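(* Every free semigroup algebra $\mathcal{S}$ (on any number $n$ of generators) is reflexive.
   Context: Let $n\in\{1,2,3,\dots\}\cup\{\infty\}$. A free semigroup algebra $\mathcal{S}$ on $n$ generators is the weak-operator-closed (in general non-self-adjoint) subalgebra of $\mathcal{B}(\mathcal{H})$ generated by the identity and isometries $S_1,\dots,S_n$ on a complex Hilbert space $\mathcal{H}$ satisfying $S_i^*S_i=I$ and $S_i^*S_j=0$ for $i\neq j$. For $x\in\mathcal{H}$, $\mathcal{S}[x]$ denotes the norm closure of $\{Ax:A\in\mathcal{S}\}$. A subspace $\mathcal{S}$ of $\mathcal{B}(\mathcal{H})$ is reflexive if it contains every $T\in\mathcal{B}(\mathcal{H})$ such that $Tx\in\mathcal{S}[x]$ for every $x\in\mathcal{H}$. *)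

theory Defs
  imports "HOL-Analysis.Analysis" "HOL-Library.Extended_Nat"
begin

class complex_hilbert_space = banach +
  fixes scaleC :: "complex \<Rightarrow> 'a \<Rightarrow> 'a" (infixr "*\<^sub>C" 75)
    and cinner :: "'a \<Rightarrow> 'a \<Rightarrow> complex"
  assumes scaleC_add_right: "c *\<^sub>C (x + y) = c *\<^sub>C x + c *\<^sub>C y"
    and scaleC_add_left: "(c + d) *\<^sub>C x = c *\<^sub>C x + d *\<^sub>C x"
    and scaleC_scaleC: "c *\<^sub>C (d *\<^sub>C x) = (c * d) *\<^sub>C x"
    and scaleR_scaleC: "r *\<^sub>R x = complex_of_real r *\<^sub>C x"
    and cinner_commute: "cinner x y = cnj (cinner y x)"
    and cinner_add_left: "cinner (x + y) z = cinner x z + cinner y z"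
    and cinner_scaleC_left: "cinner (c *\<^sub>C x) y = c * cinner x y"
    and cinner_ge_zero: "0 \<le> Re (cinner x x)"
    and cinner_eq_zero_iff: "cinner x x = 0 \<longleftrightarrow> x = 0"
    and norm_eq_sqrt_cinner: "norm x = sqrt (Re (cinner x x))"

definition bounded_operators :: "('a::complex_hilbert_space \<Rightarrow> 'a) set" where
  "bounded_operators = {A. bounded_linear A \<and> (\<forall>c x. A (c *\<^sub>C x) = c *\<^sub>C A x)}"

text \<open>For a bounded operator the adjoint exists by the Riesz representation theorem; it is
  unique because the inner product is definite.\<close>

definition cadjoint :: "('a::complex_hilbert_space \<Rightarrow> 'a) \<Rightarrow> 'a \<Rightarrow> 'a" where
  "cadjoint A = (THE B. \<forall>x y. cinner (A x) y = cinner x (B y))"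

text \<open>The coarsest topology on the bounded operators that makes every map
  \<open>A \<mapsto> cinner (A x) y\<close> continuous; compare \<^const>\<open>strong_operator_topology\<close>. Here
  \<^const>\<open>euclidean\<close> is the product topology on functions into the complex plane.\<close>

definition weak_operator_topology :: "('a::complex_hilbert_space \<Rightarrow> 'a) topology" where
  "weak_operator_topology =
     pullback_topology bounded_operators (\<lambda>A (x, y). cinner (A x) y) euclidean"

definition operator_subspace :: "('a::complex_hilbert_space \<Rightarrow> 'a) set \<Rightarrow> bool" where
  "operator_subspace \<A> \<longleftrightarrow>
     \<A> \<subseteq> bounded_operators \<and>
     (\<lambda>x. 0) \<in> \<A> \<and>
     (\<forall>A\<in>\<A>. \<forall>B\<in>\<A>. (\<lambda>x. A x + B x) \<in> \<A>) \<and>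
     (\<forall>c. \<forall>A\<in>\<A>. (\<lambda>x. c *\<^sub>C A x) \<in> \<A>)"

definition operator_algebra :: "('a::complex_hilbert_space \<Rightarrow> 'a) set \<Rightarrow> bool" where
  "operator_algebra \<A> \<longleftrightarrow> operator_subspace \<A> \<and> (\<forall>A\<in>\<A>. \<forall>B\<in>\<A>. A \<circ> B \<in> \<A>)"

text \<open>An \<open>n\<close>-tuple is a sequence of which only the entries with index \<open>i < n\<close> matter; for
  \<open>n = \<infinity>\<close> these are all entries.\<close>

definition isometric_tuple :: "enat \<Rightarrow> (nat \<Rightarrow> 'a::complex_hilbert_space \<Rightarrow> 'a) \<Rightarrow> bool" where
  "isometric_tuple n S \<longleftrightarrow>
     (\<forall>i. enat i < n \<longrightarrow> S i \<in> bounded_operators \<and> cadjoint (S i) \<circ> S i = id) \<and>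
     (\<forall>i j. enat i < n \<longrightarrow> enat j < n \<longrightarrow> i \<noteq> j \<longrightarrow> cadjoint (S i) \<circ> S j = (\<lambda>x. 0))"

definition free_semigroup_algebra ::
    "enat \<Rightarrow> (nat \<Rightarrow> 'a::complex_hilbert_space \<Rightarrow> 'a) \<Rightarrow> ('a \<Rightarrow> 'a) set" where
  "free_semigroup_algebra n S =
     (\<lambda>\<A>. operator_algebra \<A> \<and> closedin weak_operator_topology \<A>) hull
       (insert id {S i |i. enat i < n})"

definition reflexive_subspace :: "('a::complex_hilbert_space \<Rightarrow> 'a) set \<Rightarrow> bool" where
  "reflexive_subspace \<S> \<longleftrightarrow>
     operator_subspace \<S> \<and>
     (\<forall>T\<in>bounded_operators. (\<forall>x. T x \<in> closure {A x |A. A \<in> \<S>}) \<longrightarrow> T \<in> \<S>)"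

end

(* Write S[x] for the closed span of the vectors S_v x, v a word, and call z wandering if <S_v z, z> = 0 for
   every nonempty word v. The Wold decomposition gives S[x] = S[z] (+) K with z wandering
       and K reducing.
   Let T leave all cyclic subspaces S[x] of H invariant. Then T commutes with every projection
       that commutes
   with all S_i and S_i^*, hence, by spectral theory, with their whole commutant, so its
       ampliations to H^k
   leave reducing subspaces invariant. As the algebra is weakly closed, it remains to show that the
   ampliation of T maps S[z] into itself for each wandering vector z of H^k.

   Suppose H has a wandering unit vector w. For a bounded intertwiner X from S[w] to H
       and the isometric
   intertwiner V_k with V_k w = S_a^k w, the range of X + r V_k is closed
       and invariant once r > |X|. Letting r,
   and then k, tend to infinity, one gets T X = X T on S[w]; and z is the image of w under such an X
   with values in H^k.

   So one has to find a wandering vector in H when H^k has one. For a single unitary generator,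
       the coordinates
   of z define intertwiners from the bilateral shift. Since its commutant is commutative, they can
       be glued
   along spectral projections to an intertwiner that is bounded below. For two generators p
       and q, suppose that
   H has no wandering vector; then all S[x] are reducing. Successive approximation starting from a
       coordinate
   of z yields y and y' in H with <S_v y, y'> = 1 if v is empty and 0 otherwise, which is a
       contradiction because
   y lies in the closed span of the S_v y with v nonempty. The corrections are multiples of S_w x'
       with
   w = p q^k. This word does not overlap itself, so S_w x' is almost wandering for large k;
       and x' can be chosen
   with arbitrarily small coefficients <x', S_v y>. *)
theory Submission
  imports Defs "HOL-Library.Sublist"
begin

subsection \<open>Hilbert spaces\<close>

text \<open>Ampliations enter because a basic weak neighbourhood of \<open>T\<close> tests only
  finitely many pairs \<open>(x, y)\<close>. Collect the vectors x in one vector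
  \<open>\<xi>\<close> of H^k: once the ampliation of \<open>T\<close> sends \<open>\<xi>\<close>
  into the closed span of the words applied to \<open>\<xi>\<close>, elements of the algebra
  approximate \<open>T\<close> at all these x simultaneously. The hypothesis on \<open>T\<close>
  concerns k = 1 only, and passing to larger k is the whole difficulty. Hilbert spaces are types, so
  H^k is modelled by the vectors of an \<open>l2\<close> sum that are supported in a given finite
  set.

  The parameter r works because \<open>T\<close> sends X f + r V_k f to X g + r V_k g with an
  unknown g. As \<open>T\<close> commutes with V_k on S[w], the vector T X f - X T f is the image of
  g - T f under X + r V_k. Hence g - T f is O(1/r), and in the limit the vector lies in S[S_a^k w].
  These subspaces decrease to 0.

  In the approximation both corrections have norm at most the square root of the current error,
  since the error is governed by a pairing of y with y'. It drops by a factor 4 per step, so the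
  corrections are dominated by a geometric series with ratio 1/2.\<close>

lemma cinner_add_right: "cinner x (y + z) = cinner x y + cinner x z"
  by (metis cinner_add_left cinner_commute complex_cnj_add)

lemma cinner_scaleC_right: "cinner x (c *\<^sub>C y) = cnj c * cinner x y"
  by (metis cinner_scaleC_left cinner_commute complex_cnj_mult)

lemma cinner_self: "cinner x x = of_real ((norm x)\<^sup>2)"
proof -
  have "Im (cinner x x) = 0"
    using arg_cong[OF cinner_commute[of x x], of Im] by simp
  moreover have "Re (cinner x x) = (norm x)\<^sup>2"
    using cinner_ge_zero[of x] by (simp add: norm_eq_sqrt_cinner)
  ultimately show ?thesis by (simp add: complex_eq_iff)
qed

lemma scaleC_one [simp]: "1 *\<^sub>C x = x"
  by (metis of_real_1 scaleR_one scaleR_scaleC)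

lemma scaleC_zero_left [simp]: "0 *\<^sub>C x = 0"
  by (metis of_real_0 scaleR_zero_left scaleR_scaleC)

lemma scaleC_zero_right [simp]: "c *\<^sub>C 0 = 0"
  by (metis add_cancel_right_right scaleC_add_right)

lemma scaleC_minus_one: "(-1) *\<^sub>C x = - x"
  by (metis of_real_1 of_real_minus scaleR_minus1_left scaleR_scaleC)

lemma scaleC_minus_right: "c *\<^sub>C (- x) = - (c *\<^sub>C x)"
  by (metis scaleC_minus_one scaleC_scaleC mult.commute)

lemma scaleC_minus_left: "(- c) *\<^sub>C x = - (c *\<^sub>C x)"
  by (metis scaleC_minus_one scaleC_scaleC mult_minus1)

lemma scaleC_diff_right: "c *\<^sub>C (x - y) = c *\<^sub>C x - c *\<^sub>C y"
  by (metis diff_conv_add_uminus scaleC_add_right scaleC_minus_right)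

lemma scaleC_diff_left: "(c - d) *\<^sub>C x = c *\<^sub>C x - d *\<^sub>C x"
  by (metis diff_conv_add_uminus scaleC_add_left scaleC_minus_left)

lemma scaleC_sum_right: "c *\<^sub>C (\<Sum>i\<in>A. f i) = (\<Sum>i\<in>A. c *\<^sub>C f i)"
  for f :: "'i \<Rightarrow> 'a::complex_hilbert_space"
  by (induction A rule: infinite_finite_induct) (simp_all add: scaleC_add_right)

lemma mult_cnj_cmod: "z * cnj z = (of_real (cmod z))\<^sup>2"
  by (simp add: complex_norm_square flip: of_real_power)

lemma norm_scaleC: "norm (c *\<^sub>C x) = cmod c * norm x"
proof -
  have "of_real ((norm (c *\<^sub>C x))\<^sup>2) = (of_real ((cmod c * norm x)\<^sup>2) :: complex)"
    unfolding cinner_self[symmetric] cinner_scaleC_left cinner_scaleC_right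
    by (simp add: cinner_self mult_cnj_cmod power_mult_distrib mult_ac)
  then have "(norm (c *\<^sub>C x))\<^sup>2 = (cmod c * norm x)\<^sup>2" using of_real_eq_iff by blast
  then show ?thesis by (simp add: power2_eq_iff_nonneg)
qed

lemma cinner_scaleR_left: "cinner (r *\<^sub>R x) y = r *\<^sub>R cinner x y"
  by (simp add: scaleR_scaleC cinner_scaleC_left scaleR_conv_of_real)

lemma cinner_scaleR_right: "cinner x (r *\<^sub>R y) = r *\<^sub>R cinner x y"
  by (simp add: scaleR_scaleC cinner_scaleC_right scaleR_conv_of_real)

lemma norm_diff_sq: "(norm (x - y))\<^sup>2 = (norm x)\<^sup>2 - 2 * Re (cinner x y) + (norm y)\<^sup>2"
proof -
  have "cinner (x - y) (x - y) = cinner (x + (-1) *\<^sub>C y) (x + (-1) *\<^sub>C y)"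
    by (simp add: scaleC_minus_one)
  also have "\<dots> = cinner x x - cinner x y - cinner y x + cinner y y"
    by (simp add: cinner_add_left cinner_add_right cinner_scaleC_left cinner_scaleC_right)
  finally have "Re (cinner (x - y) (x - y)) = (norm x)\<^sup>2 - 2 * Re (cinner x y) + (norm y)\<^sup>2"
    using cinner_commute[of y x] by (simp add: cinner_self)
  then show ?thesis by (simp add: cinner_self)
qed

lemma norm_add_sq: "(norm (x + y))\<^sup>2 = (norm x)\<^sup>2 + 2 * Re (cinner x y) + (norm y)\<^sup>2"
proof -
  have "cinner x ((-1) *\<^sub>C y) = - cinner x y" by (simp only: cinner_scaleC_right) simp
  then show ?thesis using norm_diff_sq[of x "- y"] by (simp add: scaleC_minus_one)
qed

lemma pythagoras: "cinner x y = 0 \<Longrightarrow> (norm (x + y))\<^sup>2 = (norm x)\<^sup>2 + (norm y)\<^sup>2"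
  by (simp add: norm_add_sq)

text \<open>Nonnegativity of the left side gives the Cauchy-Schwarz inequality; the same identity
  shows that a nearest point of a closed subspace leaves an orthogonal residual.\<close>

lemma norm_minus_component_sq:
  fixes x y :: "'a::complex_hilbert_space"
  assumes "y \<noteq> 0"
  shows "(norm (x - (cinner x y / cinner y y) *\<^sub>C y))\<^sup>2 = (norm x)\<^sup>2 - (cmod (cinner x y))\<^sup>2 /
      (norm y)\<^sup>2"
proof -
  define t where "t = cinner x y / cinner y y"
  have "cnj t * cinner x y = of_real ((cmod (cinner x y))\<^sup>2 / (norm y)\<^sup>2)"
    using assms by (simp add: t_def cinner_self mult_cnj_cmod mult.commute[of "cnj _"])
  moreover have "(cmod t)\<^sup>2 * (norm y)\<^sup>2 = (cmod (cinner x y))\<^sup>2 / (norm y)\<^sup>2"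
    using assms by (simp add: t_def cinner_self norm_divide power_divide norm_mult power2_eq_square)
  ultimately show ?thesis
    unfolding t_def[symmetric] norm_diff_sq cinner_scaleC_right norm_scaleC power_mult_distrib
        by simp
qed

lemma cinner_norm_ineq: "cmod (cinner x y) \<le> norm x * norm y"
proof (cases "y = 0")
  case True then show ?thesis using cinner_add_right[of x 0 0] by simp
next
  case False
  then have "0 \<le> (norm x)\<^sup>2 - (cmod (cinner x y))\<^sup>2 / (norm y)\<^sup>2"
    using zero_le_power2 unfolding norm_minus_component_sq[OF False, symmetric] by blast
  then have "(cmod (cinner x y))\<^sup>2 \<le> (norm x * norm y)\<^sup>2"
    using False by (simp add: divide_simps power_mult_distrib split: if_splits)
  then show ?thesis by (rule power2_le_imp_le) simp
qed

interpretation cinner: bounded_bilinear "cinner :: 'a::complex_hilbert_space \<Rightarrow> _"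
  by unfold_locales
    (auto simp: cinner_add_left cinner_add_right cinner_scaleR_left cinner_scaleR_right
        intro!: exI[of _ 1] cinner_norm_ineq)

interpretation scaleC: bounded_bilinear "scaleC :: complex \<Rightarrow> 'a \<Rightarrow> 'a::complex_hilbert_space"
  by unfold_locales
    (auto simp: scaleC_add_left scaleC_add_right scaleR_scaleC scaleC_scaleC scaleR_conv_of_real
      norm_scaleC mult_ac intro!: exI[of _ 1])

declare cinner.zero_right [simp] cinner.zero_left [simp]

lemma cinner_ext: "(\<And>y. cinner x y = cinner z y) \<Longrightarrow> x = z"
  by (metis cinner_eq_zero_iff right_minus_eq cinner.diff_left)

lemma cinner_ext_right: "(\<And>y. cinner y x = cinner y z) \<Longrightarrow> x = z"
  by (metis cinner_eq_zero_iff right_minus_eq cinner.diff_right)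

section \<open>Closed complex subspaces and orthogonal projections\<close>

definition csub :: "'a::complex_hilbert_space set \<Rightarrow> bool" where
  "csub K \<longleftrightarrow> closed K \<and> 0 \<in> K \<and> (\<forall>x\<in>K. \<forall>y\<in>K. x + y \<in> K) \<and> (\<forall>c. \<forall>x\<in>K. c *\<^sub>C x \<in> K)"

lemma csubD:
  assumes "csub K"
  shows csub_closed: "closed K" and csub_0: "0 \<in> K"
    and csub_add: "\<And>x y. x \<in> K \<Longrightarrow> y \<in> K \<Longrightarrow> x + y \<in> K"
    and csub_scale: "\<And>c x. x \<in> K \<Longrightarrow> c *\<^sub>C x \<in> K"
    and csub_diff: "\<And>x y. x \<in> K \<Longrightarrow> y \<in> K \<Longrightarrow> x - y \<in> K"
proof -
  show "closed K" "0 \<in> K" "\<And>x y. x \<in> K \<Longrightarrow> y \<in> K \<Longrightarrow> x + y \<in> K" and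
    scale: "\<And>c x. x \<in> K \<Longrightarrow> c *\<^sub>C x \<in> K"
    using assms by (auto simp: csub_def)
  show "x - y \<in> K" if "x \<in> K" "y \<in> K" for x y
    using that assms unfolding csub_def by (metis diff_conv_add_uminus scaleC_minus_one)
qed

lemma csub_sum: "csub K \<Longrightarrow> (\<And>i. i \<in> A \<Longrightarrow> f i \<in> K) \<Longrightarrow> sum f A \<in> K"
  by (induction A rule: infinite_finite_induct) (auto simp: csub_0 csub_add)

lemma csub_Inter: "(\<And>K. K \<in> F \<Longrightarrow> csub K) \<Longrightarrow> csub (\<Inter>F)"
  unfolding csub_def by (auto intro: closed_Inter)

lemma csub_Int: "csub K \<Longrightarrow> csub L \<Longrightarrow> csub (K \<inter> L)"
  unfolding csub_def by auto

text \<open>This makes \<open>csub hull X\<close> the closed complex linear span of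
  \<open>X\<close>.\<close>

lemma csub_hull: "csub (csub hull X)"
  unfolding hull_def by (rule csub_Inter) auto

lemma csub_orth: "csub {x. \<forall>y\<in>X. cinner x y = 0}"
proof -
  have "{x. \<forall>y\<in>X. cinner x y = 0} = (\<Inter>y\<in>X. (\<lambda>x. cinner x y) -` {0})" by auto
  moreover have "closed ((\<lambda>x. cinner x y) -` {0})" for y
    by (rule continuous_closed_vimage[OF closed_singleton])
      (rule linear_continuous_at[OF cinner.bounded_linear_left])
  then have "closed (\<Inter>y\<in>X. (\<lambda>x. cinner x y) -` {0})" by blast
  ultimately show ?thesis
    by (simp add: csub_def cinner.add_left cinner_scaleC_left)
qed

text \<open>The minimising sequence is Cauchy by the parallelogram law.\<close>

theorem projection_exists:
  fixes x :: "'a::complex_hilbert_space"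
  assumes K: "csub K"
  obtains p where "p \<in> K" "\<And>y. y \<in> K \<Longrightarrow> cinner (x - p) y = 0"
proof -
  define d where "d = (INF y\<in>K. (norm (x - y))\<^sup>2)"
  have bdd: "bdd_below ((\<lambda>y. (norm (x - y))\<^sup>2) ` K)" by (intro bdd_belowI2[of _ 0]) simp
  have d: "d \<le> (norm (x - y))\<^sup>2" if "y \<in> K" for y
    unfolding d_def using that bdd by (intro cINF_lower)
  have "\<exists>y\<in>K. (norm (x - y))\<^sup>2 < d + 1 / Suc n" for n
  proof (rule ccontr)
    assume "\<not> ?thesis"
    then have "d + 1 / Suc n \<le> d" unfolding d_def
      using csub_0[OF K] by (intro cINF_greatest) (auto simp: d_def not_less)
    then show False by simp
  qed
  then obtain f where f: "\<And>n. f n \<in> K" "\<And>n. (norm (x - f n))\<^sup>2 < d + 1 / Suc n" by metis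
  have par: "(norm (f m - f n))\<^sup>2 \<le> 2 / Suc m + 2 / Suc n" for m n
  proof -
    let ?a = "x - f m" and ?b = "x - f n"
    have "(norm (?a - ?b))\<^sup>2 + (norm (?a + ?b))\<^sup>2 = 2 * (norm ?a)\<^sup>2 + 2 * (norm ?b)\<^sup>2"
      using norm_add_sq[of ?a ?b] norm_diff_sq[of ?a ?b] by linarith
    moreover have "?a + ?b = 2 *\<^sub>R (x - (1/2) *\<^sub>R (f m + f n))" by (simp add: algebra_simps
        scaleR_2)
    moreover have "(norm (x - (1/2) *\<^sub>R (f m + f n)))\<^sup>2 \<ge> d"
      using K f by (intro d) (simp only: scaleR_scaleC csub_add csub_scale)
    moreover have "norm (?a - ?b) = norm (f m - f n)" by (simp add: norm_minus_commute)
    ultimately show ?thesis using f(2)[of m] f(2)[of n] by (simp add: power_mult_distrib)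
  qed
  have "Cauchy f"
  proof (rule metric_CauchyI)
    fix e :: real assume e: "e > 0"
    obtain N where N: "4 / e\<^sup>2 < real N" using reals_Archimedean2 by blast
    have "dist (f m) (f n) < e" if "m \<ge> N" "n \<ge> N" for m n
    proof -
      have "2 / real (Suc m) \<le> 2 / Suc N" "2 / real (Suc n) \<le> 2 / Suc N" using that
          by (auto simp: frac_le)
      moreover have "4 / Suc N < e\<^sup>2"
        using N e by (simp add: field_simps)
          (smt (verit, best) zero_less_power2)
      ultimately have "(norm (f m - f n))\<^sup>2 < e\<^sup>2" using par[of m n] by simp
      then show ?thesis using e by (simp add: dist_norm power_less_imp_less_base)
    qed
    then show "\<exists>M. \<forall>m\<ge>M. \<forall>n\<ge>M. dist (f m) (f n) < e" by blast
  qed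
  then obtain p where p: "f \<longlonglongrightarrow> p" using Cauchy_convergent convergent_def by blast
  have pK: "p \<in> K" using K f(1) p csub_closed closed_sequentially by blast
  have "(\<lambda>n. (norm (x - f n))\<^sup>2) \<longlonglongrightarrow> (norm (x - p))\<^sup>2" by (intro tendsto_intros p)
  moreover have "(\<lambda>n. d + 1 / Suc n) \<longlonglongrightarrow> d + 0"
    by (intro tendsto_intros LIMSEQ_Suc lim_1_over_n)
  ultimately have dp: "(norm (x - p))\<^sup>2 \<le> d" using f(2)
    by (intro LIMSEQ_le[of _ _ "\<lambda>n. d + 1 / Suc n"]) (auto intro: less_imp_le)
  have "cinner (x - p) y = 0" if y: "y \<in> K" for y
  proof (cases "y = 0")
    case False
    \<comment> \<open>Moving \<open>p\<close> by the component of \<open>x - p\<close> along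
      \<open>y\<close> would get closer to \<open>x\<close> than the minimal distance unless that
      component vanishes.\<close>
    let ?t = "cinner (x - p) y / cinner y y"
    have "d \<le> (norm (x - (p + ?t *\<^sub>C y)))\<^sup>2" using K pK y by (intro d) (simp add: csub_add
        csub_scale)
    also have "x - (p + ?t *\<^sub>C y) = (x - p) - ?t *\<^sub>C y" by simp
    also have "(norm \<dots>)\<^sup>2 = (norm (x - p))\<^sup>2 - (cmod (cinner (x - p) y))\<^sup>2 / (norm y)\<^sup>2"
      by (rule norm_minus_component_sq[OF False])
    finally have "(cmod (cinner (x - p) y))\<^sup>2 / (norm y)\<^sup>2 \<le> 0" using dp by simp
    then show ?thesis using False by (simp add: divide_le_0_iff)
  qed simp
  then show thesis using pK that by blast
qed

definition cproj :: "'a::complex_hilbert_space set \<Rightarrow> 'a \<Rightarrow> 'a" where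
  "cproj K x = (SOME p. p \<in> K \<and> (\<forall>y\<in>K. cinner (x - p) y = 0))"

lemma cproj:
  assumes "csub K"
  shows cproj_in: "cproj K x \<in> K" and cproj_orth: "y \<in> K \<Longrightarrow> cinner (x - cproj K x) y = 0"
proof -
  have "\<exists>p. p \<in> K \<and> (\<forall>y\<in>K. cinner (x - p) y = 0)" using projection_exists[OF assms] by metis
  then have "cproj K x \<in> K \<and> (\<forall>y\<in>K. cinner (x - cproj K x) y = 0)" unfolding cproj_def
      by (rule someI_ex)
  then show "cproj K x \<in> K" "y \<in> K \<Longrightarrow> cinner (x - cproj K x) y = 0" by auto
qed

lemma cproj_unique:
  assumes K: "csub K" and p: "p \<in> K" "\<And>y. y \<in> K \<Longrightarrow> cinner (x - p) y = 0"
  shows "cproj K x = p"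
proof -
  let ?z = "cproj K x - p"
  have z: "?z \<in> K" using K p cproj_in csub_diff by blast
  have "?z = (x - p) - (x - cproj K x)" by simp
  then have "cinner ?z ?z = cinner (x - p) ?z - cinner (x - cproj K x) ?z"
    by (metis cinner.diff_left)
  also have "\<dots> = 0" by (simp only: p(2)[OF z] cproj_orth[OF K z]) simp
  finally have "?z = 0" by (simp only: cinner_eq_zero_iff)
  then show ?thesis by simp
qed

lemma cproj_id: "csub K \<Longrightarrow> x \<in> K \<Longrightarrow> cproj K x = x"
  by (rule cproj_unique) auto

text \<open>The residual \<open>x - cproj K x\<close> is a vector orthogonal to \<open>K\<close>, so
  by assumption it is orthogonal to \<open>x\<close> as well, hence to itself.\<close>

lemma csub_bicomplement:
  assumes "csub K" "\<And>y. (\<And>z. z \<in> K \<Longrightarrow> cinner y z = 0) \<Longrightarrow> cinner x y = 0" shows "x \<in> K"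
proof -
  let ?y = "x - cproj K x"
  have "cinner x ?y = 0" using assms(2) cproj_orth[OF assms(1)] by blast
  moreover have "cinner ?y (cproj K x) = 0" by (rule cproj_orth[OF assms(1) cproj_in[OF assms(1)]])
  then have "cinner (cproj K x) ?y = 0" by (metis cinner_commute complex_cnj_zero)
  ultimately have "cinner ?y ?y = 0" by (simp add: cinner.diff_left[of x])
  then have "?y = 0" by (simp only: cinner_eq_zero_iff)
  then have "x = cproj K x" by simp
  then show ?thesis using cproj_in[OF assms(1)] by metis
qed

subsection \<open>Bounded operators and adjoints\<close>

text \<open>The condition of \<open>bounded_operators\<close>, but for maps between two possibly
  different spaces, as analysis operators and intertwiners are.\<close>

definition cbop :: "('a::complex_hilbert_space \<Rightarrow> 'b::complex_hilbert_space) \<Rightarrow> bool" where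
  "cbop A \<longleftrightarrow> bounded_linear A \<and> (\<forall>c x. A (c *\<^sub>C x) = c *\<^sub>C A x)"

lemma bounded_operators_cbop: "A \<in> bounded_operators \<longleftrightarrow> cbop A"
  by (simp add: bounded_operators_def cbop_def)

lemma cbopD:
  assumes "cbop A"
  shows cbop_bl: "bounded_linear A" and cbop_scale: "A (c *\<^sub>C x) = c *\<^sub>C A x"
    and cbop_add: "A (x + y) = A x + A y" and cbop_diff: "A (x - y) = A x - A y"
    and cbop_0: "A 0 = 0" and cbop_sum: "A (\<Sum>i\<in>F. f i) = (\<Sum>i\<in>F. A (f i))"
    and cbop_cont: "continuous_on X A"
proof -
  show bl: "bounded_linear A" "A (c *\<^sub>C x) = c *\<^sub>C A x" using assms by (auto simp: cbop_def)
  interpret bounded_linear A by fact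
  show "A (x + y) = A x + A y" "A (x - y) = A x - A y" "A 0 = 0" "A (\<Sum>i\<in>F. f i) = (\<Sum>i\<in>F. A (f i))"
    by (auto simp: add diff zero sum)
  show "continuous_on X A" by (rule linear_continuous_on) fact
qed

lemma cbop_bound:
  assumes "cbop A" obtains c where "c > 0" "\<And>x. norm (A x) \<le> c * norm x"
  using bounded_linear.pos_bounded[OF cbop_bl[OF assms]] by (auto simp: mult.commute)

lemma cbopI:
  assumes "\<And>x y. A (x + y) = A x + A y" "\<And>c x. A (c *\<^sub>C x) = c *\<^sub>C A x" "\<And>x. norm (A x)
      \<le> c * norm x"
  shows "cbop A"
  unfolding cbop_def
  by (auto intro!: bounded_linear_intro[of A c] simp: assms scaleR_scaleC mult.commute)

lemma cbop_id [simp]: "cbop (\<lambda>x. x)" "cbop id"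
  by (auto intro!: cbopI[of _ 1])

lemma cbop_zero [simp]: "cbop (\<lambda>x. 0)"
  by (auto intro!: cbopI[of _ 1])

lemma cbop_compose: "cbop A \<Longrightarrow> cbop B \<Longrightarrow> cbop (\<lambda>x. A (B x))"
  by (auto simp: cbop_def intro: bounded_linear_compose)

lemma cbop_plus: "cbop A \<Longrightarrow> cbop B \<Longrightarrow> cbop (\<lambda>x. A x + B x)"
  by (auto simp: cbop_def scaleC_add_right intro: bounded_linear_add)

lemma cbop_minus: "cbop A \<Longrightarrow> cbop B \<Longrightarrow> cbop (\<lambda>x. A x - B x)"
  by (auto simp: cbop_def scaleC_diff_right intro: bounded_linear_sub)

lemma cbop_scaleC: "cbop A \<Longrightarrow> cbop (\<lambda>x. c *\<^sub>C A x)"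
  by (auto simp: cbop_def scaleC_scaleC mult.commute intro: scaleC.bounded_linear_right
      bounded_linear_compose)

lemma cbop_cproj:
  assumes K: "csub K" shows "cbop (cproj K)"
proof (rule cbopI[of _ 1])
  show "cproj K (x + y) = cproj K x + cproj K y" for x y
  proof (rule cproj_unique[OF K])
    show "cproj K x + cproj K y \<in> K" using K cproj_in csub_add by blast
    show "cinner (x + y - (cproj K x + cproj K y)) z = 0" if "z \<in> K" for z
      using cproj_orth[OF K that, of x] cproj_orth[OF K that, of y] by (simp add: cinner.diff_left
          cinner.add_left)
  qed
  show "cproj K (c *\<^sub>C x) = c *\<^sub>C cproj K x" for c x
  proof (rule cproj_unique[OF K])
    show "c *\<^sub>C cproj K x \<in> K" using K cproj_in csub_scale by blast
    show "cinner (c *\<^sub>C x - c *\<^sub>C cproj K x) z = 0" if "z \<in> K" for z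
      using cproj_orth[OF K that, of x] by (simp add: cinner_scaleC_left flip: scaleC_diff_right)
  qed
  show "norm (cproj K x) \<le> 1 * norm x" for x
  proof -
    have "(norm ((x - cproj K x) + cproj K x))\<^sup>2 = (norm (x - cproj K x))\<^sup>2 + (norm (cproj K x))\<^sup>2"
      by (rule pythagoras) (rule cproj_orth[OF K cproj_in[OF K]])
    then have "(norm (cproj K x))\<^sup>2 \<le> (norm x)\<^sup>2" by simp
    then show ?thesis by simp
  qed
qed

lemma cproj_selfadj:
  assumes K: "csub K" shows "cinner (cproj K x) y = cinner x (cproj K y)"
proof -
  have "cinner (x - cproj K x) (cproj K y) = 0" "cinner (y - cproj K y) (cproj K x) = 0"
    by (rule cproj_orth[OF K cproj_in[OF K]])+
  then have "cinner x (cproj K y) = cinner (cproj K x) (cproj K y)"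
    "cinner y (cproj K x) = cinner (cproj K y) (cproj K x)"
    by (simp_all add: cinner.diff_left)
  then show ?thesis using cinner_commute[of "cproj K x" y] cinner_commute[of "cproj K x" "cproj K
      y"]
    by simp
qed

lemma cbop_preimage_csub:
  assumes "cbop A" "csub K" shows "csub {x. A x \<in> K}"
proof -
  have "closed (A -` K)"
    using assms by (intro closed_vimage) (auto simp: csub_closed intro: cbop_cont)
  then show ?thesis using assms
    by (auto simp: csub_def vimage_def cbop_0 cbop_add cbop_scale)
qed

lemma cbop_hull_minimal:
  assumes "cbop A" "csub K" "\<And>x. x \<in> X \<Longrightarrow> A x \<in> K" "x \<in> csub hull X" shows "A x \<in> K"
  using hull_minimal[of X "{x. A x \<in> K}" csub] assms cbop_preimage_csub by blast

theorem riesz_representation: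
  fixes f :: "'a::complex_hilbert_space \<Rightarrow> complex"
  assumes f: "bounded_linear f" "\<And>c x. f (c *\<^sub>C x) = c * f x"
  obtains z where "\<And>x. f x = cinner x z"
proof (cases "\<forall>x. f x = 0")
  case True then show ?thesis using that[of 0] by simp
next
  case False
  then obtain x0 where x0: "f x0 \<noteq> 0" by blast
  interpret f: bounded_linear f by (rule f)
  have K: "csub {x. f x = 0}"
    unfolding csub_def
    by (auto simp: f.add f.zero f intro!: closed_Collect_eq linear_continuous_on f)
  define y where "y = x0 - cproj {x. f x = 0} x0"
  have fy: "f y = f x0" using cproj_in[OF K, of x0] by (simp add: y_def f.diff)
  have orth: "cinner y x = 0" if "f x = 0" for x
    unfolding y_def using cproj_orth[OF K] that by auto
  have y0: "y \<noteq> 0" using fy x0 f.zero by auto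
  have "f x = cinner x ((cnj (f y) / of_real ((norm y)\<^sup>2)) *\<^sub>C y)" for x
  proof -
    have "f (f y *\<^sub>C x - f x *\<^sub>C y) = 0" by (simp add: f.diff f)
    then have "cinner (f y *\<^sub>C x - f x *\<^sub>C y) y = 0" using orth cinner_commute
        by (metis complex_cnj_zero)
    then have "f y * cinner x y = f x * of_real ((norm y)\<^sup>2)"
      by (simp add: cinner.diff_left cinner_scaleC_left cinner_self)
    then show ?thesis using y0 by (simp add: cinner_scaleC_right field_simps)
  qed
  then show ?thesis by (rule that)
qed

definition adj :: "('a::complex_hilbert_space \<Rightarrow> 'b::complex_hilbert_space) \<Rightarrow> 'b \<Rightarrow> 'a" where
  "adj A y = (SOME z. \<forall>x. cinner (A x) y = cinner x z)"

lemma cinner_adj: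
  assumes A: "cbop A" shows "cinner (A x) y = cinner x (adj A y)"
proof -
  have "bounded_linear (\<lambda>x. cinner (A x) y)"
    by (rule bounded_linear_compose[OF cinner.bounded_linear_left cbop_bl[OF A]])
  then obtain z where "\<And>x. cinner (A x) y = cinner x z"
    using riesz_representation[of "\<lambda>x. cinner (A x) y"] A by (auto simp: cbop_scale
        cinner_scaleC_left)
  then have "\<exists>z. \<forall>x. cinner (A x) y = cinner x z" by blast
  then have "\<forall>x. cinner (A x) y = cinner x (adj A y)" unfolding adj_def by (rule someI_ex)
  then show ?thesis by blast
qed

lemma cinner_adj': "cbop A \<Longrightarrow> cinner (adj A y) x = cinner y (A x)"
  by (metis cinner_adj cinner_commute)

lemma adj_unique: "cbop A \<Longrightarrow> (\<And>x. cinner (A x) y = cinner x z) \<Longrightarrow> adj A y = z"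
  by (rule cinner_ext_right) (simp add: cinner_adj[symmetric])

lemma adj_bound:
  assumes A: "cbop A" and c: "0 \<le> c" "\<And>x. norm (A x) \<le> c * norm x"
  shows "norm (adj A y) \<le> c * norm y"
proof -
  let ?z = "adj A y"
  have "(norm ?z)\<^sup>2 = cmod (cinner (A ?z) y)"
    by (simp add: cinner_adj[OF A] cinner_self norm_power)
  also have "\<dots> \<le> norm (A ?z) * norm y" by (rule cinner_norm_ineq)
  also have "\<dots> \<le> (c * norm ?z) * norm y" by (intro mult_right_mono c) simp
  finally have *: "norm ?z * norm ?z \<le> norm ?z * (c * norm y)" by (simp add: power2_eq_square
      mult_ac)
  show ?thesis
    using * c by (cases "?z = 0") (auto simp: mult_le_cancel_left)
qed

lemma cbop_adj:
  assumes A: "cbop A" shows "cbop (adj A)"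
proof -
  obtain c where c: "c > 0" "\<And>x. norm (A x) \<le> c * norm x" using cbop_bound[OF A] by blast
  show ?thesis
    by (rule cbopI[of _ c])
      (auto intro!: adj_unique[OF A] adj_bound[OF A]
        simp: cinner_add_right cinner_scaleC_right cinner_adj[OF A] c less_imp_le)
qed

lemma adj_adj [simp]: "cbop A \<Longrightarrow> adj (adj A) = A"
  by (rule ext) (simp add: adj_unique cbop_adj cinner_adj')

lemma adj_compose: "cbop A \<Longrightarrow> cbop B \<Longrightarrow> adj (\<lambda>x. A (B x)) y = adj B (adj A y)"
  by (rule adj_unique) (simp_all add: cbop_compose cinner_adj)

lemma cadjoint_eq_adj:
  assumes A: "cbop A" shows "cadjoint A = adj A"
  unfolding cadjoint_def
proof (rule the_equality)
  show "\<forall>x y. cinner (A x) y = cinner x (adj A y)" by (simp add: cinner_adj[OF A])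
  show "B = adj A" if "\<forall>x y. cinner (A x) y = cinner x (B y)" for B
    using that by (intro ext adj_unique[OF A, symmetric]) simp
qed

subsection \<open>Square roots and spectral splitting\<close>

definition selfadj :: "('a::complex_hilbert_space \<Rightarrow> 'a) \<Rightarrow> bool" where
  "selfadj A \<longleftrightarrow> cbop A \<and> (\<forall>x y. cinner (A x) y = cinner x (A y))"

lemma selfadj_cbop: "selfadj A \<Longrightarrow> cbop A"
  and selfadjD: "selfadj A \<Longrightarrow> cinner (A x) y = cinner x (A y)"
  by (auto simp: selfadj_def)

text \<open>Scalar model of the iteration \<open>Z \<mapsto> (Y + Z\<^sup>2) / 2\<close>, whose fixed point satisfies \<open>(1 - Z)\<^sup>2
    = 1 - Y\<close>.\<close>

primrec sqrt_iter_real :: "nat \<Rightarrow> real" where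
  "sqrt_iter_real 0 = 0"
| "sqrt_iter_real (Suc n) = (1 + (sqrt_iter_real n)\<^sup>2) / 2"

lemma sqrt_iter_real_bounds: "0 \<le> sqrt_iter_real n" "sqrt_iter_real n \<le> 1" "sqrt_iter_real n
    \<le> sqrt_iter_real (Suc n)"
proof -
  have *: "0 \<le> sqrt_iter_real n \<and> sqrt_iter_real n \<le> 1 \<and> sqrt_iter_real n \<le> sqrt_iter_real (Suc n)"
  proof (induction n)
    case (Suc n)
    have "(sqrt_iter_real n)\<^sup>2 \<le> (sqrt_iter_real (Suc n))\<^sup>2"
      using Suc by (intro power_mono) auto
    moreover have "(sqrt_iter_real n)\<^sup>2 \<le> 1" using Suc by (simp add: power_le_one)
    ultimately show ?case by simp
  qed simp
  then show "0 \<le> sqrt_iter_real n" "sqrt_iter_real n \<le> 1" "sqrt_iter_real n \<le> sqrt_iter_real (Suc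
      n)" by auto
qed

primrec sqrt_iter :: "('a::complex_hilbert_space \<Rightarrow> 'a) \<Rightarrow> nat \<Rightarrow> 'a \<Rightarrow> 'a" where
  "sqrt_iter Y 0 x = 0"
| "sqrt_iter Y (Suc n) x = (1/2) *\<^sub>C (Y x + sqrt_iter Y n (sqrt_iter Y n x))"

lemma scaleC_half_diff: "(1/2) *\<^sub>C x - (1/2) *\<^sub>C y = (1/2) *\<^sub>C (x - y)"
    for x y :: "'a::complex_hilbert_space"
  by (simp add: scaleC_diff_right)

text \<open>\<open>Y\<close> plays the role of 1 - P for the operator P whose square root is wanted;
  the limit \<open>Z\<close> of the iteration then gives the root 1 - Z.\<close>

locale positive_contraction_complement =
  fixes Y :: "'a::complex_hilbert_space \<Rightarrow> 'a"
  assumes Y: "selfadj Y" and Y1: "\<And>x. norm (Y x) \<le> norm x"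
begin

lemma iter_selfadj: "selfadj (sqrt_iter Y n)"
proof (induction n)
  case 0 then show ?case by (simp add: selfadj_def)
next
  case (Suc n)
  then have Z: "cbop (sqrt_iter Y n)" by (rule selfadj_cbop)
  have "cbop (\<lambda>x. (1/2) *\<^sub>C (Y x + sqrt_iter Y n (sqrt_iter Y n x)))"
    by (rule cbop_scaleC[OF cbop_plus[OF selfadj_cbop[OF Y] cbop_compose[OF Z Z]]])
  moreover have "cinner (sqrt_iter Y (Suc n) x) y = cinner x (sqrt_iter Y (Suc n) y)" for x y
  proof -
    have "cinner (sqrt_iter Y n (sqrt_iter Y n x)) y = cinner x (sqrt_iter Y n (sqrt_iter Y n y))"
      by (simp only: selfadjD[OF Suc])
    then show ?thesis
      by (simp add: cinner_scaleC_left cinner_scaleC_right cinner_add_left cinner_add_right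
          selfadjD[OF Y])
  qed
  ultimately show ?case by (simp add: selfadj_def)
qed

lemmas iter_cbop = iter_selfadj[THEN selfadj_cbop]

lemma iter_commute:
  assumes "cbop C" "\<And>x. C (Y x) = Y (C x)" shows "C (sqrt_iter Y n x) = sqrt_iter Y n (C x)"
  by (induction n arbitrary: x) (simp_all add: assms cbop_scale cbop_add cbop_0)

lemma iter_commute_iter: "sqrt_iter Y m (sqrt_iter Y n x) = sqrt_iter Y n (sqrt_iter Y m x)"
  by (rule iter_commute[OF iter_cbop]) (rule iter_commute[symmetric, OF selfadj_cbop[OF Y]], simp)

lemma iter_norm: "norm (sqrt_iter Y n x) \<le> sqrt_iter_real n * norm x"
proof (induction n arbitrary: x)
  case (Suc n)
  have "norm (sqrt_iter Y n (sqrt_iter Y n x)) \<le> sqrt_iter_real n * (sqrt_iter_real n * norm x)"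
    by (rule order_trans[OF Suc mult_left_mono[OF Suc]]) (rule sqrt_iter_real_bounds)
  then have "norm (Y x + sqrt_iter Y n (sqrt_iter Y n x)) \<le> norm x
      + sqrt_iter_real n * (sqrt_iter_real n * norm x)"
    using Y1[of x] norm_triangle_ineq by (smt (verit))
  then show ?case by (simp add: norm_scaleC norm_divide power2_eq_square algebra_simps)
qed simp

text \<open>The iterates commute, so the difference of two consecutive squares factors into
  difference times sum. Each step is therefore dominated by the same step of the bounded increasing
  scalar sequence.\<close>

lemma iter_diff_norm:
  "norm (sqrt_iter Y (Suc n) x - sqrt_iter Y n x) \<le> (sqrt_iter_real (Suc n)
      - sqrt_iter_real n) * norm x"
proof (induction n arbitrary: x)
  case 0 show ?case using Y1[of x] by (simp add: norm_scaleC norm_divide)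
next
  case (Suc n)
  let ?Z = "sqrt_iter Y" and ?r = sqrt_iter_real
  define u where "u = ?Z (Suc n) x + ?Z n x"
  have "?Z (Suc (Suc n)) x - ?Z (Suc n) x
      = (1/2) *\<^sub>C (?Z (Suc n) (?Z (Suc n) x) - ?Z n (?Z n x))"
    by (simp add: scaleC_half_diff del: sqrt_iter.simps(2) add: sqrt_iter.simps(2)[of Y "Suc n" x]
        sqrt_iter.simps(2)[of Y n x])
  also have "?Z (Suc n) (?Z (Suc n) x) - ?Z n (?Z n x) = ?Z (Suc n) u - ?Z n u"
    unfolding u_def cbop_add[OF iter_cbop] by (simp only: iter_commute_iter[of "Suc n" n]) simp
  finally have "norm (?Z (Suc (Suc n)) x - ?Z (Suc n) x) \<le> 1/2 * ((?r (Suc n) - ?r n) * norm u)"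
    using Suc[of u] by (simp only: norm_scaleC) (simp add: norm_divide)
  also have "norm u \<le> (?r (Suc n) + ?r n) * norm x"
    using iter_norm[of "Suc n" x] iter_norm[of n x] norm_triangle_ineq[of "?Z (Suc n) x" "?Z n x"]
    by (simp only: u_def distrib_right)
  then have "1/2 * ((?r (Suc n) - ?r n) * norm u) \<le> 1/2 * ((?r (Suc n) - ?r n) * ((?r (Suc n)
      + ?r n) * norm x))"
    using sqrt_iter_real_bounds(3)[of n] by (intro mult_left_mono) auto
  also have "\<dots> = (?r (Suc (Suc n)) - ?r (Suc n)) * norm x"
  proof -
    have "?r (Suc (Suc n)) - ?r (Suc n) = 1/2 * ((?r (Suc n) - ?r n) * (?r (Suc n) + ?r n))"
      by (simp only: sqrt_iter_real.simps(2)[of "Suc n"] sqrt_iter_real.simps(2)[of n])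
        (simp add: field_simps power2_eq_square)
    then show ?thesis by simp
  qed
  finally show ?case .
qed

lemma iter_Cauchy: "Cauchy (\<lambda>n. sqrt_iter Y n x)"
proof -
  have "summable (\<lambda>n. (sqrt_iter_real (Suc n) - sqrt_iter_real n) * norm x)"
  proof (rule summable_mult2)
    have "incseq sqrt_iter_real" by (intro incseq_SucI sqrt_iter_real_bounds)
    then obtain L where "sqrt_iter_real \<longlonglongrightarrow> L"
      using incseq_convergent[of sqrt_iter_real 1] sqrt_iter_real_bounds(2) by blast
    then show "summable (\<lambda>n. sqrt_iter_real (Suc n) - sqrt_iter_real n)"
      by (rule telescope_summable)
  qed
  then have "summable (\<lambda>n. sqrt_iter Y (Suc n) x - sqrt_iter Y n x)"
    by (rule summable_comparison_test'[of _ 0]) (rule iter_diff_norm)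
  then have "convergent (\<lambda>n. \<Sum>i<n. sqrt_iter Y (Suc i) x - sqrt_iter Y i x)"
    by (simp only: summable_iff_convergent)
  then have "convergent (\<lambda>n. sqrt_iter Y n x)"
    by (simp add: sum_lessThan_telescope[of "\<lambda>n. sqrt_iter Y n x"] del: sqrt_iter.simps(2))
  then show ?thesis by (rule convergent_Cauchy)
qed

definition Z :: "'a \<Rightarrow> 'a" where "Z x = lim (\<lambda>n. sqrt_iter Y n x)"

lemma iter_lim: "(\<lambda>n. sqrt_iter Y n x) \<longlonglongrightarrow> Z x"
  using iter_Cauchy Cauchy_convergent unfolding Z_def convergent_LIMSEQ_iff by blast

lemma iter_contr: "norm (sqrt_iter Y n x) \<le> norm x"
  using iter_norm[of n x] sqrt_iter_real_bounds(2)[of n]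
  by (meson mult_left_le_one_le norm_ge_zero order_trans sqrt_iter_real_bounds(1))

lemma Z_contr: "norm (Z x) \<le> norm x"
  by (rule LIMSEQ_le_const2[OF tendsto_norm[OF iter_lim]]) (use iter_contr in blast)

lemma Z_cbop: "cbop Z"
proof (rule cbopI[of _ 1])
  show "Z (x + y) = Z x + Z y" for x y
    using LIMSEQ_unique[OF iter_lim[of "x + y"]] tendsto_add[OF iter_lim iter_lim]
    by (simp only: cbop_add[OF iter_cbop])
  show "Z (c *\<^sub>C x) = c *\<^sub>C Z x" for c x
    using LIMSEQ_unique[OF iter_lim[of "c *\<^sub>C x"]] scaleC.tendsto[OF tendsto_const iter_lim]
    by (simp only: cbop_scale[OF iter_cbop])
qed (simp add: Z_contr)

lemma Z_selfadj: "selfadj Z"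
  unfolding selfadj_def
proof (intro conjI allI Z_cbop)
  show "cinner (Z x) y = cinner x (Z y)" for x y
    by (rule LIMSEQ_unique[OF cinner.tendsto[OF iter_lim tendsto_const]])
      (simp only: selfadjD[OF iter_selfadj] cinner.tendsto[OF tendsto_const iter_lim])
qed

lemma Z_commute:
  assumes "cbop C" "\<And>x. C (Y x) = Y (C x)" shows "C (Z x) = Z (C x)"
proof -
  have "(\<lambda>n. C (sqrt_iter Y n x)) \<longlonglongrightarrow> C (Z x)"
    by (rule bounded_linear.tendsto[OF cbop_bl[OF assms(1)] iter_lim])
  then show ?thesis
    unfolding iter_commute[OF assms] by (rule LIMSEQ_unique) (rule iter_lim)
qed

lemma Z_fix: "Z x = (1/2) *\<^sub>C (Y x + Z (Z x))"
proof -
  \<comment> \<open>The iterates are contractions, so the inner iterate may be replaced by its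
    limit.\<close>
  have "(\<lambda>n. sqrt_iter Y n (sqrt_iter Y n x) - sqrt_iter Y n (Z x)) \<longlonglongrightarrow> 0"
  proof (rule Lim_null_comparison)
    show "\<forall>\<^sub>F n in sequentially. norm (sqrt_iter Y n (sqrt_iter Y n x) - sqrt_iter Y n (Z x))
        \<le> norm (sqrt_iter Y n x - Z x)"
      by (simp add: iter_contr flip: cbop_diff[OF iter_cbop])
    show "(\<lambda>n. norm (sqrt_iter Y n x - Z x)) \<longlonglongrightarrow> 0"
      using iter_lim LIM_zero tendsto_norm_zero by blast
  qed
  from tendsto_add[OF this iter_lim[of "Z x"]]
  have "(\<lambda>n. sqrt_iter Y n (sqrt_iter Y n x)) \<longlonglongrightarrow> Z (Z x)" by simp
  then have "(\<lambda>n. (1/2) *\<^sub>C (Y x + sqrt_iter Y n (sqrt_iter Y n x))) \<longlonglongrightarrow> (1/2) *\<^sub>C (Y x + Z (Z x))"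
    by (intro tendsto_intros scaleC.tendsto)
  moreover have "(\<lambda>n. sqrt_iter Y (Suc n) x) \<longlonglongrightarrow> Z x" using iter_lim LIMSEQ_Suc by blast
  ultimately show ?thesis by (simp add: LIMSEQ_unique)
qed

end

lemma selfadj_one_minus: "selfadj A \<Longrightarrow> selfadj (\<lambda>x. x - A x)"
  by (simp add: selfadj_def[of "\<lambda>x. x - A x"] cbop_minus selfadj_cbop cinner.diff_left
      cinner.diff_right
      selfadjD)

text \<open>The third conclusion repeats the hypothesis for \<open>B\<close>, so that a root of the
  root can be taken; the last one places \<open>B\<close> in the double commutant of
  \<open>P\<close>.\<close>

lemma sqrt_exists:
  fixes P :: "'a::complex_hilbert_space \<Rightarrow> 'a"
  assumes "selfadj P" "\<And>x. norm (x - P x) \<le> norm x"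
  obtains B where "selfadj B" "\<And>x. B (B x) = P x" "\<And>x. norm (x - B x) \<le> norm x"
    "\<forall>C. cbop C \<longrightarrow> (\<forall>x. C (P x) = P (C x)) \<longrightarrow> (\<forall>x. C (B x) = B (C x))"
proof -
  interpret positive_contraction_complement "\<lambda>x. x - P x"
    using assms by unfold_locales (auto simp: selfadj_one_minus)
  show thesis
  proof (rule that[of "\<lambda>x. x - Z x"])
    show "selfadj (\<lambda>x. x - Z x)" by (rule selfadj_one_minus[OF Z_selfadj])
    show "x - Z x - Z (x - Z x) = P x" for x
    proof -
      have "Z x + Z x = x - P x + Z (Z x)"
        using arg_cong[OF Z_fix[of x], of "\<lambda>u. 2 *\<^sub>C u"] scaleC_add_left[of 1 1 "Z x"]
        by (simp add: scaleC_scaleC)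
      then show ?thesis by (simp add: cbop_diff[OF Z_cbop] algebra_simps)
    qed
    show "norm (x - (x - Z x)) \<le> norm x" for x using Z_contr by simp
    show "\<forall>C. cbop C \<longrightarrow> (\<forall>x. C (P x) = P (C x)) \<longrightarrow> (\<forall>x. C (x - Z x) = C x - Z (C x))"
      by (simp add: Z_commute cbop_diff)
  qed
qed

lemma cproj_eq_0: "csub E \<Longrightarrow> cproj E x = 0 \<Longrightarrow> y \<in> E \<Longrightarrow> cinner x y = 0"
  using cproj_orth[of E y x] by simp

lemma cproj_commute:
  assumes E: "csub E" and C: "cbop C" "\<And>x. x \<in> E \<Longrightarrow> C x \<in> E" "\<And>x. x \<in> E \<Longrightarrow> adj C x \<in> E"
  shows "cproj E (C x) = C (cproj E x)"
proof (rule cproj_unique[OF E C(2)[OF cproj_in[OF E]]])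
  show "cinner (C x - C (cproj E x)) y = 0" if "y \<in> E" for y
    using cproj_orth[OF E C(3)[OF that], of x] by (simp add: cinner_adj C(1) flip: cbop_diff)
qed

lemma adj_selfadj: "selfadj A \<Longrightarrow> adj A = A"
  by (rule ext, rule adj_unique) (simp_all only: selfadj_cbop selfadjD)

lemma adj_commute:
  assumes "cbop A" "cbop B" "\<And>x. A (B x) = B (A x)" shows "adj A (adj B x) = adj B (adj A x)"
proof -
  have "(\<lambda>x. A (B x)) = (\<lambda>x. B (A x))" using assms(3) by blast
  then show ?thesis using adj_compose[OF assms(1,2), of x] adj_compose[OF assms(2,1), of x] by simp
qed

lemma selfadj_cinner_square: "selfadj A \<Longrightarrow> cinner (A (A x)) x = of_real ((norm (A x))\<^sup>2)"
  by (simp add: selfadjD cinner_self)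

text \<open>\<open>E = ker (\<bar>A\<bar> - A)\<close> is the spectral subspace of \<open>A\<close> for the nonnegative half line.\<close>

lemma spectral_splitting:
  fixes A :: "'a::complex_hilbert_space \<Rightarrow> 'a"
  assumes A: "selfadj A" and A1: "\<And>x. norm (A x) \<le> norm x"
  obtains E where "csub E"
    "\<forall>C. cbop C \<longrightarrow> (\<forall>x. C (A x) = A (C x)) \<longrightarrow> (\<forall>x. C (cproj E x) = cproj E (C x))"
    "\<And>x. x \<in> E \<Longrightarrow> (norm (A x))\<^sup>2 \<le> Re (cinner (A x) x)"
    "\<And>x. cproj E x = 0 \<Longrightarrow> (norm (A x))\<^sup>2 \<le> - Re (cinner (A x) x)"
proof -
  note Acb = selfadj_cbop[OF A]
  have saA: "selfadj (\<lambda>x. A (A x))"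
    by (simp add: selfadj_def cbop_compose[OF Acb Acb] selfadjD[OF A])
  have nA: "norm (x - A (A x)) \<le> norm x" for x
  proof -
    have "(norm (x - A (A x)))\<^sup>2 = (norm x)\<^sup>2 - 2 * (norm (A x))\<^sup>2 + (norm (A (A x)))\<^sup>2"
      using selfadjD[OF A, of x "A x"] by (simp add: norm_diff_sq cinner_self flip: selfadjD[OF A])
    moreover have "(norm (A (A x)))\<^sup>2 \<le> (norm (A x))\<^sup>2" using A1 by (simp add: power_mono)
    ultimately have "(norm (x - A (A x)))\<^sup>2 \<le> (norm x)\<^sup>2"
      using zero_le_power2[of "norm (A x)"] by linarith
    then show ?thesis by simp
  qed
  \<comment> \<open>\<open>B\<close> is the absolute value of \<open>A\<close>. Its own square root
    \<open>C\<close> expresses the positivity of \<open>B\<close>, and also the inequality of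
    \<open>B\<close> squared with \<open>B\<close>, through norms.\<close>
  obtain B where B: "selfadj B" "\<And>x. B (B x) = A (A x)" "\<And>x. norm (x - B x) \<le> norm x"
    and Bcom': "\<forall>C. cbop C \<longrightarrow> (\<forall>x. C (A (A x)) = A (A (C x))) \<longrightarrow> (\<forall>x. C (B x) = B (C x))"
    by (rule sqrt_exists[OF saA nA]) (rule that)
  have Bcom: "C (B x) = B (C x)" if "cbop C" "\<And>x. C (A (A x)) = A (A (C x))" for C x
    using Bcom' that by blast
  obtain C where C: "selfadj C" "\<And>x. C (C x) = B x"
    by (rule sqrt_exists[OF B(1,3)]) (rule that)
  have Bcb: "cbop B" by (rule selfadj_cbop[OF B(1)])
  have AB: "A (B x) = B (A x)" for x by (rule Bcom[OF Acb]) simp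
  have normBA: "norm (B x) = norm (A x)" for x
  proof -
    have "of_real ((norm (B x))\<^sup>2) = (of_real ((norm (A x))\<^sup>2) :: complex)"
      using selfadj_cinner_square[OF A, of x] selfadj_cinner_square[OF B(1), of x]
          by (simp only: B(2))
    then show ?thesis by (simp only: of_real_eq_iff) (simp add: power2_eq_iff_nonneg)
  qed
  have CB: "Re (cinner (B x) x) = (norm (C x))\<^sup>2" for x
    using selfadj_cinner_square[OF C(1), of x] by (simp add: C(2))
  have C1: "norm (C x) \<le> norm x" for x
  proof -
    have "(norm (C x))\<^sup>2 \<le> norm (B x) * norm x"
      using CB[of x] complex_Re_le_cmod[of "cinner (B x) x"] cinner_norm_ineq[of "B x" x]
          by linarith
    also have "\<dots> \<le> (norm x)\<^sup>2" using mult_right_mono[OF A1[of x] norm_ge_zero[of x]]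
      by (simp add: normBA power2_eq_square)
    finally show ?thesis by simp
  qed
  have main: "(norm (B x))\<^sup>2 \<le> Re (cinner (B x) x)" for x
    unfolding CB using power_mono[OF C1[of "C x"], of 2] by (simp add: C(2))
  define E where "E = {x. B x = A x}"
  have E0: "E = {x. B x - A x \<in> {0}}" by (auto simp: E_def)
  have "csub {0::'a}" by (simp add: csub_def)
  then have E: "csub E" unfolding E0 by (rule cbop_preimage_csub[OF cbop_minus[OF Bcb Acb]])
  have inv: "C x \<in> E" if "cbop C" "\<And>x. C (A x) = A (C x)" "x \<in> E" for C x
    using that Bcom[OF that(1), of x] by (simp add: E_def)
  show thesis
  proof (rule that[OF E])
    have "C (cproj E x) = cproj E (C x)" if C: "cbop C" and com: "\<And>x. C (A x) = A (C x)" for C x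
    proof (rule cproj_commute[symmetric, OF E C])
      show "C x \<in> E" if "x \<in> E" for x by (rule inv[OF C com that])
      have "adj C (A x) = A (adj C x)" for x
        using adj_commute[OF C Acb com, of x] by (simp add: adj_selfadj[OF A])
      then show "adj C x \<in> E" if "x \<in> E" for x by (rule inv[OF cbop_adj[OF C] _ that])
    qed
    then show "\<forall>C. cbop C \<longrightarrow> (\<forall>x. C (A x) = A (C x)) \<longrightarrow> (\<forall>x. C (cproj E x) = cproj E (C x))"
      by blast
    show "(norm (A x))\<^sup>2 \<le> Re (cinner (A x) x)" if "x \<in> E" for x
      using main[of x] that by (simp add: E_def)
    show "(norm (A x))\<^sup>2 \<le> - Re (cinner (A x) x)" if x: "cproj E x = 0" for x
    proof -
      have "B x + A x = 0"
      proof (rule cinner_ext)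
        fix y
        \<comment> \<open>This is the identity (B - A)(B + A) = 0. A vector orthogonal to
          \<open>E\<close> is then annihilated by B + A, so that \<open>A\<close> acts on it as
          -B.\<close>
        have "B y + A y \<in> E" by (simp add: E_def cbop_add[OF Acb] cbop_add[OF Bcb] AB B(2))
        then have "cinner x (B y + A y) = 0" by (rule cproj_eq_0[OF E x])
        then show "cinner (B x + A x) y = cinner 0 y"
          by (simp add: cinner_add_left cinner_add_right selfadjD[OF A] selfadjD[OF B(1)])
      qed
      then have "A x = - B x" by (simp add: eq_neg_iff_add_eq_0 add.commute)
      then show ?thesis using main[of x] by (simp add: cinner.minus_left)
    qed
  qed
qed

subsection \<open>Operators that preserve all reducing subspaces\<close>

text \<open>Subtracting half of the spectral symmetry \<open>P\<^sub>E - (1 - P\<^sub>E)\<close> halves the norm of \<open>A\<close> but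
  does not change the commutator with \<open>T\<close>. Iterating shows that the commutator vanishes.\<close>

lemma commutes_if_commutes_projections_selfadj:
  fixes T :: "'a::complex_hilbert_space \<Rightarrow> 'a"
  assumes T: "cbop T" and F: "\<And>C. C \<in> F \<Longrightarrow> cbop C"
    and proj: "\<And>E x. csub E \<Longrightarrow> (\<And>C x. C \<in> F \<Longrightarrow> C (cproj E x) = cproj E (C x)) \<Longrightarrow> T (cproj E x)
        = cproj E (T x)"
    and A: "selfadj A" "\<And>C x. C \<in> F \<Longrightarrow> C (A x) = A (C x)" "\<And>x. norm (A x) \<le> norm x"
  shows "T (A x) = A (T x)"
proof -
  obtain c where c: "c > 0" "\<And>x. norm (T x) \<le> c * norm x" using cbop_bound[OF T] by blast
  have main: "norm (T (A x) - A (T x)) \<le> 2 * c / 2 ^ n * norm x"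
    if "selfadj A" "\<And>C x. C \<in> F \<Longrightarrow> C (A x) = A (C x)" "\<And>x. norm (A x) \<le> norm x" for n A x
    using that
  proof (induction n arbitrary: A)
    case 0
    have "norm (T (A x) - A (T x)) \<le> norm (T (A x)) + norm (A (T x))" by (rule norm_triangle_ineq4)
    also have "\<dots> \<le> c * norm (A x) + norm (T x)" by (intro add_mono c 0)
    also have "\<dots> \<le> c * norm x + c * norm x" using c by (intro add_mono mult_left_mono 0 c) auto
    finally show ?case by simp
  next
    case (Suc n)
    note Acb = selfadj_cbop[OF Suc.prems(1)]
    obtain E where E1: "csub E"
      and E2: "\<forall>C. cbop C \<longrightarrow> (\<forall>x. C (A x) = A (C x)) \<longrightarrow> (\<forall>x. C (cproj E x) = cproj E (C x))"
      and pos: "\<And>x. x \<in> E \<Longrightarrow> (norm (A x))\<^sup>2 \<le> Re (cinner (A x) x)"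
      and neg: "\<And>x. cproj E x = 0 \<Longrightarrow> (norm (A x))\<^sup>2 \<le> - Re (cinner (A x) x)"
      by (rule spectral_splitting[OF Suc.prems(1,3)]) (rule that)
    have "C (cproj E x) = cproj E (C x)" if "cbop C" "\<And>x. C (A x) = A (C x)" for C x
      using E2 that by blast
    note E = E1 this
    note Pcb = cbop_cproj[OF E(1)]
    have AP: "A (cproj E x) = cproj E (A x)" for x by (rule E(2)[OF Acb]) simp
    have TP: "T (cproj E x) = cproj E (T x)" for x
      by (rule proj[OF E(1)]) (rule E(2)[OF F], auto simp: Suc.prems(2))
    \<comment> \<open>The symmetry enters as P - 1/2. The factor 2 brings the bound on the norm back
      to 1 and doubles the commutator with \<open>T\<close>, which makes the induction gain a factor
      2.\<close>
    define A' where "A' x = 2 *\<^sub>C (A x - (cproj E x - (1/2) *\<^sub>C x))" for x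
    have A'cb: "cbop A'" unfolding A'_def
      by (rule cbop_scaleC[OF cbop_minus[OF Acb cbop_minus[OF Pcb cbop_scaleC[OF cbop_id(1)]]]])
    have "norm (T (A' x) - A' (T x)) \<le> 2 * c / 2 ^ n * norm x"
    proof (rule Suc.IH)
      show "selfadj A'"
        using A'cb by (simp add: selfadj_def A'_def cinner_scaleC_left cinner_scaleC_right
            cinner.diff_left
            cinner.diff_right selfadjD[OF Suc.prems(1)] cproj_selfadj[OF E(1)])
      show "C (A' x) = A' (C x)" if "C \<in> F" for C x
        using F[OF that] Suc.prems(2)[OF that] E(2)[OF F[OF that] Suc.prems(2)[OF that]]
        by (simp add: A'_def cbop_scale cbop_diff)
      show "norm (A' x) \<le> norm x" for x
      proof -
        define y z where "y = cproj E x" and "z = x - y"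
        have y: "y \<in> E" "cproj E y = y" by (simp_all add: y_def cproj_in cproj_id E(1))
        have z: "cproj E z = 0" by (simp add: z_def cbop_diff[OF Pcb] y) (simp add: y_def)
        have x: "x = y + z" by (simp add: z_def)
        have orth: "cinner z u = 0" if "u \<in> E" for u by (rule cproj_eq_0[OF E(1) z that])
        have "cproj E (A z) = 0" using AP[of z] z cbop_0[OF Acb] by simp
        then have orthA: "cinner (A z) u = 0" if "u \<in> E" for u by (rule cproj_eq_0[OF E(1) _ that])
        have Ay: "A y \<in> E" using AP[of y] y cproj_in[OF E(1)] by metis
        have half: "A y - (1/2) *\<^sub>C y \<in> E" by (intro csub_diff[OF E(1)] Ay csub_scale[OF E(1)] y)
        have "A' x = 2 *\<^sub>C ((A z + (1/2) *\<^sub>C z) + (A y - (1/2) *\<^sub>C y))"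
        proof -
          have "y - (1/2) *\<^sub>C y = (1/2) *\<^sub>C y" using scaleC_diff_left[of 1 "1/2" y] by simp
          then have "y - ((1/2) *\<^sub>C y + (1/2) *\<^sub>C z) = (1/2) *\<^sub>C y - (1/2) *\<^sub>C z"
            by (metis diff_diff_eq)
          then have "A x - (cproj E x - (1/2) *\<^sub>C x) = (A z + (1/2) *\<^sub>C z) + (A y - (1/2) *\<^sub>C y)"
            unfolding y_def[symmetric] by (simp add: x cbop_add[OF Acb] scaleC_add_right)
          then show ?thesis by (simp only: A'_def)
        qed
        then have "(norm (A' x))\<^sup>2 = 4 * (norm ((A z + (1/2) *\<^sub>C z) + (A y - (1/2) *\<^sub>C y)))\<^sup>2"
          by (simp only: norm_scaleC power_mult_distrib) simp
        also have "(norm ((A z + (1/2) *\<^sub>C z) + (A y - (1/2) *\<^sub>C y)))\<^sup>2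
          = (norm (A z + (1/2) *\<^sub>C z))\<^sup>2 + (norm (A y - (1/2) *\<^sub>C y))\<^sup>2"
          by (rule pythagoras) (simp only: cinner_add_left cinner_scaleC_left orth[OF half]
              orthA[OF half], simp)
        \<comment> \<open>Expanding the square, \<open>neg\<close> makes the terms other than
          \<open>(norm z)\<^sup>2 / 4\<close> sum to at most 0; \<open>pos\<close> does the same for
          \<open>y\<close> below.\<close>
        also have "(norm (A z + (1/2) *\<^sub>C z))\<^sup>2 \<le> (norm z)\<^sup>2 / 4"
          using neg[OF z] by (simp add: norm_add_sq norm_scaleC cinner_scaleC_right norm_divide
              power_divide)
        also have "(norm (A y - (1/2) *\<^sub>C y))\<^sup>2 \<le> (norm y)\<^sup>2 / 4"
          using pos[OF y(1)] by (simp add: norm_diff_sq norm_scaleC cinner_scaleC_right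
              norm_divide power_divide)
        also have "4 * ((norm z)\<^sup>2 / 4 + (norm y)\<^sup>2 / 4) = (norm (z + y))\<^sup>2"
          using pythagoras[OF orth[OF y(1)]] by simp
        finally show ?thesis by (simp add: x add.commute)
      qed
    qed
    moreover have "T (A' x) - A' (T x) = 2 *\<^sub>C (T (A x) - A (T x))"
      by (simp add: A'_def cbop_scale[OF T] cbop_diff[OF T] TP scaleC_diff_right)
    ultimately have "2 * norm (T (A x) - A (T x)) \<le> 2 * c / 2 ^ n * norm x"
        by (simp add: norm_scaleC)
    then show ?case by (simp add: field_simps)
  qed
  have le: "norm (T (A x) - A (T x)) \<le> 2 * c / 2 ^ n * norm x" for n
    by (rule main) (fact A)+
  have "(\<lambda>n. (2 * c * norm x) * (1/2) ^ n) \<longlonglongrightarrow> (2 * c * norm x) * 0"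
    by (intro tendsto_intros LIMSEQ_power_zero) simp
  then have "(\<lambda>n. 2 * c / 2 ^ n * norm x) \<longlonglongrightarrow> 0" by (simp add: power_one_over field_simps)
  then have "norm (T (A x) - A (T x)) \<le> 0" by (rule LIMSEQ_le_const) (use le in blast)
  then show ?thesis by (simp only: norm_le_zero_iff right_minus_eq)
qed

text \<open>Closure of \<open>F\<close> under adjoints keeps \<open>adj A\<close> in the commutant,
  so the self-adjoint case applies, after rescaling, to A plus its adjoint and to \<i> times their
  difference.\<close>

lemma commutes_if_commutes_projections:
  fixes T :: "'a::complex_hilbert_space \<Rightarrow> 'a"
  assumes T: "cbop T" and F: "\<And>C. C \<in> F \<Longrightarrow> cbop C" "\<And>C. C \<in> F \<Longrightarrow> adj C \<in> F"
    and proj: "\<And>E x. csub E \<Longrightarrow> (\<And>C x. C \<in> F \<Longrightarrow> C (cproj E x) = cproj E (C x)) \<Longrightarrow> T (cproj E x)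
        = cproj E (T x)"
    and A: "cbop A" "\<And>C x. C \<in> F \<Longrightarrow> C (A x) = A (C x)"
  shows "T (A x) = A (T x)"
proof -
  have sa: "T (B x) = B (T x)" if B: "selfadj B" and com: "\<And>C x. C \<in> F \<Longrightarrow> C (B x) = B (C x)" for B x
  proof -
    obtain c where c: "c > 0" "\<And>x. norm (B x) \<le> c * norm x" using cbop_bound[OF selfadj_cbop[OF
        B]] by metis
    have "T (of_real (1/c) *\<^sub>C B x) = of_real (1/c) *\<^sub>C B (T x)"
    proof (rule commutes_if_commutes_projections_selfadj
        [where A = "\<lambda>x. of_real (1/c) *\<^sub>C B x" and F = F and T = T])
      show "T (cproj E x) = cproj E (T x)"
        if "csub E" "\<And>C x. C \<in> F \<Longrightarrow> C (cproj E x) = cproj E (C x)" for E x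
        using that by (rule proj)
      show "selfadj (\<lambda>x. of_real (1/c) *\<^sub>C B x)"
        by (simp add: selfadj_def cbop_scaleC[OF selfadj_cbop[OF B]] cinner_scaleC_left
            cinner_scaleC_right
            selfadjD[OF B])
      show "C (of_real (1/c) *\<^sub>C B x) = of_real (1/c) *\<^sub>C B (C x)" if "C \<in> F" for C x
        using com[OF that] F(1)[OF that] by (simp add: cbop_scale)
      show "norm (of_real (1/c) *\<^sub>C B x) \<le> norm x" for x
        using c by (simp add: norm_scaleC norm_divide divide_simps mult.commute)
    qed (fact T F(1))+
    then have "of_real c *\<^sub>C (of_real (1/c) *\<^sub>C T (B x)) = of_real c *\<^sub>C (of_real (1/c) *\<^sub>C B (T
        x))"
      by (simp only: cbop_scale[OF T])
    then show ?thesis using c(1) by (simp add: scaleC_scaleC)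
  qed
  note A' = cbop_adj[OF A(1)]
  have com': "C (adj A x) = adj A (C x)" if "C \<in> F" for C x
    using adj_commute[OF A(1) F(1)[OF F(2)[OF that]], of x] A(2)[OF F(2)[OF that]] F(1)[OF that]
        by simp
  have s: "T (A x + adj A x) = A (T x) + adj A (T x)"
  proof (rule sa[of "\<lambda>x. A x + adj A x"])
    show "selfadj (\<lambda>x. A x + adj A x)"
      by (simp add: selfadj_def cbop_plus[OF A(1) A'] cinner_add_left cinner_add_right
          cinner_adj[OF A(1)]
          cinner_adj'[OF A(1)])
    show "C (A x + adj A x) = A (C x) + adj A (C x)" if "C \<in> F" for C x
      using com'[OF that] A(2)[OF that] F(1)[OF that] by (simp add: cbop_add)
  qed
  have "T (\<i> *\<^sub>C (A x - adj A x)) = \<i> *\<^sub>C (A (T x) - adj A (T x))"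
  proof (rule sa[of "\<lambda>x. \<i> *\<^sub>C (A x - adj A x)"])
    show "selfadj (\<lambda>x. \<i> *\<^sub>C (A x - adj A x))"
      by (simp add: selfadj_def cbop_scaleC[OF cbop_minus[OF A(1) A']] cinner_scaleC_left
          cinner_scaleC_right
          cinner.diff_left cinner.diff_right cinner_adj[OF A(1)] cinner_adj'[OF A(1)] algebra_simps)
    show "C (\<i> *\<^sub>C (A x - adj A x)) = \<i> *\<^sub>C (A (C x) - adj A (C x))" if "C \<in> F" for C x
      using com'[OF that] A(2)[OF that] F(1)[OF that] by (simp add: cbop_diff cbop_scale)
  qed
  then have "(-\<i>) *\<^sub>C (\<i> *\<^sub>C (T (A x) - T (adj A x))) = (-\<i>) *\<^sub>C (\<i> *\<^sub>C (A (T x) - adj A (T x)))"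
    by (simp only: cbop_scale[OF T] cbop_diff[OF T])
  then have d: "T (A x) - T (adj A x) = A (T x) - adj A (T x)" by (simp add: scaleC_scaleC)
  have "2 *\<^sub>R T (A x) = T (A x + adj A x) + (T (A x) - T (adj A x))"
    unfolding cbop_add[OF T] by (simp add: scaleR_2)
  also have "\<dots> = 2 *\<^sub>R A (T x)" unfolding s d by (simp add: scaleR_2)
  finally show ?thesis by simp
qed

subsection \<open>Square summable families\<close>

instantiation complex :: complex_hilbert_space
begin
definition scaleC_complex :: "complex \<Rightarrow> complex \<Rightarrow> complex" where "scaleC_complex c x = c * x"
definition cinner_complex :: "complex \<Rightarrow> complex \<Rightarrow> complex" where "cinner_complex x y = x * cnj y"
instance
proof
  fix r c d :: complex and a :: real and x y z :: complex
  show "a *\<^sub>R x = complex_of_real a *\<^sub>C x" by (simp add: scaleC_complex_def scaleR_conv_of_real)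
  show "0 \<le> Re (cinner x x)" by (simp add: cinner_complex_def mult_cnj_cmod)
  show "norm x = sqrt (Re (cinner x x))" by (simp add: cinner_complex_def mult_cnj_cmod flip:
      of_real_power)
qed (simp_all add: scaleC_complex_def cinner_complex_def algebra_simps)
end

text \<open>One type serves both for ampliations, with values in the given Hilbert space, and for
  coefficient sequences, with values in the complex numbers.\<close>

typedef (overloaded) ('i, 'a) l2 = "{f :: 'i \<Rightarrow> 'a::complex_hilbert_space. (\<lambda>i. (norm (f i))\<^sup>2)
    summable_on UNIV}"
  morphisms l2_nth Abs_l2
  by (rule exI[of _ "\<lambda>_. 0"]) simp

lemma l2_eqI: "(\<And>i. l2_nth f i = l2_nth g i) \<Longrightarrow> f = g"
  by (simp add: l2_nth_inject[symmetric] fun_eq_iff)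

lemma l2_summable: "(\<lambda>i. (norm (l2_nth f i))\<^sup>2) summable_on UNIV"
  using l2_nth[of f] by simp

lemma in_l2I:
  assumes "\<And>F. finite F \<Longrightarrow> L2_set (\<lambda>i. norm (f i)) F \<le> c"
  shows "(\<lambda>i. (norm (f i))\<^sup>2) summable_on UNIV"
proof (rule nonneg_bdd_above_summable_on)
  have "0 \<le> c" using assms[of "{}"] by simp
  then have "(\<Sum>i\<in>F. (norm (f i))\<^sup>2) \<le> c\<^sup>2" if "finite F" for F
    using assms[OF that] by (simp add: L2_set_def sqrt_le_D)
  then show "bdd_above (sum (\<lambda>i. (norm (f i))\<^sup>2) ` {F. F \<subseteq> UNIV \<and> finite F})"
    by (auto intro!: bdd_aboveI[of _ "c\<^sup>2"])
qed simp

instantiation l2 :: (type, complex_hilbert_space) real_normed_vector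
begin
definition "0 = (Abs_l2 (\<lambda>_. 0) :: ('a, 'b) l2)"
definition "f + g = (Abs_l2 (\<lambda>i. l2_nth f i + l2_nth g i) :: ('a, 'b) l2)"
definition "f - g = (Abs_l2 (\<lambda>i. l2_nth f i - l2_nth g i) :: ('a, 'b) l2)"
definition "- f = (Abs_l2 (\<lambda>i. - l2_nth f i) :: ('a, 'b) l2)"
definition "r *\<^sub>R f = (Abs_l2 (\<lambda>i. r *\<^sub>R l2_nth f i) :: ('a, 'b) l2)"
definition "norm f = sqrt (\<Sum>\<^sub>\<infinity>i. (norm (l2_nth f i))\<^sup>2)" for f :: "('a, 'b) l2"
definition "dist f g = norm (f - g)" for f g :: "('a, 'b) l2"
definition "sgn f = scaleR (inverse (norm f)) f" for f :: "('a, 'b) l2"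
definition "uniformity = (INF e\<in>{0<..}. principal {(f, g). dist (f::('a, 'b) l2) g < e})"
definition "open U = (\<forall>x\<in>U. \<forall>\<^sub>F (x', y) in uniformity. x' = x \<longrightarrow> y \<in> U)" for U :: "('a, 'b) l2 set"

lemma L2_set_le_norm_l2:
  fixes f :: "('a, 'b) l2"
  assumes "finite F" shows "L2_set (\<lambda>i. norm (l2_nth f i)) F \<le> norm f"
  unfolding L2_set_def norm_l2_def
  by (intro real_sqrt_le_mono finite_sum_le_infsum l2_summable assms) auto

lemma norm_l2_le:
  fixes f :: "('a, 'b) l2"
  assumes "\<And>F. finite F \<Longrightarrow> L2_set (\<lambda>i. norm (l2_nth f i)) F \<le> c"
  shows "norm f \<le> c"
proof -
  have c: "0 \<le> c" using assms[of "{}"] by simp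
  have "(\<Sum>\<^sub>\<infinity>i. (norm (l2_nth f i))\<^sup>2) \<le> c\<^sup>2"
    using assms c by (intro infsum_le_finite_sums l2_summable) (simp add: L2_set_def sqrt_le_D)
  then show ?thesis using c by (simp add: norm_l2_def real_le_lsqrt infsum_nonneg)
qed

lemma l2_nth_plus_aux:
  "L2_set (\<lambda>i. norm (l2_nth f i + l2_nth g i)) F \<le> norm f + norm g"
  if "finite F" for f g :: "('a, 'b) l2"
proof -
  have "L2_set (\<lambda>i. norm (l2_nth f i + l2_nth g i)) F \<le> L2_set (\<lambda>i. norm (l2_nth f i)
      + norm (l2_nth g i)) F"
    by (intro L2_set_mono norm_triangle_ineq norm_ge_zero)
  also have "\<dots> \<le> L2_set (\<lambda>i. norm (l2_nth f i)) F + L2_set (\<lambda>i. norm (l2_nth g i)) F"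
    by (rule L2_set_triangle_ineq)
  also have "\<dots> \<le> norm f + norm g" by (intro add_mono L2_set_le_norm_l2 that)
  finally show ?thesis .
qed

lemma l2_nth_zero [simp]: "l2_nth (0 :: ('a, 'b) l2) i = 0"
  by (simp add: zero_l2_def Abs_l2_inverse)

lemma l2_nth_plus [simp]: "l2_nth (f + g :: ('a, 'b) l2) i = l2_nth f i + l2_nth g i"
  using in_l2I[OF l2_nth_plus_aux[of _ f g]] by (simp add: plus_l2_def Abs_l2_inverse)

lemma l2_nth_uminus [simp]: "l2_nth (- f :: ('a, 'b) l2) i = - l2_nth f i"
  by (simp add: uminus_l2_def Abs_l2_inverse l2_summable)

lemma l2_nth_scaleR [simp]: "l2_nth (r *\<^sub>R f :: ('a, 'b) l2) i = r *\<^sub>R l2_nth f i"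
  by (simp add: scaleR_l2_def Abs_l2_inverse power_mult_distrib l2_summable summable_on_cmult_right)

lemma l2_nth_minus [simp]: "l2_nth (f - g :: ('a, 'b) l2) i = l2_nth f i - l2_nth g i"
  using in_l2I[OF l2_nth_plus_aux[of _ f "- g"]] by (simp add: minus_l2_def Abs_l2_inverse)

lemma norm_l2_nth: "norm (l2_nth f i) \<le> norm f" for f :: "('a, 'b) l2"
  using L2_set_le_norm_l2[of "{i}" f] by simp

instance
proof
  fix f g h :: "('a, 'b) l2" and r :: real
  show "f + g + h = f + (g + h)" by (intro l2_eqI) (simp add: add.assoc)
  show "f + g = g + f" by (intro l2_eqI) (simp add: add.commute)
  show "norm (f + g) \<le> norm f + norm g"
    by (rule norm_l2_le) (simp add: l2_nth_plus_aux)
  show "norm (r *\<^sub>R f) = \<bar>r\<bar> * norm f"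
    by (simp add: norm_l2_def power_mult_distrib infsum_cmult_right' real_sqrt_mult)
  show "norm f = 0 \<longleftrightarrow> f = 0"
  proof
    assume "norm f = 0"
    then show "f = 0" using norm_l2_nth[of f] by (intro l2_eqI) simp
  qed (simp add: norm_l2_def)
qed (auto intro!: l2_eqI simp: dist_l2_def sgn_l2_def uniformity_l2_def open_l2_def
    scaleR_add_left scaleR_add_right)

end

instance l2 :: (type, complex_hilbert_space) banach
proof
  fix X :: "nat \<Rightarrow> ('a, 'b) l2"
  assume X: "Cauchy X"
  have "Cauchy (\<lambda>n. l2_nth (X n) i)" for i
  proof (rule metric_CauchyI)
    fix e :: real assume "e > 0"
    then obtain M where "\<forall>m\<ge>M. \<forall>n\<ge>M. dist (X m) (X n) < e" using X metric_CauchyD by blast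
    then have "dist (l2_nth (X m) i) (l2_nth (X n) i) < e" if "m \<ge> M" "n \<ge> M" for m n
      using norm_l2_nth[of "X m - X n" i] that by (simp add: dist_norm) (meson le_less_trans)
    then show "\<exists>M. \<forall>m\<ge>M. \<forall>n\<ge>M. dist (l2_nth (X m) i) (l2_nth (X n) i) < e" by blast
  qed
  then have "\<exists>l. (\<lambda>n. l2_nth (X n) i) \<longlonglongrightarrow> l" for i
    by (simp add: Cauchy_convergent flip: convergent_def)
  then obtain g where g: "\<And>i. (\<lambda>n. l2_nth (X n) i) \<longlonglongrightarrow> g i" by metis
  have *: "\<exists>M. \<forall>n\<ge>M. \<forall>F. finite F \<longrightarrow> L2_set (\<lambda>i. norm (l2_nth (X n) i - g i)) F \<le> e" if e: "e > 0"
      for e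
  proof -
    obtain M where M: "\<And>m n. m \<ge> M \<Longrightarrow> n \<ge> M \<Longrightarrow> dist (X m) (X n) < e" using X metric_CauchyD e by metis
    have "L2_set (\<lambda>i. norm (l2_nth (X n) i - g i)) F \<le> e" if n: "n \<ge> M" and F: "finite F" for n F
    proof (rule LIMSEQ_le_const2)
      show "(\<lambda>m. L2_set (\<lambda>i. norm (l2_nth (X n) i - l2_nth (X m) i)) F) \<longlonglongrightarrow> L2_set (\<lambda>i. norm (l2_nth
          (X n) i - g i)) F"
        unfolding L2_set_def by (intro tendsto_intros g)
      have "L2_set (\<lambda>i. norm (l2_nth (X n) i - l2_nth (X m) i)) F \<le> e" if "m \<ge> M" for m
        using L2_set_le_norm_l2[OF F, of "X n - X m"] M[OF n that] by (simp add: dist_norm)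
      then show "\<exists>N. \<forall>m\<ge>N. L2_set (\<lambda>i. norm (l2_nth (X n) i - l2_nth (X m) i)) F \<le> e" by blast
    qed
    then show ?thesis by blast
  qed
  obtain M where M: "\<forall>n\<ge>M. \<forall>F. finite F \<longrightarrow> L2_set (\<lambda>i. norm (l2_nth (X n) i - g i)) F \<le> 1"
    using *[of 1] by auto
  \<comment> \<open>The pointwise limit \<open>g\<close> is not yet known to be square summable, but
    its difference from \<open>X M\<close> is, by the uniform bound. The limit is therefore built as
    \<open>X M - D\<close>.\<close>
  define D where "D = Abs_l2 (\<lambda>i. l2_nth (X M) i - g i)"
  have D: "l2_nth D = (\<lambda>i. l2_nth (X M) i - g i)"
    unfolding D_def using M in_l2I[of "\<lambda>i. l2_nth (X M) i - g i" 1] by (intro Abs_l2_inverse) auto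
  have G: "l2_nth (X n - (X M - D)) i = l2_nth (X n) i - g i" for n i by (simp add: D)
  have "X \<longlonglongrightarrow> X M - D"
  proof (rule metric_LIMSEQ_I)
    fix e :: real assume e: "e > 0"
    obtain N where N: "\<forall>n\<ge>N. \<forall>F. finite F \<longrightarrow> L2_set (\<lambda>i. norm (l2_nth (X n) i - g i)) F \<le> e/2"
      using *[of "e/2"] e by auto
    have "dist (X n) (X M - D) < e" if "n \<ge> N" for n
    proof -
      have "norm (X n - (X M - D)) \<le> e/2"
        by (rule norm_l2_le, unfold G) (use N that in blast)
      then show ?thesis using e by (simp add: dist_norm)
    qed
    then show "\<exists>N. \<forall>n\<ge>N. dist (X n) (X M - D) < e" by blast
  qed
  then show "convergent X" by (rule convergentI)
qed

instantiation l2 :: (type, complex_hilbert_space) complex_hilbert_space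
begin
definition "c *\<^sub>C f = (Abs_l2 (\<lambda>i. c *\<^sub>C l2_nth f i) :: ('a, 'b) l2)"
definition "cinner f g = (\<Sum>\<^sub>\<infinity>i. cinner (l2_nth f i) (l2_nth g i))" for f g :: "('a, 'b) l2"

lemma l2_nth_scaleC [simp]: "l2_nth (c *\<^sub>C f :: ('a, 'b) l2) i = c *\<^sub>C l2_nth f i"
  by (simp add: scaleC_l2_def Abs_l2_inverse power_mult_distrib norm_scaleC l2_summable
      summable_on_cmult_right)

lemma l2_cinner_summable: "(\<lambda>i. cinner (l2_nth f i) (l2_nth g i)) summable_on UNIV"
  for f g :: "('a, 'b) l2"
proof (rule abs_summable_summable)
  show "(\<lambda>i. norm (cinner (l2_nth f i) (l2_nth g i))) summable_on UNIV"
  proof (rule summable_on_comparison_test)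
    show "(\<lambda>i. (norm (l2_nth f i))\<^sup>2 + (norm (l2_nth g i))\<^sup>2) summable_on UNIV"
      by (intro summable_on_add l2_summable)
    show "norm (cinner (l2_nth f i) (l2_nth g i)) \<le> (norm (l2_nth f i))\<^sup>2 + (norm (l2_nth g i))\<^sup>2"
        for i
    proof -
      have "2 * (norm (l2_nth f i) * norm (l2_nth g i)) \<le> (norm (l2_nth f i))\<^sup>2
          + (norm (l2_nth g i))\<^sup>2"
        using sum_squares_bound[of "norm (l2_nth f i)" "norm (l2_nth g i)"] by simp
      moreover have "0 \<le> norm (l2_nth f i) * norm (l2_nth g i)" by simp
      ultimately show ?thesis using cinner_norm_ineq[of "l2_nth f i" "l2_nth g i"] by linarith
    qed
  qed simp
qed

instance
proof
  fix f g h :: "('a, 'b) l2" and c d :: complex and r :: real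
  show "cinner f g = cnj (cinner g f)"
    unfolding cinner_l2_def infsum_cnj[symmetric] by (intro infsum_cong cinner_commute)
  show "cinner (f + g) h = cinner f h + cinner g h"
    by (simp add: cinner_l2_def cinner_add_left infsum_add l2_cinner_summable)
  show "cinner (c *\<^sub>C f) g = c * cinner f g"
    by (simp add: cinner_l2_def cinner_scaleC_left infsum_cmult_right')
  have "(\<Sum>\<^sub>\<infinity>i. (norm (l2_nth f i))\<^sup>2) = (norm f)\<^sup>2" by (simp add: norm_l2_def infsum_nonneg)
  then have "((\<lambda>i. (norm (l2_nth f i))\<^sup>2) has_sum (norm f)\<^sup>2) UNIV"
    using has_sum_infsum[OF l2_summable[of f]] by simp
  then have "((\<lambda>i. complex_of_real ((norm (l2_nth f i))\<^sup>2)) has_sum of_real ((norm f)\<^sup>2)) UNIV"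
    by (simp only: has_sum_of_real_iff)
  then have *: "cinner f f = of_real ((norm f)\<^sup>2)"
    unfolding cinner_l2_def cinner_self by (rule infsumI)
  show "0 \<le> Re (cinner f f)" "(cinner f f = 0) = (f = 0)" "norm f = sqrt (Re (cinner f f))"
    unfolding * by simp_all
qed (auto intro!: l2_eqI simp: scaleC_add_left scaleC_add_right scaleC_scaleC scaleR_scaleC)

end

lemma cbop_l2_nth: "cbop (\<lambda>f. l2_nth f i)"
  by (rule cbopI[of _ 1]) (simp_all add: norm_l2_nth)

lemma csub_support: "csub {f :: ('i, 'a::complex_hilbert_space) l2. \<forall>i. i \<notin> F \<longrightarrow> l2_nth f i = 0}"
proof -
  have "{f :: ('i, 'a) l2. \<forall>i. i \<notin> F \<longrightarrow> l2_nth f i = 0} = (\<Inter>i\<in>-F. {f. l2_nth f i \<in> {0}})" by auto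
  moreover have "csub {f :: ('i, 'a) l2. l2_nth f i \<in> {0}}" for i
    by (rule cbop_preimage_csub[OF cbop_l2_nth]) (simp add: csub_def)
  ultimately show ?thesis by (auto intro: csub_Inter)
qed

definition l2_single :: "'i \<Rightarrow> 'a::complex_hilbert_space \<Rightarrow> ('i, 'a) l2" where
  "l2_single i a = Abs_l2 (\<lambda>j. if j = i then a else 0)"

lemma l2_nth_single: "l2_nth (l2_single i a) j = (if j = i then a else 0)"
proof -
  have "(\<lambda>j. (norm (if j = i then a else 0))\<^sup>2) summable_on UNIV"
    by (rule summable_on_cong_neutral[where S="{i}", THEN iffD1]) auto
  then show ?thesis by (simp add: l2_single_def Abs_l2_inverse)
qed

lemma cinner_l2_single: "cinner (l2_single i a) f = cinner a (l2_nth f i)"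
proof -
  have "cinner (l2_single i a) f = (\<Sum>\<^sub>\<infinity>j\<in>{i}. cinner (l2_nth (l2_single i a) j) (l2_nth f j))"
    unfolding cinner_l2_def by (rule infsum_cong_neutral) (auto simp: l2_nth_single)
  then show ?thesis by (simp add: l2_nth_single)
qed

lemma cinner_l2_single_right: "cinner f (l2_single i a) = cinner (l2_nth f i) a"
  by (metis cinner_commute cinner_l2_single)

lemma norm_l2_single: "norm (l2_single i a) = norm a"
  using cinner_l2_single[of i a "l2_single i a"]
  by (simp add: l2_nth_single cinner_self flip: of_real_power)

lemma cbop_l2_single: "cbop (l2_single i)"
  by (rule cbopI[of _ 1]) (auto intro!: l2_eqI simp: l2_nth_single norm_l2_single)

lemma l2_finite_support:
  assumes "finite F" "\<And>i. i \<notin> F \<Longrightarrow> l2_nth f i = 0" shows "f = (\<Sum>i\<in>F. l2_single i (l2_nth f i))"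
proof (rule l2_eqI)
  fix j
  have "l2_nth (\<Sum>i\<in>F. l2_single i (l2_nth f i)) j = (\<Sum>i\<in>F. l2_nth (l2_single i (l2_nth f i)) j)"
    by (rule cbop_sum[OF cbop_l2_nth])
  also have "\<dots> = l2_nth f j" using assms by (simp add: l2_nth_single sum.delta')
  finally show "l2_nth f j = l2_nth (\<Sum>i\<in>F. l2_single i (l2_nth f i)) j" by simp
qed

definition l2_map :: "('a::complex_hilbert_space \<Rightarrow> 'a) \<Rightarrow> ('i, 'a) l2 \<Rightarrow> ('i, 'a) l2" where
  "l2_map T f = Abs_l2 (\<lambda>i. T (l2_nth f i))"

lemma l2_map_aux:
  assumes "finite F" "0 \<le> c" "\<And>x. norm (T x) \<le> c * norm x"
  shows "L2_set (\<lambda>i. norm (T (l2_nth f i))) F \<le> c * norm f"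
proof -
  have "L2_set (\<lambda>i. norm (T (l2_nth f i))) F \<le> L2_set (\<lambda>i. c * norm (l2_nth f i)) F"
    by (intro L2_set_mono assms) auto
  also have "\<dots> = c * L2_set (\<lambda>i. norm (l2_nth f i)) F" using assms
      by (simp add: L2_set_right_distrib)
  also have "\<dots> \<le> c * norm f" by (intro mult_left_mono L2_set_le_norm_l2 assms)
  finally show ?thesis .
qed

lemma l2_nth_map:
  assumes T: "cbop T" shows "l2_nth (l2_map T f) i = T (l2_nth f i)"
proof -
  obtain c where c: "c > 0" "\<And>x. norm (T x) \<le> c * norm x" using cbop_bound[OF T] by metis
  have "(\<lambda>i. (norm (T (l2_nth f i)))\<^sup>2) summable_on UNIV"
    by (rule in_l2I[of _ "c * norm f"]) (rule l2_map_aux, use c in auto)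
  then show ?thesis by (simp add: l2_map_def Abs_l2_inverse)
qed

lemma cbop_l2_map:
  assumes T: "cbop T" shows "cbop (l2_map T)"
proof -
  obtain c where c: "c > 0" "\<And>x. norm (T x) \<le> c * norm x" using cbop_bound[OF T] by metis
  show ?thesis
  proof (rule cbopI)
    show "norm (l2_map T f) \<le> c * norm f" for f
      by (rule norm_l2_le) (use c l2_map_aux[of _ c T f] in \<open>simp add: l2_nth_map[OF T]\<close>)
  qed (auto intro!: l2_eqI simp: l2_nth_map[OF T] cbop_add[OF T] cbop_scale[OF T])
qed

lemma adj_l2_map: "cbop T \<Longrightarrow> adj (l2_map T) = l2_map (adj T)"
  by (rule ext, rule adj_unique[OF cbop_l2_map])
    (simp_all add: cinner_l2_def l2_nth_map cbop_adj cinner_adj)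

subsection \<open>Bessel families\<close>

text \<open>Equivalently, the basis vectors of \<open>l2\<close> can be mapped to the
  \<open>g i\<close> by a linear operator of norm at most \<open>C\<close>; this operator is
  \<open>synth g\<close>.\<close>

definition bessel :: "('i \<Rightarrow> 'a::complex_hilbert_space) \<Rightarrow> real \<Rightarrow> bool" where
  "bessel g C \<longleftrightarrow> 0 \<le> C \<and> (\<forall>h F. finite F \<longrightarrow> L2_set (\<lambda>i. cmod (cinner h (g i))) F \<le> C * norm h)"

definition analysis :: "('i \<Rightarrow> 'a::complex_hilbert_space) \<Rightarrow> 'a \<Rightarrow> ('i, complex) l2" where
  "analysis g h = Abs_l2 (\<lambda>i. cinner h (g i))"

definition synth :: "('i \<Rightarrow> 'a::complex_hilbert_space) \<Rightarrow> ('i, complex) l2 \<Rightarrow> 'a" where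
  "synth g = adj (analysis g)"

context
  fixes g :: "'i \<Rightarrow> 'a::complex_hilbert_space" and C
  assumes g: "bessel g C"
begin

lemma l2_nth_analysis: "l2_nth (analysis g h) i = cinner h (g i)"
  using in_l2I[of "\<lambda>i. cinner h (g i)" "C * norm h"] g by (simp add: analysis_def bessel_def
      Abs_l2_inverse)

lemma norm_analysis: "norm (analysis g h) \<le> C * norm h"
  by (rule norm_l2_le) (use g in \<open>simp add: l2_nth_analysis bessel_def\<close>)

lemma cbop_analysis: "cbop (analysis g)"
  by (rule cbopI[of _ C])
    (auto intro!: l2_eqI simp: l2_nth_analysis cinner_add_left cinner_scaleC_left
        scaleC_complex_def norm_analysis)

lemma cbop_synth: "cbop (synth g)"
  unfolding synth_def by (rule cbop_adj[OF cbop_analysis])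

lemma norm_synth: "norm (synth g f) \<le> C * norm f"
  unfolding synth_def using g by (intro adj_bound cbop_analysis norm_analysis) (simp add:
      bessel_def)

lemma cinner_synth: "cinner (synth g f) h = cinner f (analysis g h)"
  unfolding synth_def by (rule cinner_adj'[OF cbop_analysis])

lemma synth_single: "synth g (l2_single i 1) = g i"
  by (rule cinner_ext) (simp add: cinner_synth cinner_l2_single l2_nth_analysis cinner_complex_def
      cinner_commute[of "g i"])

lemma synth_in:
  assumes K: "csub K" "\<And>i. g i \<in> K" shows "synth g f \<in> K"
proof (rule csub_bicomplement[OF K(1)])
  fix y assume "\<And>z. z \<in> K \<Longrightarrow> cinner y z = 0"
  then have "analysis g y = 0" using K(2) by (intro l2_eqI) (simp add: l2_nth_analysis)
  then show "cinner (synth g f) y = 0" by (simp add: cinner_synth)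
qed

end

subsection \<open>Isometric tuples and invariant subspaces\<close>

text \<open>The cyclic subspace S[x], written through words instead of the algebra, so that it also
  makes sense for ampliations.\<close>

definition orb :: "nat set \<Rightarrow> (nat \<Rightarrow> 'a::complex_hilbert_space \<Rightarrow> 'a) \<Rightarrow> 'a \<Rightarrow> 'a set" where
  "orb I S x = csub hull {foldr S v x | v. v \<in> lists I}"

definition orb0 :: "nat set \<Rightarrow> (nat \<Rightarrow> 'a::complex_hilbert_space \<Rightarrow> 'a) \<Rightarrow> 'a \<Rightarrow> 'a set" where
  "orb0 I S x = csub hull {foldr S v x | v. v \<in> lists I \<and> v \<noteq> []}"

definition wandering :: "nat set \<Rightarrow> (nat \<Rightarrow> 'a::complex_hilbert_space \<Rightarrow> 'a) \<Rightarrow> 'a \<Rightarrow> bool" where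
  "wandering I S z \<longleftrightarrow> (\<forall>v\<in>lists I. v \<noteq> [] \<longrightarrow> cinner (foldr S v z) z = 0)"

definition reducing :: "nat set \<Rightarrow> (nat \<Rightarrow> 'a::complex_hilbert_space \<Rightarrow> 'a) \<Rightarrow> 'a set \<Rightarrow> bool" where
  "reducing I S K \<longleftrightarrow> csub K \<and> (\<forall>i\<in>I. \<forall>x\<in>K. S i x \<in> K \<and> adj (S i) x \<in> K)"

lemma cinner_eq_0_sym: "cinner x y = 0 \<longleftrightarrow> cinner y x = 0"
  using cinner_commute[of x y] by simp

lemma csub_orb: "csub (orb I S x)" and csub_orb0: "csub (orb0 I S x)"
  by (simp_all add: orb_def orb0_def csub_hull)

lemma foldr_in_orb: "v \<in> lists I \<Longrightarrow> foldr S v x \<in> orb I S x"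
  unfolding orb_def by (rule hull_inc) auto

lemma foldr_in_orb0: "v \<in> lists I \<Longrightarrow> v \<noteq> [] \<Longrightarrow> foldr S v x \<in> orb0 I S x"
  unfolding orb0_def by (rule hull_inc) auto

lemma orb_self: "x \<in> orb I S x"
  using foldr_in_orb[of "[]" I S x] by simp

lemma orb_subsetI:
  assumes "csub K" "x \<in> K" "\<And>i y. i \<in> I \<Longrightarrow> y \<in> K \<Longrightarrow> S i y \<in> K" shows "orb I S x \<subseteq> K"
proof -
  have "foldr S v x \<in> K" if "v \<in> lists I" for v
    using that by (induction v) (auto simp: assms)
  then show ?thesis unfolding orb_def using assms(1) by (intro hull_minimal) auto
qed

lemma orb0_subset_orb: "orb0 I S x \<subseteq> orb I S x"
  unfolding orb0_def by (rule hull_minimal) (auto intro!: foldr_in_orb csub_orb)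

lemma orb_orth:
  assumes "\<And>v. v \<in> lists I \<Longrightarrow> cinner h (foldr S v z) = 0" "y \<in> orb I S z"
  shows "cinner h y = 0"
proof -
  have "orb I S z \<subseteq> {y. \<forall>u\<in>{h}. cinner y u = 0}"
    unfolding orb_def
  proof (intro hull_minimal csub_orth subsetI)
    fix y assume "y \<in> {foldr S v z | v. v \<in> lists I}"
    then obtain v where "v \<in> lists I" "y = foldr S v z" by blast
    then show "y \<in> {y. \<forall>u\<in>{h}. cinner y u = 0}" using assms(1)[of v] cinner_eq_0_sym[of h] by simp
  qed
  then show ?thesis using assms(2) cinner_eq_0_sym by blast
qed

locale iso_tuple =
  fixes I :: "nat set" and S :: "nat \<Rightarrow> 'a::complex_hilbert_space \<Rightarrow> 'a"
  assumes S_cbop: "i \<in> I \<Longrightarrow> cbop (S i)"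
    and S_iso: "i \<in> I \<Longrightarrow> cinner (S i x) (S i y) = cinner x y"
    and S_orth: "i \<in> I \<Longrightarrow> j \<in> I \<Longrightarrow> i \<noteq> j \<Longrightarrow> cinner (S i x) (S j y) = 0"
begin

lemma wd_cbop: "v \<in> lists I \<Longrightarrow> cbop (foldr S v)"
proof (induction v)
  case (Cons i v)
  then have "cbop (S i)" "cbop (foldr S v)" by (auto simp: S_cbop)
  then have "cbop (\<lambda>x. S i (foldr S v x))" by (rule cbop_compose)
  then show ?case by (simp add: comp_def)
qed (simp add: id_def)

lemma wd_iso: "v \<in> lists I \<Longrightarrow> cinner (foldr S v x) (foldr S v y) = cinner x y"
  by (induction v) (auto simp: S_iso)

lemma norm_wd: "v \<in> lists I \<Longrightarrow> norm (foldr S v x) = norm x"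
  using wd_iso[of v x x] by (simp add: norm_eq_sqrt_cinner)

lemma cinner_wd_longer: "u \<in> lists I \<Longrightarrow> cinner (foldr S (u @ s) x) (foldr S u y)
    = cinner (foldr S s x) y"
  by (simp add: wd_iso)

lemma cinner_wd_parallel:
  "u \<in> lists I \<Longrightarrow> v \<in> lists I \<Longrightarrow> \<not> prefix u v \<Longrightarrow> \<not> prefix v u \<Longrightarrow> cinner (foldr S u x) (foldr S v y) = 0"
proof (induction u arbitrary: v)
  case (Cons i u)
  then obtain j v' where v: "v = j # v'" by (cases v) auto
  show ?case
    using Cons by (cases "i = j") (auto simp: v S_iso S_orth)
qed simp

lemma adj_S_same: "i \<in> I \<Longrightarrow> adj (S i) (S i x) = x"
  by (rule adj_unique) (simp_all add: S_cbop S_iso)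

lemma adj_S_diff: "i \<in> I \<Longrightarrow> j \<in> I \<Longrightarrow> i \<noteq> j \<Longrightarrow> adj (S i) (S j x) = 0"
  by (rule adj_unique) (simp_all add: S_cbop S_orth)

lemma cbop_adj_S: "i \<in> I \<Longrightarrow> cbop (adj (S i))"
  by (simp add: S_cbop cbop_adj)

lemma S_in_orb:
  assumes i: "i \<in> I" and y: "y \<in> orb I S x" shows "S i y \<in> orb0 I S x"
proof (rule cbop_hull_minimal[OF S_cbop[OF i] csub_orb0 _ y[unfolded orb_def]])
  fix z assume "z \<in> {foldr S v x |v. v \<in> lists I}"
  then obtain v where "v \<in> lists I" "z = foldr S v x" by auto
  then show "S i z \<in> orb0 I S x" using foldr_in_orb0[of "i # v" I S x] i by simp
qed

lemma S_in_orb': "i \<in> I \<Longrightarrow> y \<in> orb I S x \<Longrightarrow> S i y \<in> orb I S x"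
  using S_in_orb orb0_subset_orb by blast

lemma wd_in_orb: "v \<in> lists I \<Longrightarrow> y \<in> orb I S x \<Longrightarrow> foldr S v y \<in> orb I S x"
  by (induction v) (auto simp: S_in_orb')

lemma orb_mono: "y \<in> orb I S x \<Longrightarrow> orb I S y \<subseteq> orb I S x"
  by (rule orb_subsetI) (auto simp: csub_orb S_in_orb')

text \<open>The adjoint of \<open>S i\<close> strips the first letter of a nonempty word or kills
  the vector. Thus the empty word is the only obstruction to \<open>orb I S x\<close> being
  reducing.\<close>

lemma adj_S_orb0:
  assumes i: "i \<in> I" and y: "y \<in> orb0 I S x" shows "adj (S i) y \<in> orb I S x"
proof (rule cbop_hull_minimal[OF cbop_adj_S[OF i] csub_orb _ y[unfolded orb0_def]])
  fix z assume "z \<in> {foldr S v x |v. v \<in> lists I \<and> v \<noteq> []}"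
  then obtain u where "u \<in> lists I" "u \<noteq> []" "z = foldr S u x" by blast
  then obtain j v where "j \<in> I" "v \<in> lists I" "z = S j (foldr S v x)" by (cases u) auto
  then show "adj (S i) z \<in> orb I S x"
    by (cases "i = j") (auto simp: i adj_S_same adj_S_diff foldr_in_orb csub_0 csub_orb)
qed

lemma reducing_orb: "x \<in> orb0 I S x \<Longrightarrow> reducing I S (orb I S x)"
proof -
  assume "x \<in> orb0 I S x"
  then have "orb I S x \<subseteq> orb0 I S x"
    by (intro orb_subsetI csub_orb0 S_in_orb) (use orb0_subset_orb in auto)
  then show ?thesis
    unfolding reducing_def using csub_orb S_in_orb' adj_S_orb0 by blast
qed

lemma wandering_orth:
  assumes z: "wandering I S z" and "u \<in> lists I" "v \<in> lists I" "u \<noteq> v"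
  shows "cinner (foldr S u z) (foldr S v z) = 0"
proof -
  consider s where "v = u @ s" "s \<noteq> []" | s where "u = v @ s" "s \<noteq> []" | "\<not> prefix u v" "\<not> prefix
      v u"
    using \<open>u \<noteq> v\<close> by (metis append_Nil2 prefixE)
  then show ?thesis
  proof cases
    case 1
    then have "cinner (foldr S s z) z = 0" using z assms by (auto simp: wandering_def)
    then have "cinner z (foldr S s z) = 0" using cinner_eq_0_sym by blast
    then show ?thesis using 1 assms by (simp add: wd_iso)
  next
    case 2
    then show ?thesis using z assms by (auto simp: wandering_def wd_iso)
  next
    case 3 then show ?thesis using assms cinner_wd_parallel by blast
  qed
qed

text \<open>Nonempty words map the residual, a vector of \<open>orb I S x\<close>, into
  \<open>orb0 I S x\<close>, to which it is orthogonal.\<close>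

lemma wandering_residual: "wandering I S (x - cproj (orb0 I S x) x)"
proof -
  define z where "z = x - cproj (orb0 I S x) x"
  have z_in: "z \<in> orb I S x"
    unfolding z_def using cproj_in[OF csub_orb0] orb0_subset_orb
    by (intro csub_diff[OF csub_orb] orb_self) blast
  have "cinner (foldr S v z) z = 0" if v: "v \<in> lists I" "v \<noteq> []" for v
  proof -
    have "foldr S v z \<in> orb0 I S x"
      using v wd_in_orb[OF _ z_in] by (cases v) (auto intro: S_in_orb)
    then have "cinner z (foldr S v z) = 0"
      unfolding z_def by (rule cproj_orth[OF csub_orb0])
    then show ?thesis using cinner_eq_0_sym by blast
  qed
  then show ?thesis unfolding wandering_def z_def by blast
qed

lemma no_wandering: "\<nexists>w. wandering I S w \<and> w \<noteq> 0 \<Longrightarrow> x \<in> orb0 I S x"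
  using wandering_residual[of x] cproj_in[OF csub_orb0, of I S x x] by fastforce

lemma wold_decomposition:
  obtains z K where "z \<in> orb I S x" "wandering I S z" "reducing I S K" "K \<subseteq> orb I S x"
    "x - cproj (orb I S z) x \<in> K"
proof -
  let ?P = "cproj (orb0 I S x)"
  define z where "z = x - ?P x"
  have z_orth: "cinner z y = 0" if "y \<in> orb0 I S x" for y
    unfolding z_def by (rule cproj_orth[OF csub_orb0 that])
  have z_in: "z \<in> orb I S x"
    unfolding z_def using cproj_in[OF csub_orb0] orb0_subset_orb
    by (intro csub_diff[OF csub_orb] orb_self) blast
  have wand: "wandering I S z" unfolding z_def by (rule wandering_residual)
  \<comment> \<open>The orthogonal complement of S[z] inside S[x].\<close>
  define K where "K = {k. \<forall>y\<in>orb I S z. cinner k y = 0} \<inter> orb I S x"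
  have K: "csub K" unfolding K_def by (intro csub_Int csub_orth csub_orb)
  have K_orb0: "k \<in> orb0 I S x" if k: "k \<in> K" for k
  proof -
    \<comment> \<open>Membership in \<open>D\<close> says that the part of \<open>y\<close>
      orthogonal to \<open>orb0\<close> is a multiple of \<open>z\<close>; the double orthogonal
      complement makes closedness immediate. For \<open>k\<close> in \<open>K\<close> this multiple
      is also orthogonal to \<open>z\<close>, hence 0.\<close>
    define D where "D = {y. y - ?P y \<in> {y. \<forall>u\<in>{u. cinner z u = 0}. cinner y u = 0}}"
    have "csub D"
      unfolding D_def by (rule cbop_preimage_csub[OF cbop_minus[OF cbop_id(1) cbop_cproj[OF
          csub_orb0]] csub_orth])
    moreover have "foldr S v x \<in> D" if "v \<in> lists I" for v
    proof (cases "v = []")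
      case True then show ?thesis by (auto simp: D_def z_def)
    next
      case False
      then show ?thesis using that by (simp add: D_def cproj_id[OF csub_orb0 foldr_in_orb0])
    qed
    ultimately have "orb I S x \<subseteq> D" unfolding orb_def by (intro hull_minimal) auto
    then have kD: "k \<in> D" using k by (auto simp: K_def)
    have "cinner k z = 0" using k orb_self by (auto simp: K_def)
    then have "cinner z k = 0" using cinner_eq_0_sym by blast
    then have "cinner z (k - ?P k) = 0"
      using z_orth[OF cproj_in[OF csub_orb0]] by (simp add: cinner.diff_right)
    then have "cinner (k - ?P k) (k - ?P k) = 0" using kD by (auto simp: D_def)
    then have "k - ?P k = 0" by (simp only: cinner_eq_zero_iff)
    then show ?thesis using cproj_in[OF csub_orb0, of I S x k] by simp
  qed
  have red: "reducing I S K"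
    unfolding reducing_def
  proof (intro conjI ballI K)
    fix i k assume i: "i \<in> I" and k: "k \<in> K"
    have k_orth: "cinner k (foldr S v z) = 0" if "v \<in> lists I" for v
      using k foldr_in_orb[OF that] by (auto simp: K_def)
    have orthI: "\<forall>y\<in>orb I S z. cinner h y = 0" if "\<And>v. v \<in> lists I \<Longrightarrow> cinner h (foldr S v z) = 0"
        for h
      using orb_orth[OF that] by blast
    have "cinner (S i k) (foldr S v z) = 0" if v: "v \<in> lists I" for v
    proof (cases v)
      case Nil
      have "S i k \<in> orb0 I S x" using k by (intro S_in_orb i) (simp add: K_def)
      then show ?thesis using z_orth[of "S i k"] Nil by simp (metis cinner_commute complex_cnj_zero)
    next
      case (Cons j w)
      then show ?thesis using v i k_orth[of w] by (cases "i = j") (auto simp: S_iso S_orth)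
    qed
    then show "S i k \<in> K" using k i orthI by (simp add: K_def S_in_orb')
    have "cinner (adj (S i) k) (foldr S v z) = 0" if v: "v \<in> lists I" for v
      using k_orth[of "i # v"] v i by (simp add: cinner_adj' S_cbop)
    then show "adj (S i) k \<in> K" using orthI adj_S_orb0[OF i K_orb0[OF k]] by (simp add: K_def)
  qed
  have "x - cproj (orb I S z) x \<in> K"
    unfolding K_def using cproj_orth[OF csub_orb] cproj_in[OF csub_orb, of I S z x] orb_mono[OF
        z_in]
    by (auto intro!: csub_diff[OF csub_orb] orb_self)
  then show thesis using that[of z K] z_in wand red by (auto simp: K_def)
qed

end

section \<open>Reducing subspaces of ampliations\<close>

lemma reducing_iff_proj:
  assumes "csub K" "\<And>i. i \<in> I \<Longrightarrow> cbop (S i)"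
  shows "reducing I S K \<Longrightarrow> i \<in> I \<Longrightarrow> S i (cproj K x) = cproj K (S i x)"
    and "reducing I S K \<Longrightarrow> i \<in> I \<Longrightarrow> adj (S i) (cproj K x) = cproj K (adj (S i) x)"
  using assms by (auto intro!: cproj_commute[symmetric] simp: reducing_def cbop_adj)

lemma foldr_l2_map:
  assumes "\<And>i. i \<in> I \<Longrightarrow> cbop (S i)" "v \<in> lists I"
  shows "l2_nth (foldr (\<lambda>i. l2_map (S i)) v f) j = foldr S v (l2_nth f j)"
  using assms(2) by (induction v) (auto simp: l2_nth_map assms(1))

context iso_tuple begin

lemma iso_tuple_l2: "iso_tuple I (\<lambda>i. l2_map (S i) :: ('i, 'a) l2 \<Rightarrow> _)"
  by unfold_locales (simp_all add: S_cbop cbop_l2_map cinner_l2_def l2_nth_map S_iso S_orth)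

end

context iso_tuple begin

text \<open>The matrix entries of the projection onto \<open>K\<close> commute with all
  \<open>S i\<close> and their adjoints, hence with \<open>T\<close>. So the ampliation of
  \<open>T\<close> commutes with the projection on vectors with one nonzero coordinate, and finite
  support reduces \<open>x\<close> to finitely many of these.\<close>

lemma preserves_reducing_l2:
  fixes x :: "('i, 'a) l2"
  assumes T: "cbop T" "\<And>x. T x \<in> orb I S x"
    and K: "reducing I (\<lambda>i. l2_map (S i)) K" and x: "x \<in> K" "finite F" "\<And>i. i \<notin> F \<Longrightarrow> l2_nth x i = 0"
  shows "l2_map T x \<in> K"
proof -
  define G where "G = S ` I \<union> (\<lambda>i. adj (S i)) ` I"
  have G: "cbop C" "adj C \<in> G" if "C \<in> G" for C
    using that S_cbop cbop_adj_S by (auto simp: G_def)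
  have proj: "T (cproj E x) = cproj E (T x)"
    if E: "csub E" and com: "\<And>C x. C \<in> G \<Longrightarrow> C (cproj E x) = cproj E (C x)" for E x
  proof -
    have com': "S i (cproj E x) = cproj E (S i x)" if "i \<in> I" for i x
    proof -
      have "S i \<in> G" using that by (auto simp: G_def)
      then show ?thesis by (rule com)
    qed
    have inv: "T y \<in> E'" if "csub E'" "y \<in> E'" "\<And>i y. i \<in> I \<Longrightarrow> y \<in> E' \<Longrightarrow> S i y \<in> E'" for E' y
    proof -
      have "orb I S y \<subseteq> E'" using that by (rule orb_subsetI)
      then show ?thesis using T(2)[of y] by (rule subsetD)
    qed
    \<comment> \<open>Both \<open>E\<close> and the kernel of \<open>cproj E\<close> are closed and
      invariant under the \<open>S i\<close>, hence under \<open>T\<close>; together this is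
      commutation with the projection.\<close>
    have 1: "T (cproj E x) \<in> E"
    proof (rule inv[OF E cproj_in[OF E]])
      show "S i y \<in> E" if "i \<in> I" "y \<in> E" for i y
        using com'[OF that(1), of y] cproj_in[OF E, of "S i y"] cproj_id[OF E that(2)] by simp
    qed
    have "csub {y. cproj E y \<in> {0}}"
      by (rule cbop_preimage_csub[OF cbop_cproj[OF E]]) (simp add: csub_def)
    then have "T (x - cproj E x) \<in> {y. cproj E y \<in> {0}}"
    proof (rule inv)
      show "x - cproj E x \<in> {y. cproj E y \<in> {0}}"
        by (simp add: cbop_diff[OF cbop_cproj[OF E]] cproj_id[OF E cproj_in[OF E]])
      show "S i y \<in> {y. cproj E y \<in> {0}}" if "i \<in> I" "y \<in> {y. cproj E y \<in> {0}}" for i y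
        using that com'[OF that(1), of y] by (simp add: S_cbop cbop_0)
    qed
    then have "cproj E (T x) = cproj E (T (cproj E x))"
      by (simp add: cbop_diff[OF T(1)] cbop_diff[OF cbop_cproj[OF E]])
    then show ?thesis using cproj_id[OF E 1] by simp
  qed
  note Kc = K[unfolded reducing_def, THEN conjunct1]
  have lc: "cbop (l2_map (S i) :: ('i, 'a) l2 \<Rightarrow> _)" if "i \<in> I" for i
    by (intro cbop_l2_map S_cbop that)
  let ?P = "cproj K"
  have single: "l2_map T (?P (l2_single j h)) = ?P (l2_single j (T h))" for j :: 'i and h
  proof (rule l2_eqI)
    fix i
    let ?A = "\<lambda>h. l2_nth (?P (l2_single j h)) i"
    have "T (?A h) = ?A (T h)"
    proof (rule commutes_if_commutes_projections[where F = G and A = ?A and T = T])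
      show "cbop ?A"
        by (rule cbop_compose[OF cbop_l2_nth cbop_compose[OF cbop_cproj[OF Kc] cbop_l2_single]])
      show "C (?A h) = ?A (C h)" if "C \<in> G" for C h
      proof -
        note C = G(1)[OF that]
        have "l2_map C (?P f) = ?P (l2_map C f)" for f
          using that reducing_iff_proj[OF Kc lc K] by (auto simp: G_def adj_l2_map S_cbop)
        moreover have "l2_map C (l2_single j h) = l2_single j (C h)"
          by (intro l2_eqI) (simp add: l2_nth_map[OF C] l2_nth_single cbop_0[OF C])
        ultimately show ?thesis by (metis l2_nth_map[OF C])
      qed
      show "T (cproj E x) = cproj E (T x)"
        if "csub E" "\<And>C x. C \<in> G \<Longrightarrow> C (cproj E x) = cproj E (C x)" for E x
        using that by (rule proj)
    qed (fact T G)+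
    then show "l2_nth (l2_map T (?P (l2_single j h))) i = l2_nth (?P (l2_single j (T h))) i"
      by (simp add: l2_nth_map[OF T(1)])
  qed
  have "x = ?P x" by (rule cproj_id[OF Kc x(1), symmetric])
  also have "\<dots> = (\<Sum>i\<in>F. ?P (l2_single i (l2_nth x i)))"
    by (subst l2_finite_support[OF x(2,3)]) (auto simp: cbop_sum[OF cbop_cproj[OF Kc]])
  finally have "l2_map T x = l2_map T (\<Sum>i\<in>F. ?P (l2_single i (l2_nth x i)))" by (rule arg_cong)
  also have "\<dots> = (\<Sum>i\<in>F. l2_map T (?P (l2_single i (l2_nth x i))))"
    by (rule cbop_sum[OF cbop_l2_map[OF T(1)]])
  also have "\<dots> \<in> K" unfolding single by (intro csub_sum Kc cproj_in)
  finally show ?thesis .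
qed

end

subsection \<open>Intertwiners on the orbit of a wandering vector\<close>

lemma bessel_orthonormal:
  fixes g :: "'i \<Rightarrow> 'a::complex_hilbert_space"
  assumes orth: "\<And>i j. i \<noteq> j \<Longrightarrow> cinner (g i) (g j) = 0" and le1: "\<And>i. norm (g i) \<le> 1"
  shows "bessel g 1"
  unfolding bessel_def
proof (intro conjI allI impI)
  fix h F assume F: "finite (F :: 'i set)"
  define c where "c i = cinner h (g i)" for i
  define p where "p = (\<Sum>i\<in>F. c i *\<^sub>C g i)"
  have hp: "cinner h p = of_real (\<Sum>i\<in>F. (cmod (c i))\<^sup>2)"
    by (simp add: p_def cinner.sum_right cinner_scaleC_right c_def mult_cnj_cmod mult.commute[of
        "cnj _"])
  have gp: "cinner (g i) p = cnj (c i) * cinner (g i) (g i)" if "i \<in> F" for i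
  proof -
    have "cinner (g i) p = (\<Sum>j\<in>F. cnj (c j) * cinner (g i) (g j))"
      by (simp add: p_def cinner.sum_right cinner_scaleC_right)
    also have "\<dots> = (\<Sum>j\<in>F. if j = i then cnj (c i) * cinner (g i) (g i) else 0)"
      by (intro sum.cong refl) (use orth in auto)
    also have "\<dots> = cnj (c i) * cinner (g i) (g i)" using that F by simp
    finally show ?thesis .
  qed
  have "cinner p p = (\<Sum>i\<in>F. c i * cinner (g i) p)"
    by (subst p_def) (simp add: cinner.sum_left cinner_scaleC_left)
  also have "\<dots> = (\<Sum>i\<in>F. of_real ((cmod (c i))\<^sup>2 * (norm (g i))\<^sup>2))"
    by (intro sum.cong refl) (simp add: gp cinner_self mult_cnj_cmod flip: mult.assoc)
  also have "\<dots> = of_real (\<Sum>i\<in>F. (cmod (c i))\<^sup>2 * (norm (g i))\<^sup>2)"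
    by simp
  finally have "(norm p)\<^sup>2 = (\<Sum>i\<in>F. (cmod (c i))\<^sup>2 * (norm (g i))\<^sup>2)"
    unfolding cinner_self of_real_eq_iff .
  also have "\<dots> \<le> (\<Sum>i\<in>F. (cmod (c i))\<^sup>2)"
    using le1 by (intro sum_mono mult_left_le power_le_one) auto
  finally have "(\<Sum>i\<in>F. (cmod (c i))\<^sup>2) \<le> (norm h)\<^sup>2"
    using norm_diff_sq[of h p] zero_le_power2[of "norm (h - p)"] by (simp add: hp)
  then show "L2_set (\<lambda>i. cmod (cinner h (g i))) F \<le> 1 * norm h"
    by (simp add: L2_set_def c_def real_le_lsqrt sum_nonneg)
qed simp

text \<open>Zero outside the words over \<open>I\<close>, so that all lists can serve as the index type.\<close>

definition fam :: "nat set \<Rightarrow> (nat \<Rightarrow> 'a::complex_hilbert_space \<Rightarrow> 'a) \<Rightarrow> 'a \<Rightarrow> nat list \<Rightarrow> 'a" where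
  "fam I S x v = (if v \<in> lists I then foldr S v x else 0)"

lemma (in iso_tuple) bessel_wandering:
  assumes "wandering I S z" "norm z = 1" shows "bessel (fam I S z) 1"
  using assms by (intro bessel_orthonormal) (auto simp: fam_def wandering_orth norm_wd)

lemma orb_agree:
  assumes A: "cbop A" and B: "cbop B" and eq: "\<And>v. v \<in> lists I \<Longrightarrow> A (foldr S v w) = B (foldr S v w)"
    and h: "h \<in> orb I S w"
  shows "A h = B h"
proof -
  have "csub {h. A h - B h \<in> {0}}"
    by (rule cbop_preimage_csub[OF cbop_minus[OF A B]]) (simp add: csub_def)
  moreover have "{foldr S v w | v. v \<in> lists I} \<subseteq> {h. A h - B h \<in> {0}}"
    using eq by auto
  ultimately show ?thesis using h hull_minimal[of _ "{h. A h - B h \<in> {0}}" csub] unfolding orb_def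
      by auto
qed

lemma csub_image:
  assumes Y: "cbop Y" and M: "csub M" and e: "0 < e" "\<And>f. f \<in> M \<Longrightarrow> e * norm f \<le> norm (Y f)"
  shows "csub (Y ` M)"
  unfolding csub_def
proof (intro conjI ballI allI)
  have "complete (Y ` M)"
  proof (rule complete_isometric_image[OF e(1)])
    show "subspace M" using M by (auto simp: subspace_def csub_def scaleR_scaleC)
    show "bounded_linear Y" by (rule cbop_bl[OF Y])
    show "complete M" using csub_closed[OF M] by (simp add: complete_eq_closed)
  qed (use e(2) in blast)
  then show "closed (Y ` M)" by (simp add: complete_eq_closed)
  show "0 \<in> Y ` M" using csub_0[OF M] cbop_0[OF Y] by (metis imageI)
  show "y + z \<in> Y ` M" if "y \<in> Y ` M" "z \<in> Y ` M" for y z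
    using that csub_add[OF M] by (auto simp: cbop_add[OF Y, symmetric])
  show "d *\<^sub>C y \<in> Y ` M" if "y \<in> Y ` M" for d y
    using that csub_scale[OF M] by (auto simp: cbop_scale[OF Y, symmetric])
qed

lemma norm_minus_cproj_le:
  assumes L: "csub L" and l: "l \<in> L" shows "norm (e - cproj L e) \<le> norm (e - l)"
proof -
  have "(norm ((e - cproj L e) + (cproj L e - l)))\<^sup>2 = (norm (e - cproj L e))\<^sup>2 + (norm (cproj L e
      - l))\<^sup>2"
    by (intro pythagoras cproj_orth L csub_diff[OF L] cproj_in l)
  then have "(norm (e - cproj L e))\<^sup>2 \<le> (norm (e - l))\<^sup>2" by simp
  then show ?thesis by simp
qed

text \<open>If \<open>e = X g + \<lambda> V g\<close> is solvable for all large \<open>\<lambda>\<close>, then \<open>g = O (1 / \<lambda>)\<close>, hence \<open>e\<close> is a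
    limit of
  vectors of the range of \<open>V\<close>.\<close>

lemma in_csub_of_perturbed_range:
  fixes e :: "'a::complex_hilbert_space"
  assumes L: "csub L" and V: "\<And>g. g \<in> N \<Longrightarrow> V g \<in> L" "\<And>g. g \<in> N \<Longrightarrow> norm (V g) = norm g"
    and X: "0 \<le> c" "\<And>g. g \<in> N \<Longrightarrow> norm (X g) \<le> c * norm g"
    and ex: "\<And>r. c < r \<Longrightarrow> \<exists>g\<in>N. e = X g + of_real r *\<^sub>C V g"
  shows "e \<in> L"
proof -
  have le: "norm (e - cproj L e) \<le> c * norm e / r" if r: "0 < r" for r
  proof -
    \<comment> \<open>With \<open>c + r\<close> in place of r, the term \<open>c * norm g\<close>
      cancels and \<open>r * norm g \<le> norm e\<close> remains.\<close>
    obtain g where g: "g \<in> N" "e = X g + of_real (c + r) *\<^sub>C V g" using ex[of "c + r"] r by auto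
    have "of_real (c + r) *\<^sub>C V g = e - X g" using g(2) by simp
    then have "norm (of_real (c + r) *\<^sub>C V g) \<le> norm e + norm (X g)"
        by (simp only: norm_triangle_ineq4)
    then have "(c + r) * norm g \<le> norm e + c * norm g"
      using X(1) X(2)[OF g(1)] r by (simp only: norm_scaleC V(2)[OF g(1)] norm_of_real)
    then have "norm g \<le> norm e / r" using r by (simp add: field_simps)
    then have "c * norm g \<le> c * (norm e / r)" by (rule mult_left_mono[OF _ X(1)])
    moreover have "norm (e - cproj L e) \<le> norm (e - of_real (c + r) *\<^sub>C V g)"
      by (intro norm_minus_cproj_le L csub_scale[OF L] V g)
    ultimately show ?thesis using X(2)[OF g(1)] g(2) by simp
  qed
  have "(\<lambda>n. c * norm e * inverse (real (Suc n))) \<longlonglongrightarrow> c * norm e * 0"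
    by (intro tendsto_intros LIMSEQ_inverse_real_of_nat)
  then have "norm (e - cproj L e) \<le> c * norm e * 0"
    by (rule LIMSEQ_le_const) (use le[of "real (Suc _)"] in \<open>auto simp: divide_inverse intro!:
        exI[of _ 0]\<close>)
  then have "e = cproj L e" by simp
  then show ?thesis using cproj_in[OF L, of e] by simp
qed

text \<open>For a wandering unit vector \<open>w\<close> and a Bessel family
  \<open>fam I S' x\<close> this is the intertwiner that sends \<open>foldr S v w\<close> to
  \<open>foldr S' v x\<close> and vanishes on the orthogonal complement of \<open>orb I S w\<close>.
  Its target may be another space, such as an ampliation.\<close>

definition transfer_op :: "nat set \<Rightarrow> (nat \<Rightarrow> 'a::complex_hilbert_space \<Rightarrow> 'a) \<Rightarrow> 'a \<Rightarrow>
    (nat \<Rightarrow> 'b::complex_hilbert_space \<Rightarrow> 'b) \<Rightarrow> 'b \<Rightarrow> 'a \<Rightarrow> 'b" where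
  "transfer_op I S w S' x h = synth (fam I S' x) (analysis (fam I S w) h)"

locale wandering_vector = iso_tuple I S for I and S :: "nat \<Rightarrow> 'a::complex_hilbert_space \<Rightarrow> 'a" +
  fixes w :: 'a
  assumes wand: "wandering I S w" and unit: "norm w = 1"
begin

lemma bessel_w: "bessel (fam I S w) 1"
  by (rule bessel_wandering[OF wand unit])

context
  fixes S' :: "nat \<Rightarrow> 'b::complex_hilbert_space \<Rightarrow> 'b" and x :: 'b and C :: real
  assumes x: "bessel (fam I S' x) C" and S': "iso_tuple I S'"
begin

lemma cbop_transfer: "cbop (transfer_op I S w S' x)"
  unfolding transfer_op_def by (rule cbop_compose[OF cbop_synth[OF x] cbop_analysis[OF bessel_w]])

lemma transfer_bound: "norm (transfer_op I S w S' x h) \<le> C * norm h"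
proof -
  have "norm (transfer_op I S w S' x h) \<le> C * norm (analysis (fam I S w) h)"
    unfolding transfer_op_def by (rule norm_synth[OF x])
  also have "\<dots> \<le> C * (1 * norm h)"
    using x by (intro mult_left_mono norm_analysis bessel_w) (simp add: bessel_def)
  finally show ?thesis by simp
qed

lemma transfer_wd:
  assumes v: "v \<in> lists I" shows "transfer_op I S w S' x (foldr S v w) = foldr S' v x"
proof -
  have "analysis (fam I S w) (foldr S v w) = l2_single v 1"
  proof (rule l2_eqI)
    fix u
    show "l2_nth (analysis (fam I S w) (foldr S v w)) u = l2_nth (l2_single v 1) u"
      using v unit wandering_orth[OF wand v]
      by (cases "u \<in> lists I"; cases "u = v")
        (simp_all add: l2_nth_analysis[OF bessel_w] l2_nth_single fam_def norm_wd cinner_self)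
  qed
  then show ?thesis using v by (simp add: transfer_op_def synth_single[OF x]) (simp add: fam_def)
qed

lemma transfer_in_orb: "transfer_op I S w S' x h \<in> orb I S' x"
  unfolding transfer_op_def
  by (rule synth_in[OF x csub_orb]) (simp add: fam_def foldr_in_orb csub_0[OF csub_orb])

lemma transfer_S:
  assumes i: "i \<in> I" and h: "h \<in> orb I S w" shows "transfer_op I S w S' x (S i h)
      = S' i (transfer_op I S w S' x h)"
proof (rule orb_agree[OF _ _ _ h])
  show "cbop (\<lambda>h. transfer_op I S w S' x (S i h))" by (rule cbop_compose[OF cbop_transfer
      S_cbop[OF i]])
  show "cbop (\<lambda>h. S' i (transfer_op I S w S' x h))" by (rule cbop_compose[OF iso_tuple.S_cbop[OF
      S' i] cbop_transfer])
  show "transfer_op I S w S' x (S i (foldr S v w)) = S' i (transfer_op I S w S' x (foldr S v w))"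
      if "v \<in> lists I" for v
    using transfer_wd[of "i # v"] transfer_wd[of v] i that by simp
qed

end

end

context wandering_vector begin

text \<open>Both families of word vectors are orthonormal, so \<open>adj ?X (?X u) - u\<close> is
  orthogonal to \<open>orb I S w\<close> for u in \<open>orb I S w\<close>. The restriction on
  \<open>h\<close> is essential, since the complement is mapped to 0.\<close>

lemma transfer_isometric:
  fixes x :: "'b::complex_hilbert_space"
  assumes S': "iso_tuple I S'" and x: "wandering I S' x" "norm x = 1" and h: "h \<in> orb I S w"
  shows "norm (transfer_op I S w S' x h) = norm h"
proof -
  let ?X = "transfer_op I S w S' x"
  note b = iso_tuple.bessel_wandering[OF S' x]
  note X = cbop_transfer[OF b S']
  define N where "N = {u. \<forall>y\<in>orb I S w. cinner u y = 0}"
  define D where "D = {h. adj ?X (?X h) - h \<in> N}"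
  have "csub D"
    unfolding D_def N_def
    by (rule cbop_preimage_csub[OF cbop_minus[OF cbop_compose[OF cbop_adj[OF X] X] cbop_id(1)]
        csub_orth])
  moreover have "foldr S u w \<in> D" if u: "u \<in> lists I" for u
  proof -
    have "cinner (adj ?X (?X (foldr S u w)) - foldr S u w) y = 0" if "y \<in> orb I S w" for y
    proof (rule orb_orth[OF _ that])
      fix v assume v: "v \<in> lists I"
      have "cinner (foldr S' u x) (foldr S' v x) = cinner (foldr S u w) (foldr S v w)"
        using iso_tuple.wandering_orth[OF S' x(1) u v] wandering_orth[OF wand u v]
          iso_tuple.norm_wd[OF S' u] norm_wd[OF u] x(2) unit
        by (cases "u = v") (simp_all add: cinner_self)
      then show "cinner (adj ?X (?X (foldr S u w)) - foldr S u w) (foldr S v w) = 0"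
        by (simp add: cinner.diff_left cinner_adj'[OF X] transfer_wd[OF b S'] u v)
    qed
    then show ?thesis by (simp add: D_def N_def)
  qed
  ultimately have "orb I S w \<subseteq> D" unfolding orb_def by (intro hull_minimal) auto
  then have "cinner (adj ?X (?X h) - h) h = 0" using h by (auto simp: D_def N_def)
  then have "complex_of_real ((norm (?X h))\<^sup>2) = of_real ((norm h)\<^sup>2)"
    by (simp add: cinner.diff_left cinner_adj'[OF X] cinner_self)
  then show ?thesis by (simp only: of_real_eq_iff) (simp add: power2_eq_iff_nonneg)
qed

section \<open>Commutation of T with intertwiners defined on S[w]\<close>

context
  fixes T :: "'a \<Rightarrow> 'a" and a :: nat
  assumes T: "cbop T" and T_orb: "\<And>x. T x \<in> orb I S x" and a: "a \<in> I"
begin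

definition wk :: "nat \<Rightarrow> 'a" where "wk k = foldr S (replicate k a) w"

text \<open>On word vectors \<open>V k\<close> appends k letters \<open>a\<close> at the right end,
  next to \<open>w\<close>, while \<open>S i\<close> adds a letter at the left end; so the two
  commute on \<open>orb I S w\<close>.\<close>

definition V :: "nat \<Rightarrow> 'a \<Rightarrow> 'a" where "V k = transfer_op I S w S (wk k)"

lemma rep: "replicate k a \<in> lists I"
  using a by (induction k) auto

lemma wk_wand: "wandering I S (wk k)" "norm (wk k) = 1"
proof -
  show "norm (wk k) = 1" unfolding wk_def using norm_wd[OF rep] unit by simp
  show "wandering I S (wk k)" unfolding wandering_def wk_def
  proof (intro ballI impI)
    fix v assume v: "v \<in> lists I" "v \<noteq> []"
    have "cinner (foldr S (v @ replicate k a) w) (foldr S (replicate k a) w) = 0"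
      using v rep by (intro wandering_orth[OF wand]) auto
    then show "cinner (foldr S v (foldr S (replicate k a) w)) (foldr S (replicate k a) w) = 0"
        by simp
  qed
qed

lemmas V_facts = bessel_wandering[OF wk_wand] iso_tuple_axioms

lemma V_cbop: "cbop (V k)"
  unfolding V_def by (rule cbop_transfer[OF V_facts])

lemma V_norm: "h \<in> orb I S w \<Longrightarrow> norm (V k h) = norm h"
  unfolding V_def by (rule transfer_isometric[OF iso_tuple_axioms wk_wand])

lemma V_S: "i \<in> I \<Longrightarrow> h \<in> orb I S w \<Longrightarrow> V k (S i h) = S i (V k h)"
  unfolding V_def by (rule transfer_S[OF V_facts])

lemma V_in: "V k h \<in> orb I S (wk k)"
  unfolding V_def by (rule transfer_in_orb[OF V_facts])

lemma V_wd: "v \<in> lists I \<Longrightarrow> V k (foldr S v w) = foldr S v (wk k)"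
  unfolding V_def by (rule transfer_wd[OF V_facts])

lemma wk_in: "wk k \<in> orb I S w"
  unfolding wk_def by (rule foldr_in_orb[OF rep])

lemma V_in_N: "V k h \<in> orb I S w"
  using V_in orb_mono[OF wk_in] by blast

lemma wk_Suc_in: "wk (Suc k) \<in> orb I S (wk k)"
  using S_in_orb'[OF a orb_self] by (simp add: wk_def)

lemma orb_wk_antimono: "orb I S (wk (Suc k)) \<subseteq> orb I S (wk k)"
  by (rule orb_mono[OF wk_Suc_in])

lemma foldr_wk: "foldr S v (wk k) = foldr S (v @ replicate k a) w"
  by (simp add: wk_def)

lemma V_wk: "v \<in> lists I \<Longrightarrow> V k (foldr S v (wk l)) = foldr S v (wk (k + l))"
  using V_wd[of "v @ replicate l a" k] rep[of l]
  by (simp only: foldr_wk append_in_lists_conv simp_thms append_assoc replicate_add[symmetric]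
      add.commute)

lemma V_add: "h \<in> orb I S w \<Longrightarrow> V k (V l h) = V (k + l) h"
  by (rule orb_agree[OF cbop_compose[OF V_cbop V_cbop] V_cbop]) (simp_all add: V_wd V_wk)

lemma V_orb_wk:
  assumes h: "h \<in> orb I S (wk l)" shows "V k h \<in> orb I S (wk (k + l))"
proof (rule cbop_hull_minimal[OF V_cbop csub_orb _ h[unfolded orb_def]])
  fix z assume "z \<in> {foldr S v (wk l) | v. v \<in> lists I}"
  then obtain v where "v \<in> lists I" "z = foldr S v (wk l)" by blast
  then show "V k z \<in> orb I S (wk (k + l))" by (simp only: V_wk foldr_in_orb)
qed

text \<open>The subspace \<open>orb I S (wk k)\<close> is spanned by words of length at least k
  applied to \<open>w\<close>, and these are orthogonal to all shorter ones.\<close>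

lemma Inter_orb_wk:
  assumes "\<And>k. h \<in> orb I S (wk k)" shows "h = 0"
proof -
  have "cinner h (foldr S u w) = 0" if u: "u \<in> lists I" for u
  proof -
    have "cinner (foldr S u w) h = 0"
    proof (rule orb_orth[OF _ assms[of "Suc (length u)"]])
      fix v assume v: "v \<in> lists I"
      have "length (v @ replicate (Suc (length u)) a) \<noteq> length u" by simp
      then have "u \<noteq> v @ replicate (Suc (length u)) a" by metis
      then show "cinner (foldr S u w) (foldr S v (wk (Suc (length u)))) = 0"
        unfolding foldr_wk using u v a by (intro wandering_orth[OF wand]) auto
    qed
    then show ?thesis using cinner_eq_0_sym by blast
  qed
  moreover have "h \<in> orb I S w" using assms[of 0] by (simp add: wk_def)
  ultimately have "cinner h h = 0" using orb_orth by blast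
  then show ?thesis by (simp add: cinner_eq_zero_iff)
qed

text \<open>Because \<open>V k\<close> is isometric on \<open>orb I S w\<close>, the number
  \<open>r - c\<close> is a lower bound for the perturbed operator. No relation between
  \<open>f\<close> and \<open>g\<close> is claimed; finding it is the task of the following
  lemmas.\<close>

lemma graph:
  assumes X: "cbop X" "\<And>i h. i \<in> I \<Longrightarrow> h \<in> orb I S w \<Longrightarrow> X (S i h) = S i (X h)"
    and c: "0 \<le> c" "\<And>h. norm (X h) \<le> c * norm h" and r: "c < r" and f: "f \<in> orb I S w"
  shows "\<exists>g\<in>orb I S w. T (X f + of_real r *\<^sub>C V k f) = X g + of_real r *\<^sub>C V k g"
proof -
  let ?Y = "\<lambda>h. X h + of_real r *\<^sub>C V k h" and ?N = "orb I S w"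
  have Y: "cbop ?Y" by (rule cbop_plus[OF X(1) cbop_scaleC[OF V_cbop]])
  have "csub (?Y ` ?N)"
  proof (rule csub_image[OF Y csub_orb])
    show "0 < r - c" using r by simp
    fix h assume h: "h \<in> ?N"
    have "r * norm h = norm (of_real r *\<^sub>C V k h)"
      using c(1) r by (simp add: norm_scaleC V_norm[OF h])
    also have "\<dots> = norm (?Y h - X h)" by simp
    also have "\<dots> \<le> norm (?Y h) + norm (X h)" by (rule norm_triangle_ineq4)
    finally show "(r - c) * norm h \<le> norm (?Y h)" using c(2)[of h] by (simp add: algebra_simps)
  qed
  then have "orb I S (?Y f) \<subseteq> ?Y ` ?N"
  proof (rule orb_subsetI)
    show "?Y f \<in> ?Y ` ?N" using f by blast
    show "S i y \<in> ?Y ` ?N" if i: "i \<in> I" and y: "y \<in> ?Y ` ?N" for i y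
    proof -
      obtain h where h: "h \<in> ?N" "y = ?Y h" using y by blast
      have "S i y = ?Y (S i h)"
        using i h by (simp add: X(2) V_S cbop_add[OF S_cbop[OF i]] cbop_scale[OF S_cbop[OF i]])
      then show ?thesis using S_in_orb'[OF i h(1)] by blast
    qed
  qed
  then show ?thesis using T_orb[of "?Y f"] by blast
qed

lemma T_in_N: "f \<in> orb I S w \<Longrightarrow> T f \<in> orb I S w"
  using T_orb[of f] orb_mono by blast

text \<open>Taking X = 0 in \<open>graph\<close> gives a vector \<open>t\<close>, about which
  nothing further is known at first. Taking for X the identity then shows that \<open>t\<close> and
  \<open>T f\<close> agree modulo \<open>orb I S (wk k)\<close>.\<close>

lemma T_V_ex:
  assumes "f \<in> orb I S w"
  obtains t where "t \<in> orb I S w" "T (V k f) = V k t" "T f - t \<in> orb I S (wk k)"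
proof -
  have "\<exists>g\<in>orb I S w. T (0 + of_real 1 *\<^sub>C V k f) = 0 + of_real 1 *\<^sub>C V k g"
    by (rule graph[of "\<lambda>_. 0" 0, OF _ _ _ _ _ assms]) (simp_all add: S_cbop cbop_0)
  then obtain t where t: "t \<in> orb I S w" "T (V k f) = V k t" by auto
  have "T f - t \<in> orb I S (wk k)"
  proof (rule in_csub_of_perturbed_range[where N = "orb I S w" and V = "V k" and X = "\<lambda>x. x" and c
      = 1])
    fix r :: real assume r: "1 < r"
    have "\<exists>g\<in>orb I S w. T (f + of_real r *\<^sub>C V k f) = g + of_real r *\<^sub>C V k g"
      by (rule graph[of "\<lambda>h. h" 1, OF _ _ _ _ r assms]) simp_all
    then obtain g where g: "g \<in> orb I S w" "T f + of_real r *\<^sub>C V k t = g + of_real r *\<^sub>C V k g"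
      by (auto simp: cbop_add[OF T] cbop_scale[OF T] t)
    then have "T f - t = (g - t) + of_real r *\<^sub>C V k (g - t)"
      by (simp add: cbop_diff[OF V_cbop] scaleC_diff_right algebra_simps)
    then show "\<exists>g\<in>orb I S w. T f - t = g + of_real r *\<^sub>C V k g"
      using csub_diff[OF csub_orb g(1) t(1)] by blast
  qed (simp_all add: csub_orb V_in V_norm)
  then show thesis using t that by blast
qed

lemma T_V_1:
  assumes f: "f \<in> orb I S w" shows "T (V 1 f) = V 1 (T f)"
proof -
  have "T (V 1 f) - V 1 (T f) \<in> orb I S (wk k)" for k
  proof -
    obtain t where t: "t \<in> orb I S w" "T (V k (V 1 f)) = V k t" "T (V 1 f) - t \<in> orb I S (wk k)"
      using T_V_ex[OF V_in_N] .
    obtain s where s: "s \<in> orb I S w" "T (V (Suc k) f) = V (Suc k) s" "T f - s \<in> orb I S (wk (Suc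
        k))"
      using T_V_ex[OF f] .
    \<comment> \<open>Both sides are the image under \<open>T\<close> of \<open>V (Suc k) f\<close>.
      Hence \<open>t\<close> equals \<open>V 1 s\<close>, and the commutator of \<open>T\<close>
      with \<open>V 1\<close> is the difference of two vectors of
      \<open>orb I S (wk k)\<close>.\<close>
    have "V k t = V k (V 1 s)" using t(2) s(2) by (simp add: V_add f s(1))
    then have "V k (t - V 1 s) = 0" by (simp add: cbop_diff[OF V_cbop])
    then have "norm (t - V 1 s) = 0"
      using V_norm[of "t - V 1 s" k] csub_diff[OF csub_orb t(1) V_in_N] by simp
    then have "T (V 1 f) - V 1 (T f) = (T (V 1 f) - t) - V 1 (T f - s)"
      by (simp add: cbop_diff[OF V_cbop])
    moreover have "V 1 (T f - s) \<in> orb I S (wk k)"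
      using V_orb_wk[OF s(3), of 1] orb_wk_antimono[of k] orb_wk_antimono[of "Suc k"] by auto
    ultimately show ?thesis by (simp only: csub_diff[OF csub_orb t(3)])
  qed
  then have "T (V 1 f) - V 1 (T f) = 0" by (rule Inter_orb_wk)
  then show ?thesis by simp
qed

lemma T_V:
  assumes f: "f \<in> orb I S w" shows "T (V k f) = V k (T f)"
proof (induction k)
  case 0
  have "V 0 h = h" if "h \<in> orb I S w" for h
    by (rule orb_agree[OF V_cbop cbop_id(1) _ that]) (simp add: V_wd wk_def)
  then show ?case using f T_in_N by simp
next
  case (Suc k)
  have "T (V (Suc k) f) = T (V 1 (V k f))" using V_add[OF f, of 1 k] by simp
  also have "\<dots> = V 1 (V k (T f))" by (simp only: T_V_1[OF V_in_N] Suc)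
  also have "\<dots> = V (Suc k) (T f)" using V_add[OF T_in_N[OF f], of 1 k] by simp
  finally show ?case .
qed

lemma T_transfer:
  assumes x: "bessel (fam I S x) C" and f: "f \<in> orb I S w"
  shows "T (transfer_op I S w S x f) = transfer_op I S w S x (T f)"
proof -
  let ?X = "transfer_op I S w S x"
  note xS = x iso_tuple_axioms
  have C: "0 \<le> C" using x by (simp add: bessel_def)
  have "T (?X f) - ?X (T f) \<in> orb I S (wk k)" for k
  proof (rule in_csub_of_perturbed_range[where N = "orb I S w" and V = "V k" and X = ?X and c = C])
    fix r :: real assume r: "C < r"
    have "\<exists>g\<in>orb I S w. T (?X f + of_real r *\<^sub>C V k f) = ?X g + of_real r *\<^sub>C V k g"
      by (rule graph[of ?X C, OF cbop_transfer[OF xS] transfer_S[OF xS] C transfer_bound[OF xS] r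
          f])
    then obtain g where g: "g \<in> orb I S w" "T (?X f) + of_real r *\<^sub>C V k (T f) = ?X g
        + of_real r *\<^sub>C V k g"
      by (auto simp: cbop_add[OF T] cbop_scale[OF T] T_V[OF f])
    have "T (?X f) = ?X g + of_real r *\<^sub>C V k g - of_real r *\<^sub>C V k (T f)"
      by (rule eq_diff_eq[THEN iffD2, OF g(2)])
    \<comment> \<open>Since \<open>T\<close> commutes with \<open>V k\<close>, the unknown
      \<open>g\<close> enters only through \<open>g - T f\<close>.\<close>
    then have "T (?X f) - ?X (T f) = ?X (g - T f) + of_real r *\<^sub>C V k (g - T f)"
      by (simp add: cbop_diff[OF V_cbop] cbop_diff[OF cbop_transfer[OF xS]] scaleC_diff_right)
    then show "\<exists>g\<in>orb I S w. T (?X f) - ?X (T f) = ?X g + of_real r *\<^sub>C V k g"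
      using csub_diff[OF csub_orb g(1) T_in_N[OF f]] by blast
  qed (simp_all add: csub_orb V_in V_norm C transfer_bound[OF xS])
  then have "T (?X f) - ?X (T f) = 0" by (rule Inter_orb_wk)
  then show ?thesis by simp
qed

end

end

subsection \<open>Reduction to the existence of wandering vectors\<close>

text \<open>Coordinates of a wandering vector of an ampliation need not be wandering, but they
  inherit the Bessel bound, which is all that \<open>transfer_op\<close> asks of its target
  vector.\<close>

lemma bessel_l2_nth:
  fixes z :: "('i, 'a::complex_hilbert_space) l2"
  assumes S: "iso_tuple I S" and z: "bessel (fam I (\<lambda>i. l2_map (S i)) z) C"
  shows "bessel (fam I S (l2_nth z j)) C"
    and "cinner (l2_single j h) (fam I (\<lambda>i. l2_map (S i)) z v) = cinner h (fam I S (l2_nth z j) v)"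
proof -
  have eq: "cinner (l2_single j h) (fam I (\<lambda>i. l2_map (S i)) z v) = cinner h (fam I S (l2_nth z j)
      v)" for h v
    using foldr_l2_map[of I S v z j] iso_tuple.S_cbop[OF S] by (simp add: fam_def cinner_l2_single)
  then show "cinner (l2_single j h) (fam I (\<lambda>i. l2_map (S i)) z v) = cinner h (fam I S (l2_nth z
      j) v)" .
  show "bessel (fam I S (l2_nth z j)) C"
    unfolding bessel_def
  proof (intro conjI allI impI)
    show "0 \<le> C" using z by (simp add: bessel_def)
    show "L2_set (\<lambda>v. cmod (cinner h (fam I S (l2_nth z j) v))) F \<le> C * norm h" if "finite F"
        for h F
      using z that unfolding bessel_def eq[symmetric] by (metis norm_l2_single)
  qed
qed

lemma wandering_scaleC:
  assumes "iso_tuple I S" "wandering I S z" shows "wandering I S (c *\<^sub>C z)"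
  using assms iso_tuple.wd_cbop[OF assms(1)]
  by (simp add: wandering_def cbop_scale cinner_scaleC_left cinner_scaleC_right)

lemma orb_scaleC:
  assumes "iso_tuple I S" "c \<noteq> 0" shows "orb I S (c *\<^sub>C z) = orb I S z"
proof -
  have *: "orb I S (d *\<^sub>C y) \<subseteq> orb I S y" for d y
    by (intro iso_tuple.orb_mono[OF assms(1)] csub_scale[OF csub_orb] orb_self)
  from *[of "inverse c" "c *\<^sub>C z"] *[of c z] show ?thesis using assms(2)
      by (simp add: scaleC_scaleC)
qed

lemma wandering_normalize:
  assumes S: "iso_tuple I S" and z: "wandering I S z" "z \<noteq> 0"
  obtains z' where "wandering I S z'" "norm z' = 1" "orb I S z' = orb I S z"
    "z' = complex_of_real (inverse (norm z)) *\<^sub>C z"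
  using wandering_scaleC[OF S z(1)] orb_scaleC[OF S, of "complex_of_real (inverse (norm z))" z]
      z(2) that
  by (simp add: norm_scaleC norm_inverse)

context iso_tuple begin

lemma orb_zero: "orb I S 0 \<subseteq> {0}"
  by (rule orb_subsetI) (auto simp: csub_def cbop_0[OF S_cbop])

text \<open>The coordinates of the intertwiner from \<open>orb I S w'\<close> to the ampliation are
  intertwiners into the original space. \<open>T_transfer\<close> applies to each of them, so the
  whole intertwiner carries \<open>T\<close> to its ampliation.\<close>

lemma preserves_wandering_orb_l2:
  fixes z :: "('i, 'a) l2"
  assumes T: "cbop T" "\<And>x. T x \<in> orb I S x" and a: "a \<in> I"
    and w: "wandering I S w" "w \<noteq> 0" and z: "wandering I (\<lambda>i. l2_map (S i)) z"
    and x: "x \<in> orb I (\<lambda>i. l2_map (S i)) z"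
  shows "l2_map T x \<in> orb I (\<lambda>i. l2_map (S i)) z"
proof (cases "z = 0")
  case True
  then have "orb I (\<lambda>i. l2_map (S i)) z \<subseteq> {0}" using iso_tuple.orb_zero[OF iso_tuple_l2] by simp
  then have "x = 0" using x by blast
  then show ?thesis by (simp add: cbop_0[OF cbop_l2_map[OF T(1)]] csub_0[OF csub_orb])
next
  case False
  let ?S = "\<lambda>i. l2_map (S i) :: ('i, 'a) l2 \<Rightarrow> ('i, 'a) l2"
  obtain w' where w': "wandering I S w'" "norm w' = 1"
    using wandering_normalize[OF iso_tuple_axioms w] by metis
  interpret W: wandering_vector I S w' using w' by unfold_locales
  obtain y where y: "wandering I ?S y" "norm y = 1" "orb I ?S y = orb I ?S z"
    using wandering_normalize[OF iso_tuple_l2 z False] by metis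
  note bes = iso_tuple.bessel_wandering[OF iso_tuple_l2 y(1,2)]
  note besj = bessel_l2_nth[OF iso_tuple_axioms bes]
  let ?X = "transfer_op I S w' ?S y"
  have comp: "l2_nth (?X h) j = transfer_op I S w' S (l2_nth y j) h" for h j
  proof (rule cinner_ext)
    fix k
    have "analysis (fam I ?S y) (l2_single j k) = analysis (fam I S (l2_nth y j)) k"
      by (rule l2_eqI) (simp add: l2_nth_analysis[OF bes] l2_nth_analysis[OF besj(1)] besj(2))
    then show "cinner (l2_nth (?X h) j) k = cinner (transfer_op I S w' S (l2_nth y j) h) k"
      by (simp add: transfer_op_def cinner_synth[OF besj(1)] cinner_synth[OF bes] flip:
          cinner_l2_single_right)
  qed
  have TX: "l2_map T (?X h) = ?X (T h)" if "h \<in> orb I S w'" for h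
    by (rule l2_eqI) (simp add: l2_nth_map[OF T(1)] comp W.T_transfer[OF T a besj(1) that])
  show ?thesis
    unfolding y(3)[symmetric]
  proof (rule cbop_hull_minimal[OF cbop_l2_map[OF T(1)] csub_orb _ x[folded y(3), unfolded
      orb_def]])
    fix u assume "u \<in> {foldr ?S v y | v. v \<in> lists I}"
    then obtain v where v: "v \<in> lists I" "u = foldr ?S v y" by blast
    then have "l2_map T u = ?X (T (foldr S v w'))"
      using TX[OF foldr_in_orb[OF v(1)]] W.transfer_wd[OF bes iso_tuple_l2 v(1)] by simp
    then show "l2_map T u \<in> orb I ?S y" using W.transfer_in_orb[OF bes iso_tuple_l2] by simp
  qed
qed

text \<open>The Wold decomposition is taken in the ampliation. Its wandering vector lies in the
  orbit of \<open>x\<close>, hence is supported in \<open>F\<close>; the hypothesis \<open>w\<close>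
  is invoked only if that vector is nonzero.\<close>

lemma preserves_orb_l2:
  fixes x :: "('i, 'a) l2"
  assumes T: "cbop T" "\<And>x. T x \<in> orb I S x" and a: "a \<in> I"
    and w: "\<And>z :: ('i, 'a) l2. wandering I (\<lambda>i. l2_map (S i)) z \<Longrightarrow> z \<noteq> 0 \<Longrightarrow> (\<And>i. i \<notin> F \<Longrightarrow> l2_nth z i
        = 0)
        \<Longrightarrow> \<exists>w. wandering I S w \<and> w \<noteq> 0"
    and x: "finite F" "\<And>i. i \<notin> F \<Longrightarrow> l2_nth x i = 0"
  shows "l2_map T x \<in> orb I (\<lambda>i. l2_map (S i)) x"
proof -
  let ?S = "\<lambda>i. l2_map (S i) :: ('i, 'a) l2 \<Rightarrow> ('i, 'a) l2"
  obtain z K where z: "z \<in> orb I ?S x" "wandering I ?S z" and K: "reducing I ?S K" "K \<subseteq> orb I ?S x"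
    "x - cproj (orb I ?S z) x \<in> K"
    using iso_tuple.wold_decomposition[OF iso_tuple_l2] by metis
  let ?p = "cproj (orb I ?S z) x"
  define D where "D = {f :: ('i, 'a) l2. \<forall>i. i \<notin> F \<longrightarrow> l2_nth f i = 0}"
  have "csub D" unfolding D_def by (rule csub_support)
  then have orbD: "orb I ?S x \<subseteq> D"
    by (rule orb_subsetI) (use x in \<open>auto simp: D_def l2_nth_map S_cbop cbop_0\<close>)
  have p: "?p \<in> orb I ?S z" by (rule cproj_in[OF csub_orb])
  have 1: "l2_map T ?p \<in> orb I ?S z"
  proof (cases "z = 0")
    case False
    then obtain w where "wandering I S w" "w \<noteq> 0" using w[OF z(2)] orbD z(1) by (auto simp: D_def)
    then show ?thesis by (rule preserves_wandering_orb_l2[OF T a _ _ z(2) p])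
  next
    case True
    then have "orb I ?S z \<subseteq> {0}" using iso_tuple.orb_zero[OF iso_tuple_l2] by simp
    then have "?p = 0" using p by blast
    then show ?thesis by (simp add: cbop_0[OF cbop_l2_map[OF T(1)]] csub_0[OF csub_orb])
  qed
  have 2: "l2_map T (x - ?p) \<in> K"
    by (rule preserves_reducing_l2[OF T K(1,3) x(1)]) (use K orbD in \<open>auto simp: D_def\<close>)
  have "l2_map T x = l2_map T ?p + l2_map T (x - ?p)"
    by (simp flip: cbop_add[OF cbop_l2_map[OF T(1)]])
  moreover have "l2_map T ?p \<in> orb I ?S x" using 1 iso_tuple.orb_mono[OF iso_tuple_l2 z(1)] by blast
  ultimately show ?thesis using 2 K(2) by (simp add: csub_add[OF csub_orb] subsetD)
qed

end

subsection \<open>Square sums\<close>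

lemma L2_set_cmod_add: "L2_set (\<lambda>v. cmod (f v + g v)) F \<le> L2_set (\<lambda>v. cmod (f v)) F
    + L2_set (\<lambda>v. cmod (g v)) F"
  by (rule order_trans[OF L2_set_mono L2_set_triangle_ineq]) (simp_all add: norm_triangle_ineq)

lemma L2_set_cmod_sum:
  assumes "finite V" "\<And>a. a \<in> V \<Longrightarrow> L2_set (\<lambda>v. cmod (f a v)) F \<le> t"
  shows "L2_set (\<lambda>v. cmod (\<Sum>a\<in>V. c a * f a v)) F \<le> (\<Sum>a\<in>V. cmod (c a)) * t"
  using assms
proof (induction V)
  case empty then show ?case by (simp add: L2_set_def)
next
  case (insert a V)
  have "L2_set (\<lambda>v. cmod (\<Sum>a\<in>insert a V. c a * f a v)) F
      \<le> L2_set (\<lambda>v. cmod (c a * f a v)) F + L2_set (\<lambda>v. cmod (\<Sum>a\<in>V. c a * f a v)) F"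
    using insert by (simp add: L2_set_cmod_add)
  also have "L2_set (\<lambda>v. cmod (c a * f a v)) F = cmod (c a) * L2_set (\<lambda>v. cmod (f a v)) F"
    by (simp add: norm_mult L2_set_right_distrib)
  also have "\<dots> \<le> cmod (c a) * t" using insert by (intro mult_left_mono) auto
  finally show ?case using insert by (simp add: algebra_simps)
qed

text \<open>\<open>V\<close> is chosen so that its square sum comes within \<open>d\<^sup>2\<close>
  of the supremum over all finite sets.\<close>

lemma L2_set_tail:
  fixes f :: "'i \<Rightarrow> real"
  assumes bound: "\<And>F. finite F \<Longrightarrow> F \<subseteq> A \<Longrightarrow> L2_set f F \<le> c" and "0 < d"
  obtains V where "finite V" "V \<subseteq> A" "\<And>F. finite F \<Longrightarrow> F \<subseteq> A \<Longrightarrow> F \<inter> V = {} \<Longrightarrow> L2_set f F \<le> d"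
proof -
  define s where "s = (SUP F\<in>{F. finite F \<and> F \<subseteq> A}. \<Sum>i\<in>F. (f i)\<^sup>2)"
  have "0 \<le> c" using bound[of "{}"] by simp
  then have "(\<Sum>i\<in>F. (f i)\<^sup>2) \<le> c\<^sup>2" if "finite F" "F \<subseteq> A" for F
    using bound[OF that] by (simp add: L2_set_def sqrt_le_D)
  then have bdd: "bdd_above ((\<lambda>F. \<Sum>i\<in>F. (f i)\<^sup>2) ` {F. finite F \<and> F \<subseteq> A})"
    by (intro bdd_aboveI2[of _ _ "c\<^sup>2"]) auto
  have le: "(\<Sum>i\<in>F. (f i)\<^sup>2) \<le> s" if "finite F" "F \<subseteq> A" for F
    unfolding s_def using that bdd by (intro cSUP_upper) auto
  have "\<exists>V. finite V \<and> V \<subseteq> A \<and> s - d\<^sup>2 < (\<Sum>i\<in>V. (f i)\<^sup>2)"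
  proof (rule ccontr)
    assume "\<not> ?thesis"
    then have "s \<le> s - d\<^sup>2"
      by (subst s_def, intro cSUP_least) (auto simp: not_less)
    then show False using \<open>0 < d\<close> by simp
  qed
  then obtain V where V: "finite V" "V \<subseteq> A" "s - d\<^sup>2 < (\<Sum>i\<in>V. (f i)\<^sup>2)" by blast
  have "L2_set f F \<le> d" if F: "finite F" "F \<subseteq> A" "F \<inter> V = {}" for F
  proof -
    have "(\<Sum>i\<in>F. (f i)\<^sup>2) + (\<Sum>i\<in>V. (f i)\<^sup>2) = (\<Sum>i\<in>F \<union> V. (f i)\<^sup>2)"
      using F V by (simp add: sum.union_disjoint)
    also have "\<dots> \<le> s" using F V by (intro le) auto
    finally have "(\<Sum>i\<in>F. (f i)\<^sup>2) \<le> d\<^sup>2" using V(3) by simp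
    then show ?thesis using \<open>0 < d\<close> by (simp add: L2_set_def real_le_lsqrt sum_nonneg)
  qed
  then show thesis using that V by blast
qed

text \<open>Meant for inner products of word vectors: after cancelling a common prefix, the nonzero
  terms are coefficients indexed injectively by other words.\<close>

lemma L2_set_reindex_le:
  fixes f :: "'i \<Rightarrow> real" and g :: "'j \<Rightarrow> real"
  assumes F: "finite F" and inj: "inj_on \<psi> {v\<in>F. f v \<noteq> 0}"
    and eq: "\<And>v. v \<in> F \<Longrightarrow> f v \<noteq> 0 \<Longrightarrow> f v = g (\<psi> v)"
    and le: "\<And>G. finite G \<Longrightarrow> G \<subseteq> \<psi> ` {v\<in>F. f v \<noteq> 0} \<Longrightarrow> L2_set g G \<le> c"
  shows "L2_set f F \<le> c"
proof -
  have "(\<Sum>v\<in>F. (f v)\<^sup>2) = (\<Sum>v\<in>{v\<in>F. f v \<noteq> 0}. (f v)\<^sup>2)"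
    using F by (intro sum.mono_neutral_right) auto
  also have "\<dots> = (\<Sum>v\<in>{v\<in>F. f v \<noteq> 0}. (g (\<psi> v))\<^sup>2)" using eq by (intro sum.cong) auto
  also have "\<dots> = (\<Sum>t\<in>\<psi> ` {v\<in>F. f v \<noteq> 0}. (g t)\<^sup>2)" by (simp add: sum.reindex[OF inj])
  finally have "L2_set f F = L2_set g (\<psi> ` {v\<in>F. f v \<noteq> 0})" by (simp add: L2_set_def)
  then show ?thesis using le[of "\<psi> ` {v\<in>F. f v \<noteq> 0}"] F by simp
qed

lemma norm_sum_orthogonal:
  fixes f :: "'i \<Rightarrow> 'a::complex_hilbert_space"
  assumes "finite F" "\<And>i j. i \<in> F \<Longrightarrow> j \<in> F \<Longrightarrow> i \<noteq> j \<Longrightarrow> cinner (f i) (f j) = 0"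
  shows "norm (\<Sum>i\<in>F. f i) = L2_set (\<lambda>i. norm (f i)) F"
proof -
  have "(norm (\<Sum>i\<in>F. f i))\<^sup>2 = (\<Sum>i\<in>F. (norm (f i))\<^sup>2)"
    using assms
  proof (induction F)
    case (insert i F)
    have "cinner (f i) (\<Sum>j\<in>F. f j) = 0"
      using insert.hyps insert.prems by (auto simp: cinner.sum_right intro!: sum.neutral)
    then show ?case using insert by (simp add: pythagoras)
  qed simp
  then show ?thesis by (simp add: L2_set_def real_sqrt_unique)
qed

lemma csub_closure:
  fixes A :: "'a::complex_hilbert_space set"
  assumes "0 \<in> A" "\<And>x y. x \<in> A \<Longrightarrow> y \<in> A \<Longrightarrow> x + y \<in> A" "\<And>c x. x \<in> A \<Longrightarrow> c *\<^sub>C x \<in> A"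
  shows "csub (closure A)"
  unfolding csub_def
proof (intro conjI ballI allI)
  show "0 \<in> closure A" using assms(1) closure_subset by blast
  show "x + y \<in> closure A" if xy: "x \<in> closure A" "y \<in> closure A" for x y
  proof -
    obtain f g where f: "\<And>n. f n \<in> A" "f \<longlonglongrightarrow> x" and g: "\<And>n. g n \<in> A" "g \<longlonglongrightarrow> y"
      using xy unfolding closure_sequential by auto
    then have "\<forall>n. f n + g n \<in> A" "(\<lambda>n. f n + g n) \<longlonglongrightarrow> x + y"
      by (auto intro: assms tendsto_add)
    then show ?thesis unfolding closure_sequential by (intro exI[of _ "\<lambda>n. f n + g n"] conjI)
  qed
  show "c *\<^sub>C x \<in> closure A" if x: "x \<in> closure A" for c x
  proof -
    obtain f where f: "\<And>n. f n \<in> A" "f \<longlonglongrightarrow> x"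
      using x unfolding closure_sequential by auto
    then have "\<forall>n. c *\<^sub>C f n \<in> A" "(\<lambda>n. c *\<^sub>C f n) \<longlonglongrightarrow> c *\<^sub>C x"
      by (auto intro: assms scaleC.tendsto tendsto_const)
    then show ?thesis unfolding closure_sequential by (intro exI[of _ "\<lambda>n. c *\<^sub>C f n"] conjI)
  qed
qed simp

text \<open>The \<open>R b\<close> are isometries with orthogonal ranges whose closed span contains
  \<open>x\<close>, so the squares of \<open>norm (adj (R b) x)\<close> add up to
  \<open>(norm x)\<^sup>2\<close>. Testing \<open>x\<close> against finite sums from the ranges
  yields the needed inequality without an infinite sum.\<close>

lemma norm_le_of_total_ranges:
  fixes R :: "'i \<Rightarrow> 'a::complex_hilbert_space \<Rightarrow> 'a"
  assumes R: "\<And>b. b \<in> W \<Longrightarrow> cbop (R b)" "\<And>b x. b \<in> W \<Longrightarrow> norm (R b x) = norm x"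
      "\<And>b b' x y. b \<in> W \<Longrightarrow> b' \<in> W \<Longrightarrow> b \<noteq> b' \<Longrightarrow> cinner (R b x) (R b' y) = 0"
    and total: "x \<in> csub hull {R b h | b h. b \<in> W}"
    and le: "\<And>F. finite F \<Longrightarrow> F \<subseteq> W \<Longrightarrow> L2_set (\<lambda>b. norm (adj (R b) x)) F \<le> c"
  shows "norm x \<le> c"
proof -
  define A where "A = {\<Sum>b\<in>F. R b (h b) | F h. finite F \<and> F \<subseteq> W}"
  have "csub (closure A)"
  proof (rule csub_closure)
    show "0 \<in> A" unfolding A_def by (rule CollectI, rule exI[of _ "{}"]) simp
    show "x + y \<in> A" if xy: "x \<in> A" "y \<in> A" for x y
    proof -
      obtain F h G k where x: "x = (\<Sum>b\<in>F. R b (h b))" "finite F" "F \<subseteq> W"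
        and y: "y = (\<Sum>b\<in>G. R b (k b))" "finite G" "G \<subseteq> W"
        using xy unfolding A_def by blast
      have ext: "(\<Sum>b\<in>F. R b (h b)) = (\<Sum>b\<in>F \<union> G. R b (if b \<in> F then h b else 0))"
        if "finite F" "finite G" "F \<subseteq> W" "G \<subseteq> W" for F G h
        using that by (intro sum.mono_neutral_cong_left) (auto simp: cbop_0[OF R(1)])
      have "x + y = (\<Sum>b\<in>F \<union> G. R b (if b \<in> F then h b else 0) + R b (if b \<in> G then k b else 0))"
        unfolding sum.distrib x(1) y(1) using ext[of F G h] ext[of G F k] x y
            by (simp add: Un_commute)
      also have "\<dots> = (\<Sum>b\<in>F \<union> G. R b ((if b \<in> F then h b else 0) + (if b \<in> G then k b else 0)))"
        using x y by (intro sum.cong refl cbop_add[OF R(1), symmetric]) auto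
      finally have "x + y = (\<Sum>b\<in>F \<union> G. R b ((\<lambda>b. (if b \<in> F then h b else 0)
          + (if b \<in> G then k b else 0)) b))" .
      moreover have "finite (F \<union> G)" "F \<union> G \<subseteq> W" using x y by auto
      ultimately show ?thesis unfolding A_def by (intro CollectI exI conjI)
    qed
    show "c *\<^sub>C x \<in> A" if "x \<in> A" for c x
    proof -
      obtain F h where x: "x = (\<Sum>b\<in>F. R b (h b))" "finite F" "F \<subseteq> W"
        using \<open>x \<in> A\<close> unfolding A_def by blast
      have "c *\<^sub>C x = (\<Sum>b\<in>F. R b (c *\<^sub>C h b))"
        unfolding x(1) scaleC_sum_right using x by (intro sum.cong refl cbop_scale[OF R(1),
            symmetric]) auto
      then have "c *\<^sub>C x = (\<Sum>b\<in>F. R b ((\<lambda>b. c *\<^sub>C h b) b))" .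
      moreover have "finite F" "F \<subseteq> W" using x by auto
      ultimately show ?thesis unfolding A_def by (intro CollectI exI conjI)
    qed
  qed
  moreover have "R b h \<in> closure A" if "b \<in> W" for b h
  proof -
    have "R b h \<in> A" unfolding A_def using that
      by (intro CollectI exI[of _ "{b}"] exI[of _ "\<lambda>_. h"]) simp
    then show ?thesis using closure_subset by blast
  qed
  ultimately have x: "x \<in> closure A"
    using total hull_minimal[of "{R b h | b h. b \<in> W}" "closure A" csub] by blast
  have "cmod (cinner x g) \<le> c * norm g" if gA: "g \<in> A" for g
  proof -
    obtain F h where g: "g = (\<Sum>b\<in>F. R b (h b))" "finite F" "F \<subseteq> W"
      using gA unfolding A_def by blast
    have "norm g = L2_set (\<lambda>b. norm (R b (h b))) F"
      unfolding g(1) using g(3) by (intro norm_sum_orthogonal g(2) R(3)) auto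
    also have "\<dots> = L2_set (\<lambda>b. norm (h b)) F" using g(3) by (intro L2_set_cong refl R(2)) auto
    finally have ng: "norm g = L2_set (\<lambda>b. norm (h b)) F" .
    have "cinner x g = (\<Sum>b\<in>F. cinner (adj (R b) x) (h b))"
      unfolding g(1) cinner.sum_right using g(3) by (intro sum.cong refl cinner_adj'[OF R(1),
          symmetric]) auto
    also have "cmod \<dots> \<le> (\<Sum>b\<in>F. \<bar>norm (adj (R b) x)\<bar> * \<bar>norm (h b)\<bar>)"
      by (rule sum_norm_le) (simp add: cinner_norm_ineq)
    also have "\<dots> \<le> L2_set (\<lambda>b. norm (adj (R b) x)) F * L2_set (\<lambda>b. norm (h b)) F"
      by (rule L2_set_mult_ineq)
    also have "\<dots> \<le> c * norm g" unfolding ng using g by (intro mult_right_mono le) auto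
    finally show ?thesis .
  qed
  then have "A \<subseteq> {g. cmod (cinner x g) \<le> c * norm g}" by blast
  moreover have "closed {g. cmod (cinner x g) \<le> c * norm g}"
    by (intro closed_Collect_le continuous_intros linear_continuous_on cinner.bounded_linear_right)
  ultimately have "cmod (cinner x x) \<le> c * norm x" using closure_minimal x by blast
  moreover have "0 \<le> c" using le[of "{}"] by simp
  ultimately show ?thesis by (cases "x = 0") (auto simp: cinner_self norm_power power2_eq_square
      norm_mult)
qed

subsection \<open>Two or more generators\<close>

context iso_tuple begin

text \<open>Equivalently, the canonical basis vectors of the Fock space can be mapped to the vectors
    \<open>S\<^sub>v x\<close> by a
  bounded operator; such vectors are called absolutely continuous.\<close>

definition ac :: "'a \<Rightarrow> bool" where "ac x \<longleftrightarrow> (\<exists>C. bessel (fam I S x) C)"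

lemma fam_append: "u \<in> lists I \<Longrightarrow> fam I S (foldr S u x) v = fam I S x (v @ u)"
  by (simp add: fam_def)

lemma ac_wd:
  assumes "ac x" "u \<in> lists I" shows "ac (foldr S u x)"
proof -
  obtain C where C: "bessel (fam I S x) C" using assms by (auto simp: ac_def)
  have "bessel (fam I S (foldr S u x)) C"
    unfolding bessel_def fam_append[OF assms(2)]
  proof (intro conjI allI impI)
    show "0 \<le> C" using C by (simp add: bessel_def)
    show "L2_set (\<lambda>v. cmod (cinner h (fam I S x (v @ u)))) F \<le> C * norm h" if "finite F" for h F
      by (rule L2_set_reindex_le[OF that, of "\<lambda>v. v @ u" _ "\<lambda>v. cmod (cinner h (fam I S x v))"])
        (use C in \<open>auto simp: bessel_def inj_on_def\<close>)
  qed
  then show ?thesis by (auto simp: ac_def)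
qed

lemma fam_add: "fam I S (x + y) v = fam I S x v + fam I S y v"
  by (simp add: fam_def cbop_add[OF wd_cbop] del: in_lists_conv_set)

lemma fam_scaleC: "fam I S (c *\<^sub>C x) v = c *\<^sub>C fam I S x v"
  by (simp add: fam_def cbop_scale[OF wd_cbop] del: in_lists_conv_set)

lemma ac_0: "ac 0"
  unfolding ac_def
  by (intro exI[of _ 0]) (simp add: bessel_def fam_def cbop_0[OF wd_cbop] L2_set_def if_distrib
      del: in_lists_conv_set cong: if_cong)

lemma ac_add:
  assumes "ac x" "ac y" shows "ac (x + y)"
proof -
  obtain C D where C: "bessel (fam I S x) C" and D: "bessel (fam I S y) D" using assms
      by (auto simp: ac_def)
  have "L2_set (\<lambda>v. cmod (cinner h (fam I S (x + y) v))) F \<le> (C + D) * norm h" if F: "finite F"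
      for h F
  proof -
    have "L2_set (\<lambda>v. cmod (cinner h (fam I S (x + y) v))) F
      \<le> L2_set (\<lambda>v. cmod (cinner h (fam I S x v))) F + L2_set (\<lambda>v. cmod (cinner h (fam I S y v))) F"
      unfolding fam_add cinner_add_right by (rule L2_set_cmod_add)
    also have "\<dots> \<le> C * norm h + D * norm h"
      using C D F unfolding bessel_def by (intro add_mono) blast+
    finally show ?thesis by (simp add: distrib_right)
  qed
  then have "bessel (fam I S (x + y)) (C + D)" using C D by (simp add: bessel_def)
  then show ?thesis by (auto simp: ac_def)
qed

lemma ac_scaleC:
  assumes "ac x" shows "ac (c *\<^sub>C x)"
proof -
  obtain C where C: "bessel (fam I S x) C" using assms by (auto simp: ac_def)
  have "L2_set (\<lambda>v. cmod (cinner h (fam I S (c *\<^sub>C x) v))) F \<le> (cmod c * C) * norm h"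
      if F: "finite F" for h F
  proof -
    have "L2_set (\<lambda>v. cmod (cinner h (fam I S (c *\<^sub>C x) v))) F
      = cmod c * L2_set (\<lambda>v. cmod (cinner h (fam I S x v))) F"
      unfolding fam_scaleC cinner_scaleC_right by (simp add: norm_mult L2_set_right_distrib)
    also have "\<dots> \<le> cmod c * (C * norm h)"
      using C F unfolding bessel_def by (intro mult_left_mono) auto
    finally show ?thesis by (simp add: mult_ac)
  qed
  then have "bessel (fam I S (c *\<^sub>C x)) (cmod c * C)" using C by (simp add: bessel_def)
  then show ?thesis by (auto simp: ac_def)
qed

text \<open>A nonempty word begins with some letter \<open>i\<close>, and \<open>S i\<close> maps
  the span of the ranges for length m into the one for length m + 1.\<close>

lemma total_ranges:
  assumes no: "\<And>x. x \<in> orb0 I S x"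
  shows "x \<in> csub hull {foldr S b h | b h. b \<in> {b \<in> lists I. length b = m}}"
proof (induction m arbitrary: x)
  case 0
  have "x \<in> {foldr S b h | b h. b \<in> {b \<in> lists I. length b = 0}}" by auto
  then show ?case by (rule hull_inc)
next
  case (Suc m)
  let ?G = "csub hull {foldr S b h | b h. b \<in> {b \<in> lists I. length b = Suc m}}"
  have step: "S i h \<in> ?G" if i: "i \<in> I" for i h
  proof (rule cbop_hull_minimal[OF S_cbop[OF i] csub_hull _ Suc[of h]])
    fix y assume "y \<in> {foldr S b h |b h. b \<in> {b \<in> lists I. length b = m}}"
    then obtain b k where "y = foldr S b k" "b \<in> lists I" "length b = m" by blast
    then have "S i y = foldr S (i # b) k" "i # b \<in> lists I" "length (i # b) = Suc m" using i by auto
    then show "S i y \<in> ?G" by (intro hull_inc) blast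
  qed
  have "orb0 I S x \<subseteq> ?G"
    unfolding orb0_def
  proof (intro hull_minimal csub_hull subsetI)
    fix y assume "y \<in> {foldr S v x |v. v \<in> lists I \<and> v \<noteq> []}"
    then obtain v where v: "y = foldr S v x" "v \<in> lists I" "v \<noteq> []" by blast
    then show "y \<in> ?G" using step by (cases v) auto
  qed
  then show ?case using no by blast
qed

lemma adj_wd_in_orb:
  assumes "\<And>x. x \<in> orb0 I S x" "b \<in> lists I" "y \<in> orb I S x" shows "adj (foldr S b) y \<in> orb I S x"
  using assms(2,3)
proof (induction b arbitrary: y)
  case Nil
  have "adj id y = y" by (rule adj_unique) simp_all
  then show ?case using Nil by (simp add: id_def)
next
  case (Cons i b)
  have "adj (foldr S (i # b)) y = adj (foldr S b) (adj (S i) y)"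
    using Cons.hyps adj_compose[OF S_cbop wd_cbop, of i b y] by (simp add: comp_def)
  moreover have "adj (S i) y \<in> orb I S x"
    using reducing_orb[OF assms(1)] Cons.hyps(1) Cons.prems by (auto simp: reducing_def)
  ultimately show ?case using Cons.IH by metis
qed

text \<open>Otherwise the analysis operator of \<open>y\<close> would be bounded below on the reducing subspace
    generated by \<open>x\<close>.
  It intertwines \<open>S\<^sub>b\<^sup>*\<close> with the backward shifts, so the total mass \<open>\<Sum> \<parallel>S\<^sub>b\<^sup>* x\<parallel>\<^sup>2 = \<parallel>x\<parallel>\<^sup>2\<close> over
      all words
  \<open>b\<close> of length \<open>m\<close> would be controlled by the tail of a convergent series.\<close>

lemma exists_almost_annihilated:
  assumes no: "\<And>x. x \<in> orb0 I S x" and x: "ac x" "x \<noteq> 0" and y: "ac y" and e: "0 < e"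
  shows "\<exists>x'. ac x' \<and> norm x' = 1 \<and> norm (analysis (fam I S y) x') \<le> e"
proof (rule ccontr)
  assume contra: "\<not> ?thesis"
  let ?A = "analysis (fam I S y)"
  obtain C where C: "bessel (fam I S y) C" using y by (auto simp: ac_def)
  note A = cbop_analysis[OF C]
  have lower: "e * norm u \<le> norm (?A u)" if u: "ac u" for u
  proof (cases "u = 0")
    case False
    let ?c = "complex_of_real (inverse (norm u))"
    have "ac (?c *\<^sub>C u)" "norm (?c *\<^sub>C u) = 1" using u False by (simp_all add: ac_scaleC
        norm_scaleC norm_inverse)
    then have "e < norm (?A (?c *\<^sub>C u))" using contra by (meson not_less)
    then have "e < inverse (norm u) * norm (?A u)" by (simp add: cbop_scale[OF A] norm_scaleC
        norm_inverse)
    then show ?thesis using False by (simp add: field_simps)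
  qed simp
  \<comment> \<open>The lower bound extends by continuity to the whole cyclic subspace of
    \<open>x\<close>, because absolutely continuous vectors are dense there. It is needed at the
    vectors \<open>adj (foldr S b) x\<close>, which may fail to be absolutely continuous
    themselves.\<close>
  have "csub (closure {u. ac u})" by (rule csub_closure) (auto simp: ac_0 ac_add ac_scaleC)
  moreover have "foldr S v x \<in> closure {u. ac u}" if "v \<in> lists I" for v
    using ac_wd[OF x(1) that] closure_subset by blast
  ultimately have "orb I S x \<subseteq> closure {u. ac u}" unfolding orb_def by (intro hull_minimal) auto
  also have "\<dots> \<subseteq> {u. e * norm u \<le> norm (?A u)}"
    using lower by (intro closure_minimal closed_Collect_le continuous_intros cbop_cont[OF A]) auto
  finally have lower': "e * norm u \<le> norm (?A u)" if "u \<in> orb I S x" for u using that by blast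
  define f where "f = (\<lambda>v. cmod (cinner x (fam I S y v)))"
  have "L2_set f F \<le> C * norm x" if "finite F" for F
    using C that by (simp add: bessel_def f_def)
  \<comment> \<open>Passing to finite sections below costs half of \<open>e\<close>; with a quarter
    here the comparison ends in \<open>norm x \<le> norm x / 2\<close>.\<close>
  then obtain V where V: "finite V" "\<And>F. finite F \<Longrightarrow> F \<inter> V = {} \<Longrightarrow> L2_set f F \<le> e * norm x / 4"
    using L2_set_tail[of UNIV f "C * norm x" "e * norm x / 4"] e x(2) by auto
  define m where "m = Suc (Max (insert 0 (length ` V)))"
  have m: "length v < m" if "v \<in> V" for v
    using that V(1) by (simp add: m_def less_Suc_eq_le)
  have "norm x \<le> norm x / 2"
  proof (rule norm_le_of_total_ranges[of "{b \<in> lists I. length b = m}" "foldr S"])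
    show "x \<in> csub hull {foldr S b h |b h. b \<in> {b \<in> lists I. length b = m}}"
      by (rule total_ranges[OF no])
    show "cbop (foldr S b)" if "b \<in> {b \<in> lists I. length b = m}" for b using that
        by (simp add: wd_cbop del: in_lists_conv_set)
    show "norm (foldr S b h) = norm h" if "b \<in> {b \<in> lists I. length b = m}" for b h
      using that by (simp add: norm_wd del: in_lists_conv_set)
    show "cinner (foldr S b h) (foldr S b' k) = 0"
      if "b \<in> {b \<in> lists I. length b = m}" "b' \<in> {b \<in> lists I. length b = m}" "b \<noteq> b'" for b b' h k
    proof -
      have "length b = length b'" using that(1,2) by simp
      then have "b \<parallel> b'" using not_equal_is_parallel[OF that(3)] by blast
      then show ?thesis using that(1,2) by (intro cinner_wd_parallel) auto
    qed
    show "L2_set (\<lambda>b. norm (adj (foldr S b) x)) F \<le> norm x / 2"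
      if F: "finite F" "F \<subseteq> {b \<in> lists I. length b = m}" for F
    proof -
      define u where "u b = adj (foldr S b) x" for b
      have u: "u b \<in> orb I S x" if "b \<in> F" for b
        unfolding u_def using that F by (intro adj_wd_in_orb no orb_self) auto
      have "\<exists>G. finite G \<and> e / 2 * norm (u b) \<le> L2_set (\<lambda>v. cmod (cinner (u b) (fam I S y v))) G"
          if "b \<in> F" for b
      proof (rule ccontr)
        assume *: "\<not> ?thesis"
        have "norm (?A (u b)) \<le> e / 2 * norm (u b)"
        proof (rule norm_l2_le)
          fix G :: "nat list set" assume "finite G"
          then have "L2_set (\<lambda>v. cmod (cinner (u b) (fam I S y v))) G < e / 2 * norm (u b)"
              using * by (meson not_less)
          then show "L2_set (\<lambda>v. norm (l2_nth (?A (u b)) v)) G \<le> e / 2 * norm (u b)"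
            by (simp add: l2_nth_analysis[OF C])
        qed
        then have "norm (u b) = 0" using lower'[OF u[OF that]] e
          by (smt (verit, best) divide_pos_pos field_sum_of_halves mult_pos_pos norm_ge_zero
              distrib_right)
        then show False using * by (metis L2_set_nonneg finite.emptyI mult_zero_right)
      qed
      then obtain G where G: "\<And>b. b \<in> F \<Longrightarrow> finite (G b)"
        "\<And>b. b \<in> F \<Longrightarrow> e / 2 * norm (u b) \<le> L2_set (\<lambda>v. cmod (cinner (u b) (fam I S y v))) (G b)"
            by metis
      \<comment> \<open>The coefficient of \<open>u b\<close> at \<open>v\<close> is the coefficient
        of \<open>x\<close> at \<open>b @ v\<close>, which belongs to the tail because
        \<open>b\<close> has length \<open>m\<close>.\<close>
      have sq: "(e / 2 * norm (u b))\<^sup>2 \<le> (\<Sum>v\<in>G b \<inter> lists I. (f (b @ v))\<^sup>2)" if b: "b \<in> F" for b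
      proof -
        have bI: "b \<in> lists I" using b F by auto
        have "(e / 2 * norm (u b))\<^sup>2 \<le> (L2_set (\<lambda>v. cmod (cinner (u b) (fam I S y v))) (G b))\<^sup>2"
          using e by (intro power_mono G b) simp
        also have "\<dots> = (\<Sum>v\<in>G b. (cmod (cinner (u b) (fam I S y v)))\<^sup>2)"
          by (simp add: L2_set_def sum_nonneg)
        also have "\<dots> = (\<Sum>v\<in>G b \<inter> lists I. (f (b @ v))\<^sup>2)"
        proof (rule sum.mono_neutral_cong_right)
          show "finite (G b)" by (rule G(1)[OF b])
          show "(cmod (cinner (u b) (fam I S y v)))\<^sup>2 = (f (b @ v))\<^sup>2" if v: "v \<in> G b \<inter> lists I"
              for v
            using v bI by (simp add: u_def f_def fam_def cinner_adj'[OF wd_cbop[OF bI]] del: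
                in_lists_conv_set)
        qed (auto simp: fam_def simp del: in_lists_conv_set)
        finally show ?thesis .
      qed
      let ?P = "SIGMA b:F. G b \<inter> lists I"
      \<comment> \<open>All \<open>b\<close> have the same length, so \<open>b @ v\<close>
        determines both parts and no coefficient of \<open>x\<close> is counted twice.\<close>
      have inj: "inj_on (\<lambda>(b, v). b @ v) ?P"
      proof (rule inj_onI, clarify)
        fix b v b' v' assume *: "b \<in> F" "b' \<in> F" "b @ v = b' @ v'"
        then have "length b = length b'" using F(2) by blast
        then show "b = b' \<and> v = v'" using *(3) by simp
      qed
      have "(\<Sum>b\<in>F. (e / 2 * norm (u b))\<^sup>2) \<le> (\<Sum>b\<in>F. \<Sum>v\<in>G b \<inter> lists I. (f (b @ v))\<^sup>2)"
        by (rule sum_mono[OF sq])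
      also have "\<dots> = (\<Sum>(b, v)\<in>?P. (f (b @ v))\<^sup>2)"
        using F G by (intro sum.Sigma) auto
      also have "\<dots> = (\<Sum>t\<in>(\<lambda>(b, v). b @ v) ` ?P. (f t)\<^sup>2)"
        by (subst sum.reindex[OF inj]) (simp add: case_prod_unfold)
      also have "\<dots> = (L2_set f ((\<lambda>(b, v). b @ v) ` ?P))\<^sup>2"
        by (simp add: L2_set_def sum_nonneg)
      also have "\<dots> \<le> (e * norm x / 4)\<^sup>2"
      proof (intro power_mono V(2) L2_set_nonneg)
        show "finite ((\<lambda>(b, v). b @ v) ` ?P)" using F G by (intro finite_imageI finite_SigmaI) auto
        have "m \<le> length t" if "t \<in> (\<lambda>(b, v). b @ v) ` ?P" for t using that F(2) by auto
        then show "(\<lambda>(b, v). b @ v) ` ?P \<inter> V = {}" using m by (meson disjoint_iff not_less)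
      qed
      finally have "(e / 2)\<^sup>2 * (\<Sum>b\<in>F. (norm (u b))\<^sup>2) \<le> (e / 2)\<^sup>2 * (norm x / 2)\<^sup>2"
        by (simp add: power_mult_distrib power_divide sum_distrib_left)
      then have "(\<Sum>b\<in>F. (norm (u b))\<^sup>2) \<le> (norm x / 2)\<^sup>2"
        using e by (subst (asm) mult_le_cancel_left_pos) auto
      then show ?thesis unfolding L2_set_def u_def by (intro real_le_lsqrt sum_nonneg) auto
    qed
  qed
  then show False using x(2) by simp
qed

end

lemma cmod_cinner_commute: "cmod (cinner x y) = cmod (cinner y x)"
  using cinner_commute[of x y] by simp

context iso_tuple begin

lemma cinner_wd_nonzero_cases:
  assumes "u \<in> lists I" "v \<in> lists I" "cinner (foldr S u x) (foldr S v y) \<noteq> 0"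
  obtains s where "s \<in> lists I" "u = v @ s" "cinner (foldr S u x) (foldr S v y)
      = cinner (foldr S s x) y"
    | s where "s \<in> lists I" "v = u @ s" "cinner (foldr S u x) (foldr S v y)
        = cinner x (foldr S s y)"
proof -
  have "prefix u v \<or> prefix v u" using cinner_wd_parallel assms by blast
  then consider s where "u = v @ s" | s where "v = u @ s" by (auto simp: prefix_def)
  then show thesis
  proof cases
    case (1 s)
    then show thesis using that(1)[of s] assms(1,2) by (simp add: wd_iso)
  next
    case (2 s)
    then show thesis using that(2)[of s] assms(1,2) by (simp add: wd_iso)
  qed
qed

definition small_tail :: "'a \<Rightarrow> 'a \<Rightarrow> nat \<Rightarrow> real \<Rightarrow> bool" where
  "small_tail h x m d \<longleftrightarrow> (\<forall>G. finite G \<longrightarrow> (\<forall>u\<in>G. u \<in> lists I \<and> m \<le> length u) \<longrightarrow>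
     L2_set (\<lambda>u. cmod (cinner h (foldr S u x))) G \<le> d)"

lemma small_tailD:
  "small_tail h x m d \<Longrightarrow> finite G \<Longrightarrow> (\<And>u. u \<in> G \<Longrightarrow> u \<in> lists I \<and> m \<le> length u) \<Longrightarrow>
    L2_set (\<lambda>u. cmod (cinner h (foldr S u x))) G \<le> d"
  unfolding small_tail_def by blast

lemma small_tail_mono: "small_tail h x m d \<Longrightarrow> m \<le> k \<Longrightarrow> small_tail h x k d"
  unfolding small_tail_def by (meson order_trans)

lemma ac_tail:
  assumes "ac x" "0 < d" shows "\<exists>m. small_tail h x m d"
proof -
  obtain C where C: "bessel (fam I S x) C" using assms by (auto simp: ac_def)
  let ?f = "\<lambda>u. cmod (cinner h (foldr S u x))"
  have "L2_set ?f F \<le> C * norm h" if F: "finite F" "F \<subseteq> lists I" for F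
  proof -
    have "L2_set ?f F = L2_set (\<lambda>u. cmod (cinner h (fam I S x u))) F"
      using F(2) by (intro L2_set_cong refl) (auto simp: fam_def)
    then show ?thesis using C F(1) by (simp add: bessel_def)
  qed
  then obtain V where V: "finite V" "V \<subseteq> lists I"
    "\<And>F. finite F \<Longrightarrow> F \<subseteq> lists I \<Longrightarrow> F \<inter> V = {} \<Longrightarrow> L2_set ?f F \<le> d"
    using L2_set_tail[of "lists I" ?f _ d] assms(2) by metis
  define m where "m = Suc (Max (insert 0 (length ` V)))"
  have m: "length v < m" if "v \<in> V" for v
    using that V(1) by (simp add: m_def less_Suc_eq_le)
  have "L2_set ?f G \<le> d" if G: "finite G" "\<forall>u\<in>G. u \<in> lists I \<and> m \<le> length u" for G
  proof (rule V(3)[OF G(1)])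
    show "G \<subseteq> lists I" using G(2) by blast
    show "G \<inter> V = {}" using G(2) m by (meson disjoint_iff not_less)
  qed
  then have "small_tail h x m d" unfolding small_tail_def by blast
  then show ?thesis ..
qed

text \<open>It vanishes on all words exactly if \<open>y'\<close> pairs to 1 with \<open>y\<close>
  and is orthogonal to \<open>orb0 I S y\<close>.\<close>

definition err :: "'a \<Rightarrow> 'a \<Rightarrow> nat list \<Rightarrow> complex" where
  "err y y' v = cinner (foldr S v y) y' - (if v = [] then 1 else 0)"

section \<open>Probe words without self-overlap\<close>

context
  fixes p q :: nat
  assumes p: "p \<in> I" and q: "q \<in> I" and pq: "p \<noteq> q"
begin

abbreviation "probe k \<equiv> p # replicate k q"

lemma probe_in: "probe k \<in> lists I"
  using p q by (induction k) auto

text \<open>The letter \<open>p\<close> occurs in \<open>probe k\<close> only at the front, yet the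
  left side has \<open>p\<close> at position \<open>length s\<close>.\<close>

lemma probe_overlap:
  assumes "s @ probe k = probe k @ s'" "s \<noteq> []" shows "k < length s"
proof (rule ccontr)
  assume "\<not> k < length s"
  then have "(probe k @ s') ! length s = probe k ! length s"
    by (simp only: nth_append) simp
  moreover have "(s @ probe k) ! length s = p" by simp
  ultimately have "p = probe k ! length s" unfolding assms(1) by metis
  then show False using assms(2) pq \<open>\<not> k < length s\<close> by (cases s) auto
qed

text \<open>A nonzero inner product needs one word to be a prefix of the other, and by
  \<open>probe_overlap\<close> the two occurrences of the probe are then shifted by more than
  \<open>k\<close>. As \<open>length a \<le> k\<close>, the longer word can only be the one with
  \<open>v\<close>, and it contains both probes disjointly.\<close>

lemma probe_inner:
  assumes a: "a \<in> lists I" "length a \<le> k" and v: "v \<in> lists I" and x: "norm x = 1"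
    and nz: "cinner (foldr S (v @ probe k) x) (foldr S (a @ probe k) x) \<noteq> (if v = a then 1 else 0)"
  obtains s where "s \<in> lists I" "v = a @ probe k @ s"
    "cinner (foldr S (v @ probe k) x) (foldr S (a @ probe k) x) = cinner (foldr S (s @ probe k) x)
        x" "v \<noteq> a"
proof -
  let ?w = "probe k"
  have vw: "v @ ?w \<in> lists I" and aw: "a @ ?w \<in> lists I" using a v probe_in by auto
  have ne: "v \<noteq> a"
  proof
    assume "v = a"
    then have "cinner (foldr S (v @ ?w) x) (foldr S (a @ ?w) x) = 1"
      using wd_iso[OF aw, of x x] x by (simp only: cinner_self) simp
    then show False using nz \<open>v = a\<close> by simp
  qed
  then have "cinner (foldr S (v @ ?w) x) (foldr S (a @ ?w) x) \<noteq> 0" using nz by simp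
  note cases = cinner_wd_nonzero_cases[OF vw aw this]
  show thesis
  proof (cases rule: cases)
    case (1 s')
    from 1(2) have "v @ ?w = a @ (?w @ s')" by simp
    then obtain us where us: "v = a @ us \<and> us @ ?w = ?w @ s' \<or> v @ us = a \<and> ?w = us @ ?w @ s'"
      unfolding append_eq_append_conv2 by blast
    have "us \<noteq> []" using us ne by auto
    moreover have "\<not> (v @ us = a \<and> ?w = us @ ?w @ s')"
    proof
      assume "v @ us = a \<and> ?w = us @ ?w @ s'"
      then have "length ?w = length us + length ?w + length s'"
          by (metis append_assoc length_append)
      then show False using \<open>us \<noteq> []\<close> by simp
    qed
    ultimately have us: "v = a @ us" "us @ ?w = ?w @ s'" "us \<noteq> []" using us by auto
    have "length ?w \<le> length us" using probe_overlap[OF us(2,3)] by simp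
    then obtain s where s: "us = ?w @ s" using us(2) by (metis append_eq_append_conv_if
        append_take_drop_id)
    then have sI: "s \<in> lists I" using us(1) v by auto
    have "cinner (foldr S ((a @ ?w) @ (s @ ?w)) x) (foldr S (a @ ?w) x) = cinner (foldr S (s @ ?w)
        x) x"
      by (rule cinner_wd_longer[OF aw])
    then show thesis using that[of s] sI s us(1) ne by simp
  next
    case (2 s')
    from 2(2) have "a @ ?w = v @ (?w @ s')" by simp
    then obtain us where us: "a = v @ us \<and> us @ ?w = ?w @ s' \<or> a @ us = v \<and> ?w = us @ ?w @ s'"
      unfolding append_eq_append_conv2 by blast
    have "us \<noteq> []" using us ne by auto
    moreover have "\<not> (a @ us = v \<and> ?w = us @ ?w @ s')"
    proof
      assume "a @ us = v \<and> ?w = us @ ?w @ s'"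
      then have "length ?w = length us + length ?w + length s'"
          by (metis append_assoc length_append)
      then show False using \<open>us \<noteq> []\<close> by simp
    qed
    ultimately have "a = v @ us" "k < length us" using us probe_overlap by auto
    then show thesis using a(2) by simp
  qed
qed

text \<open>A column of the Gram matrix of the vectors \<open>foldr S (v @ probe k) x\<close>
  differs from that of the identity only by coefficients of \<open>x\<close> at words longer than
  \<open>k\<close>, that is, by part of a tail.\<close>

lemma probe_inner_L2:
  assumes a: "a \<in> lists I" "length a \<le> k" and x: "norm x = 1" and F: "finite F" "F \<subseteq> lists I"
    and tail: "small_tail x x k d"
  shows "L2_set (\<lambda>v. cmod (cinner (foldr S (v @ probe k) x) (foldr S (a @ probe k) x) - (if v
      = a then 1 else 0))) F \<le> d"
proof (rule L2_set_reindex_le[where \<psi> = "\<lambda>v. drop (length (a @ probe k)) v @ probe k"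
      and g = "\<lambda>u. cmod (cinner x (foldr S u x))", OF F(1)])
  let ?f = "\<lambda>v. cmod (cinner (foldr S (v @ probe k) x) (foldr S (a @ probe k) x) - (if v
      = a then 1 else 0))"
  let ?\<psi> = "\<lambda>v. drop (length (a @ probe k)) v @ probe k"
  have key: "\<exists>s\<in>lists I. v = (a @ probe k) @ s \<and> ?f v = cmod (cinner x (foldr S (s @ probe k) x))"
    if v: "v \<in> F" "?f v \<noteq> 0" for v
  proof -
    have vI: "v \<in> lists I" using v F by blast
    have "cinner (foldr S (v @ probe k) x) (foldr S (a @ probe k) x) \<noteq> (if v = a then 1 else 0)"
      using v(2) by auto
    then obtain s where "s \<in> lists I" "v = a @ probe k @ s" "v \<noteq> a"
      "cinner (foldr S (v @ probe k) x) (foldr S (a @ probe k) x) = cinner (foldr S (s @ probe k)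
          x) x"
      by (rule probe_inner[OF a vI x])
    then show ?thesis using cmod_cinner_commute[of x] by (intro bexI[of _ s]) auto
  qed
  show "inj_on ?\<psi> {v \<in> F. ?f v \<noteq> 0}"
  proof (rule inj_onI)
    fix v v' assume vv: "v \<in> {v \<in> F. ?f v \<noteq> 0}" "v' \<in> {v \<in> F. ?f v \<noteq> 0}" and eq: "?\<psi> v = ?\<psi> v'"
    obtain s s' where "v = (a @ probe k) @ s" "v' = (a @ probe k) @ s'" using key vv by blast
    then show "v = v'" using eq by simp
  qed
  show "?f v = cmod (cinner x (foldr S (?\<psi> v) x))" if "v \<in> F" "?f v \<noteq> 0" for v
    using key[OF that] by auto
  show "L2_set (\<lambda>u. cmod (cinner x (foldr S u x))) G \<le> d"
    if G: "finite G" "G \<subseteq> ?\<psi> ` {v \<in> F. ?f v \<noteq> 0}" for G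
  proof (rule small_tailD[OF tail G(1)])
    fix u assume u: "u \<in> G"
    obtain v where v: "v \<in> F" "?f v \<noteq> 0" "u = ?\<psi> v" using u G(2) by blast
    obtain s where "s \<in> lists I" "v = (a @ probe k) @ s" using key[OF v(1,2)] by blast
    then show "u \<in> lists I \<and> k \<le> length u" using v(3) probe_in[of k] by auto
  qed
qed

text \<open>That the first vector lies in the range of \<open>S p\<close> excludes a remainder
  \<open>s\<close> inside the final block of letters \<open>q\<close>, since the ranges of
  \<open>S p\<close> and \<open>S q\<close> are orthogonal. The remainder is thus on the side of
  \<open>v\<close>, or longer than \<open>k\<close>.\<close>

lemma probe_cross:
  assumes a: "a \<in> lists I" and v: "v \<in> lists I"
    and nz: "cinner (foldr S v (S p y0)) (foldr S (a @ probe k) x) \<noteq> 0"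
  obtains s where "s \<in> lists I" "v = (a @ probe k) @ s"
      "cinner (foldr S v (S p y0)) (foldr S (a @ probe k) x) = cinner (foldr S s (S p y0)) x"
    | s where "s \<in> lists I" "a @ probe k = v @ s" "k < length s"
      "cinner (foldr S v (S p y0)) (foldr S (a @ probe k) x) = cinner (S p y0) (foldr S s x)"
proof -
  have aw: "a @ probe k \<in> lists I" using a probe_in by auto
  show thesis
  proof (cases rule: cinner_wd_nonzero_cases[OF v aw nz])
    case (1 s)
    then show thesis using that(1) by blast
  next
    case (2 s)
    show thesis
    proof (cases "k < length s")
      case True
      then show thesis using 2 that(2) by blast
    next
      case False
      show thesis
      proof (cases s)
        case Nil
        then show thesis using 2 that(1)[of "[]"] by simp
      next
        case (Cons c s')
        have "(a @ [p]) @ replicate k q = v @ s" using 2(2) by simp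
        then obtain us where "a @ [p] = v @ us \<and> us @ replicate k q = s \<or> (a @ [p]) @ us = v
            \<and> replicate k q = us @ s"
          unfolding append_eq_append_conv2 by blast
        then have "set s \<subseteq> {q}"
        proof
          assume *: "a @ [p] = v @ us \<and> us @ replicate k q = s"
          then have "us = []" using False by auto
          then show ?thesis using * by auto
        next
          assume "(a @ [p]) @ us = v \<and> replicate k q = us @ s"
          then have "set (us @ s) = set (replicate k q)" by simp
          then show ?thesis by (auto split: if_splits)
        qed
        then have "c = q" using Cons by simp
        then have "cinner (S p y0) (foldr S s x) = 0" using Cons p q pq by (simp add: S_orth)
        then show thesis using 2(3) nz by simp
      qed
    qed
  qed
qed

text \<open>If \<open>v\<close> extends \<open>a @ probe k\<close>, the terms are coefficients of
  \<open>x\<close> along the words of \<open>y\<close>, small by the choice of \<open>x\<close>.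
  Otherwise they are coefficients of \<open>y\<close> along long words of \<open>x\<close>, small by
  the tail bound. Each kind contributes \<open>d\<close>.\<close>

lemma probe_cross_L2:
  assumes a: "a \<in> lists I" and F: "finite F" "F \<subseteq> lists I" and y: "y = S p y0" and yac: "ac y"
    and small: "norm (analysis (fam I S y) x) \<le> d"
    and tail: "small_tail y x k d"
  shows "L2_set (\<lambda>v. cmod (cinner (foldr S v y) (foldr S (a @ probe k) x))) F \<le> 2 * d"
proof -
  let ?aw = "a @ probe k"
  let ?r = "\<lambda>v. cinner (foldr S v y) (foldr S ?aw x)"
  let ?r1 = "\<lambda>v. if prefix ?aw v then ?r v else 0"
  let ?r2 = "\<lambda>v. if prefix ?aw v then 0 else ?r v"
  have 1: "L2_set (\<lambda>v. cmod (?r1 v)) F \<le> d"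
  proof (rule L2_set_reindex_le[where \<psi> = "drop (length ?aw)" and g = "\<lambda>s. cmod (cinner x (foldr S
      s y))", OF F(1)])
    have key: "\<exists>s\<in>lists I. v = ?aw @ s \<and> cmod (?r1 v) = cmod (cinner x (foldr S s y))"
      if v: "v \<in> F" "cmod (?r1 v) \<noteq> 0" for v
    proof -
      have vI: "v \<in> lists I" using v F by blast
      obtain s where s: "v = ?aw @ s" using v(2) by (auto simp: prefix_def split: if_splits)
      have awI: "?aw \<in> lists I" using a probe_in by auto
      have "?r v = cinner (foldr S s y) x" unfolding s by (rule cinner_wd_longer[OF awI])
      then show ?thesis using s vI cmod_cinner_commute[of x] by (intro bexI[of _ s]) auto
    qed
    show "inj_on (drop (length ?aw)) {v \<in> F. cmod (?r1 v) \<noteq> 0}"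
    proof (rule inj_onI)
      fix v v' assume vv: "v \<in> {v \<in> F. cmod (?r1 v) \<noteq> 0}" "v' \<in> {v \<in> F. cmod (?r1 v) \<noteq> 0}"
        and eq: "drop (length ?aw) v = drop (length ?aw) v'"
      obtain s s' where "v = ?aw @ s" "v' = ?aw @ s'" using key vv by blast
      then show "v = v'" using eq by simp
    qed
    show "cmod (?r1 v) = cmod (cinner x (foldr S (drop (length ?aw) v) y))"
      if "v \<in> F" "cmod (?r1 v) \<noteq> 0" for v
      using key[OF that] by auto
    show "L2_set (\<lambda>s. cmod (cinner x (foldr S s y))) G \<le> d"
      if G: "finite G" "G \<subseteq> drop (length ?aw) ` {v \<in> F. cmod (?r1 v) \<noteq> 0}" for G
    proof -
      have GI: "G \<subseteq> lists I" using G(2) F(2) by (force dest: in_set_dropD)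
      obtain C where C: "bessel (fam I S y) C" using yac by (auto simp: ac_def)
      have "L2_set (\<lambda>s. cmod (cinner x (foldr S s y))) G = L2_set (\<lambda>s. cmod (l2_nth (analysis (fam
          I S y) x) s)) G"
        using GI by (intro L2_set_cong refl) (auto simp: l2_nth_analysis[OF C] fam_def)
      also have "\<dots> \<le> norm (analysis (fam I S y) x)" by (rule L2_set_le_norm_l2[OF G(1)])
      finally show ?thesis using small by simp
    qed
  qed
  have 2: "L2_set (\<lambda>v. cmod (?r2 v)) F \<le> d"
  proof (rule L2_set_reindex_le[where \<psi> = "\<lambda>v. drop (length v) ?aw" and g = "\<lambda>s. cmod (cinner y
      (foldr S s x))", OF F(1)])
    have key: "\<exists>s\<in>lists I. ?aw = v @ s \<and> k < length s \<and> cmod (?r2 v) = cmod (cinner y (foldr S s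
        x))"
      if v: "v \<in> F" "cmod (?r2 v) \<noteq> 0" for v
    proof -
      have vI: "v \<in> lists I" using v F by blast
      have np: "\<not> prefix ?aw v" and nz: "?r v \<noteq> 0" using v(2) by (auto split: if_splits)
      show ?thesis
      proof (cases rule: probe_cross[OF a vI nz[unfolded y]])
        case (1 s) then show ?thesis using np by (auto simp: prefix_def)
      next
        case (2 s) then show ?thesis using np by (intro bexI[of _ s]) (auto simp: y)
      qed
    qed
    show "inj_on (\<lambda>v. drop (length v) ?aw) {v \<in> F. cmod (?r2 v) \<noteq> 0}"
    proof (rule inj_onI)
      fix v v' assume vv: "v \<in> {v \<in> F. cmod (?r2 v) \<noteq> 0}" "v' \<in> {v \<in> F. cmod (?r2 v) \<noteq> 0}"
        and eq: "drop (length v) ?aw = drop (length v') ?aw"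
      obtain s s' where s: "?aw = v @ s" "?aw = v' @ s'" using key vv by blast
      have "drop (length v) ?aw = s" "drop (length v') ?aw = s'" using s
          by (metis append_eq_conv_conj)+
      then have "v @ s = v' @ s" using eq s by metis
      then show "v = v'" by simp
    qed
    have drop: "drop (length v) ?aw = s" if "?aw = v @ s" for v s
      using that by (metis append_eq_conv_conj)
    show "cmod (?r2 v) = cmod (cinner y (foldr S (drop (length v) ?aw) x))"
      if "v \<in> F" "cmod (?r2 v) \<noteq> 0" for v
      using key[OF that] drop by metis
    show "L2_set (\<lambda>s. cmod (cinner y (foldr S s x))) G \<le> d"
      if G: "finite G" "G \<subseteq> (\<lambda>v. drop (length v) ?aw) ` {v \<in> F. cmod (?r2 v) \<noteq> 0}" for G
    proof (rule small_tailD[OF tail G(1)])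
      fix u assume u: "u \<in> G"
      obtain v where v: "v \<in> F" "cmod (?r2 v) \<noteq> 0" "u = drop (length v) ?aw" using u G(2) by blast
      obtain s where "s \<in> lists I" "?aw = v @ s" "k < length s" using key[OF v(1,2)] by blast
      then show "u \<in> lists I \<and> k \<le> length u" using v(3) drop[of v s] by auto
    qed
  qed
  have "L2_set (\<lambda>v. cmod (?r v)) F = L2_set (\<lambda>v. cmod (?r1 v + ?r2 v)) F"
    by (intro L2_set_cong refl) simp
  also have "\<dots> \<le> L2_set (\<lambda>v. cmod (?r1 v)) F + L2_set (\<lambda>v. cmod (?r2 v)) F"
      by (rule L2_set_cmod_add)
  finally show ?thesis using 1 2 by simp
qed

end

end

section \<open>Successive approximation of a dual pair\<close>

context iso_tuple begin

context
  fixes p q :: nat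
  assumes p: "p \<in> I" and q: "q \<in> I" and pq: "p \<noteq> q"
begin

text \<open>The range condition is what \<open>probe_cross\<close> needs; it survives the
  corrections because the probe word begins with \<open>p\<close>.\<close>

definition approx_dual :: "'a \<Rightarrow> 'a \<Rightarrow> real \<Rightarrow> bool" where
  "approx_dual y y' e \<longleftrightarrow> ac y \<and> (\<exists>y0. y = S p y0) \<and>
     (\<forall>F. finite F \<longrightarrow> F \<subseteq> lists I \<longrightarrow> L2_set (\<lambda>v. cmod (err y y' v)) F \<le> e)"

text \<open>The corrections \<open>u\<close> and \<open>u'\<close> are a multiple of the probe
  vector and a combination of its shifts by words of the finite set \<open>V\<close>. Their pairing
  cancels the error on \<open>V\<close>. There remain the error outside \<open>V\<close> (at most
  e/16), the Gram deviation (e/32) and two cross terms (e/16 each), together below e/4.\<close>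

lemma approx_dual_step:
  assumes no: "\<And>x. x \<in> orb0 I S x" and x0: "ac x0" "x0 \<noteq> 0"
    and y: "approx_dual y y' e" and e: "0 < e"
  shows "\<exists>y1 y1'. approx_dual y1 y1' (e / 4) \<and> norm (y1 - y) \<le> sqrt e \<and> norm (y1' - y') \<le> sqrt e"
proof -
  obtain y0 where yac: "ac y" and y0: "y = S p y0"
    and yerr: "\<And>F. finite F \<Longrightarrow> F \<subseteq> lists I \<Longrightarrow> L2_set (\<lambda>v. cmod (err y y' v)) F \<le> e"
    using y by (auto simp: approx_dual_def)
  define se where "se = sqrt e"
  have se: "0 < se" "se * se = e" using e by (simp_all add: se_def)
  have e16: "0 < e / 16" using e by simp
  obtain V where V: "finite V" "V \<subseteq> lists I"
    and Vtail: "\<And>F. finite F \<Longrightarrow> F \<subseteq> lists I \<Longrightarrow> F \<inter> V = {} \<Longrightarrow> L2_set (\<lambda>v. cmod (err y y' v)) F \<le> e / 16"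
    using L2_set_tail[of "lists I" "\<lambda>v. cmod (err y y' v)" e "e / 16"] yerr e16 by metis
  define E where "E = (\<Sum>a\<in>V. cmod (err y y' a))"
  have E: "0 \<le> E" by (simp add: E_def sum_nonneg)
  \<comment> \<open>\<open>E\<close> is the l1 norm of the error on \<open>V\<close>, by which the
    tolerances get multiplied; \<open>1 +\<close> avoids a zero denominator. Tolerances with the
    factor \<open>se\<close> make up for the division by \<open>se\<close> in \<open>c\<close>, or
    are halves of a pairing in which \<open>u\<close> supplies the other \<open>se\<close>.\<close>
  define d where "d = e / (32 * (1 + E))"
  have d: "0 < d" "E * d \<le> e / 32" using e E by (auto simp: d_def field_simps)
  have sed: "0 < se * d" and se16: "0 < se / 16" using d se by simp_all
  obtain x where x: "ac x" "norm x = 1" and small: "norm (analysis (fam I S y) x) \<le> se * d"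
    using exists_almost_annihilated[OF no x0 yac sed] by blast
  obtain m1 where m1: "small_tail x x m1 d" using ac_tail[OF x(1) d(1)] ..
  obtain m2 where m2: "small_tail y' x m2 (se / 16)" using ac_tail[OF x(1) se16] ..
  obtain m3 where m3: "small_tail y x m3 (se * d)" using ac_tail[OF x(1) sed] ..
  define k where "k = m1 + m2 + m3 + Max (insert 0 (length ` V))"
  have k: "m1 \<le> k" "m2 \<le> k" "m3 \<le> k" by (simp_all add: k_def)
  have kV: "length a \<le> k" if "a \<in> V" for a
  proof -
    have "length a \<le> Max (insert 0 (length ` V))" using V that by (intro Max_ge) auto
    then show ?thesis by (simp add: k_def)
  qed
  define w where "w = p # replicate k q"
  have w: "w \<in> lists I" unfolding w_def by (rule probe_in[OF p q pq])
  define g where "g a = foldr S (a @ w) x" for a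
  have gI: "a @ w \<in> lists I" if "a \<in> V" for a using that V w by auto
  define c where "c a = - err y y' a / of_real se" for a
  define u where "u = complex_of_real se *\<^sub>C foldr S w x"
  \<comment> \<open>The coefficients are conjugated because \<open>cinner\<close> is antilinear in
    its second argument.\<close>
  define u' where "u' = (\<Sum>a\<in>V. cnj (c a) *\<^sub>C g a)"
  have cu': "cinner h u' = (\<Sum>a\<in>V. c a * cinner h (g a))" for h
    by (simp add: u'_def cinner.sum_right cinner_scaleC_right)
  have wdu: "foldr S v u = complex_of_real se *\<^sub>C foldr S (v @ w) x" if "v \<in> lists I" for v
    by (simp add: u_def cbop_scale[OF wd_cbop[OF that]])
  define r where "r a v = cinner (foldr S (v @ w) x) (g a) - (if v = a then 1 else 0)" for a v
  have uu': "cinner (foldr S v u) u' = - (\<Sum>a\<in>V. err y y' a * r a v) - (if v \<in> V then err y y' v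
      else 0)"
    if v: "v \<in> lists I" for v
  proof -
    have "cinner (foldr S v u) u' = (\<Sum>a\<in>V. - err y y' a * cinner (foldr S (v @ w) x) (g a))"
      unfolding cu' wdu[OF v] cinner_scaleC_left using se by (simp add: c_def)
    also have "\<dots> = (\<Sum>a\<in>V. - (err y y' a * r a v) - (if v = a then err y y' a else 0))"
      by (intro sum.cong refl) (simp add: r_def algebra_simps)
    also have "\<dots> = - (\<Sum>a\<in>V. err y y' a * r a v) - (\<Sum>a\<in>V. if v = a then err y y' a else 0)"
      by (simp add: sum_subtractf sum_negf)
    finally show ?thesis using V(1) by simp
  qed
  have err1: "err (y + u) (y' + u') v = (if v \<in> V then 0 else err y y' v) + (- (\<Sum>a\<in>V. err y y' a *
      r a v)
      + (cinner (foldr S v u) y' + cinner (foldr S v y) u'))" if v: "v \<in> lists I" for v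
    using uu'[OF v] by (simp add: err_def cbop_add[OF wd_cbop[OF v]] cinner_add_left
        cinner_add_right)
  have L: "L2_set (\<lambda>v. cmod (err (y + u) (y' + u') v)) F \<le> e / 4" if F: "finite F" "F \<subseteq> lists I"
      for F
  proof -
    let ?t1 = "\<lambda>v. if v \<in> V then 0 else err y y' v" and ?t2 = "\<lambda>v. - (\<Sum>a\<in>V. err y y' a * r a v)"
    let ?t3 = "\<lambda>v. cinner (foldr S v u) y'" and ?t4 = "\<lambda>v. cinner (foldr S v y) u'"
    have "L2_set (\<lambda>v. cmod (?t1 v)) F = L2_set (\<lambda>v. cmod (err y y' v)) (F - V)"
      unfolding L2_set_def using F by (intro arg_cong[where f = sqrt] sum.mono_neutral_cong_right)
          auto
    also have "\<dots> \<le> e / 16" using F by (intro Vtail) auto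
    finally have t1: "L2_set (\<lambda>v. cmod (?t1 v)) F \<le> e / 16" .
    have "L2_set (\<lambda>v. cmod (r a v)) F \<le> d" if a: "a \<in> V" for a
      unfolding r_def g_def w_def
      using a V by (intro probe_inner_L2[OF p q pq _ kV[OF a] x(2) F small_tail_mono[OF m1 k(1)]])
          blast
    then have "L2_set (\<lambda>v. cmod (\<Sum>a\<in>V. err y y' a * r a v)) F \<le> E * d"
      unfolding E_def by (intro L2_set_cmod_sum V)
    then have t2: "L2_set (\<lambda>v. cmod (?t2 v)) F \<le> e / 32" using d(2) by simp
    have "L2_set (\<lambda>v. cmod (cinner (foldr S (v @ w) x) y')) F \<le> se / 16"
    proof (rule L2_set_reindex_le[where \<psi> = "\<lambda>v. v @ w" and g = "\<lambda>u. cmod (cinner y' (foldr S u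
        x))", OF F(1)])
      fix G assume G: "finite G" "G \<subseteq> (\<lambda>v. v @ w) ` {v \<in> F. cmod (cinner (foldr S (v @ w) x) y') \<noteq>
          0}"
      have *: "u \<in> lists I \<and> k \<le> length u" if "u \<in> G" for u
      proof -
        obtain v where "v \<in> F" "u = v @ w" using \<open>u \<in> G\<close> G(2) by blast
        then show ?thesis using F(2) w by (auto simp: w_def)
      qed
      then show "L2_set (\<lambda>u. cmod (cinner y' (foldr S u x))) G \<le> se / 16"
        using small_tailD[OF small_tail_mono[OF m2 k(2)] G(1)] by blast
    qed (use cmod_cinner_commute in \<open>auto simp: inj_on_def\<close>)
    moreover have "L2_set (\<lambda>v. cmod (?t3 v)) F = se * L2_set (\<lambda>v. cmod (cinner (foldr S (v @ w) x)
        y')) F"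
    proof -
      have "L2_set (\<lambda>v. cmod (?t3 v)) F = L2_set (\<lambda>v. se * cmod (cinner (foldr S (v @ w) x) y')) F"
        using F(2) se by (intro L2_set_cong refl) (auto simp only: wdu cinner_scaleC_left
            norm_mult norm_of_real subset_iff)
      then show ?thesis using se by (simp add: L2_set_right_distrib)
    qed
    ultimately have t3: "L2_set (\<lambda>v. cmod (?t3 v)) F \<le> e / 16"
      using mult_left_mono[of "L2_set (\<lambda>v. cmod (cinner (foldr S (v @ w) x) y')) F" "se / 16" se]
          se by simp
    have "L2_set (\<lambda>v. cmod (cinner (foldr S v y) (g a))) F \<le> 2 * (se * d)" if a: "a \<in> V" for a
      unfolding g_def w_def
      using a V by (intro probe_cross_L2[OF p q pq _ F y0 yac small small_tail_mono[OF m3 k(3)]])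
          blast
    then have "L2_set (\<lambda>v. cmod (?t4 v)) F \<le> (\<Sum>a\<in>V. cmod (c a)) * (2 * (se * d))"
      unfolding cu' by (intro L2_set_cmod_sum V)
    also have "(\<Sum>a\<in>V. cmod (c a)) = E / se"
      using se by (simp add: c_def E_def norm_divide sum_divide_distrib)
    also have "E / se * (2 * (se * d)) = 2 * (E * d)" using se by simp
    finally have t4: "L2_set (\<lambda>v. cmod (?t4 v)) F \<le> e / 16" using d(2) by simp
    have "L2_set (\<lambda>v. cmod (err (y + u) (y' + u') v)) F
      = L2_set (\<lambda>v. cmod (?t1 v + (?t2 v + (?t3 v + ?t4 v)))) F"
      using F(2) by (intro L2_set_cong refl arg_cong[where f = cmod] err1) blast
    also have "\<dots> \<le> L2_set (\<lambda>v. cmod (?t1 v)) F + (L2_set (\<lambda>v. cmod (?t2 v)) F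
        + (L2_set (\<lambda>v. cmod (?t3 v)) F + L2_set (\<lambda>v. cmod (?t4 v)) F))"
      by (intro order_trans[OF L2_set_cmod_add] add_left_mono) simp
    finally show ?thesis using t1 t2 t3 t4 e by linarith
  qed
  have "ac (y + u)" unfolding u_def by (intro ac_add yac ac_scaleC ac_wd x w)
  moreover have "y + u = S p (y0 + complex_of_real se *\<^sub>C foldr S (replicate k q) x)"
    by (simp add: y0 u_def w_def cbop_add[OF S_cbop[OF p]] cbop_scale[OF S_cbop[OF p]])
  ultimately have "approx_dual (y + u) (y' + u') (e / 4)"
    unfolding approx_dual_def using L by blast
  moreover have "norm u = se" using se by (simp add: u_def norm_scaleC norm_wd[OF w] x)
  moreover have "norm u' \<le> se"
  proof -
    \<comment> \<open>Orthogonality is exact here: words in \<open>V\<close> have length at most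
      \<open>k\<close>, too short for the only nonzero case of \<open>probe_inner\<close>. So the
      norm of \<open>u'\<close> is an L2 norm of the error divided by \<open>se\<close>, not an l1
      norm.\<close>
    have orth: "cinner (g a) (g b) = 0" if ab: "a \<in> V" "b \<in> V" "a \<noteq> b" for a b
    proof (rule ccontr)
      assume nz: "cinner (g a) (g b) \<noteq> 0"
      then have "cinner (foldr S (a @ w) x) (foldr S (b @ w) x) \<noteq> (if a = b then 1 else 0)"
        using ab(3) by (simp add: g_def)
      moreover have "a \<in> lists I" "b \<in> lists I" using ab V by auto
      ultimately obtain s where "a = b @ w @ s"
        using probe_inner[OF p q pq _ kV[OF ab(2)] _ x(2), of a] unfolding w_def by metis
      then have "k < length a" by (simp add: w_def)
      then show False using kV[OF ab(1)] by simp
    qed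
    have "norm u' = L2_set (\<lambda>a. norm (cnj (c a) *\<^sub>C g a)) V"
      unfolding u'_def
      by (rule norm_sum_orthogonal[OF V(1)]) (simp add: cinner_scaleC_left cinner_scaleC_right orth)
    also have "\<dots> = L2_set (\<lambda>a. (1 / se) * cmod (err y y' a)) V"
      using se x gI by (intro L2_set_cong refl) (simp add: norm_scaleC g_def c_def norm_divide
          norm_wd del: foldr_append)
    also have "\<dots> = (1 / se) * L2_set (\<lambda>a. cmod (err y y' a)) V"
      using se by (intro L2_set_right_distrib[symmetric]) simp
    also have "\<dots> \<le> (1 / se) * e" using se by (intro mult_left_mono yerr V) auto
    also have "\<dots> = se" using se(1) by (simp flip: se(2))
    finally show ?thesis .
  qed
  ultimately show ?thesis by (intro exI[of _ "y + u"] exI[of _ "y' + u'"]) (simp add: se_def)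
qed

lemma ac_imp_zero:
  assumes no: "\<And>x. x \<in> orb0 I S x" and x: "ac x" shows "x = 0"
proof (rule ccontr)
  assume x0: "x \<noteq> 0"
  define P where "P n z = approx_dual (fst z) (snd z) ((1/4) ^ n)" for n z
  define Q where "Q n z z' \<longleftrightarrow> norm (fst z' - fst z) \<le> (1/2) ^ n \<and> norm (snd z' - snd z) \<le> (1/2) ^ n"
    for n :: nat and z z' :: "'a \<times> 'a"
  have "\<exists>f. \<forall>n. P n (f n) \<and> Q n (f n) (f (Suc n))"
  proof (rule dependent_nat_choice)
    \<comment> \<open>The iteration starts at the zero pair, whose only defect is the missing 1 at
      the empty word. The given vector \<open>x\<close> enters through every correction
      step.\<close>
    have "L2_set (\<lambda>v. cmod (err 0 0 v)) F \<le> 1" if "finite F" "F \<subseteq> lists I" for F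
    proof -
      have "L2_set (\<lambda>v. cmod (err 0 0 v)) F = L2_set (\<lambda>v. if v = [] then 1 else 0) F"
        by (intro L2_set_cong refl) (simp add: err_def)
      also have "\<dots> \<le> 1"
        using that(1) by (simp add: L2_set_def if_distrib[of "\<lambda>x. x ^ 2"] cong: if_cong)
      finally show ?thesis .
    qed
    then have "approx_dual 0 0 1"
      unfolding approx_dual_def using ac_0 cbop_0[OF S_cbop[OF p]] by metis
    then show "\<exists>z. P 0 z" by (intro exI[of _ "(0, 0)"]) (simp add: P_def)
    show "\<exists>z'. P (Suc n) z' \<and> Q n z z'" if z: "P n z" for n z
    proof -
      have sq: "sqrt ((1/4) ^ n) = (1/2 :: real) ^ n"
        by (rule real_sqrt_unique) (simp_all add: power_mult_distrib flip: power_mult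
            power2_eq_square, simp add: power_mult mult.commute[of n] power2_eq_square)
      obtain y1 y1' where "approx_dual y1 y1' ((1/4) ^ n / 4)" "norm (y1 - fst z) \<le> (1/2) ^ n"
        "norm (y1' - snd z) \<le> (1/2) ^ n"
        using approx_dual_step[OF no x x0 z[unfolded P_def]] unfolding sq by auto
      then show ?thesis by (intro exI[of _ "(y1, y1')"]) (simp add: P_def Q_def)
    qed
  qed
  then obtain f where f: "\<And>n. P n (f n)" "\<And>n. Q n (f n) (f (Suc n))" by blast
  have conv: "convergent h" if h: "\<And>n. norm (h (Suc n) - h n) \<le> (1/2) ^ n" for h :: "nat \<Rightarrow> 'a"
  proof -
    have "summable (\<lambda>n. (1/2 :: real) ^ n)" by (rule summable_geometric) simp
    then have "summable (\<lambda>n. h (Suc n) - h n)"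
      by (rule summable_comparison_test'[of _ 0]) (rule h)
    then have "convergent (\<lambda>n. (\<Sum>i<n. h (Suc i) - h i) + h 0)"
      unfolding summable_iff_convergent by (intro convergent_add convergent_const)
    then show ?thesis by (simp add: sum_lessThan_telescope)
  qed
  obtain y where y: "(\<lambda>n. fst (f n)) \<longlonglongrightarrow> y"
    using conv[of "\<lambda>n. fst (f n)"] f(2) by (auto simp: Q_def convergent_def)
  obtain y' where y': "(\<lambda>n. snd (f n)) \<longlonglongrightarrow> y'"
    using conv[of "\<lambda>n. snd (f n)"] f(2) by (auto simp: Q_def convergent_def)
  have err0: "err y y' v = 0" if v: "v \<in> lists I" for v
  proof -
    have "(\<lambda>n. err (fst (f n)) (snd (f n)) v) \<longlonglongrightarrow> err y y' v"
      unfolding err_def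
      by (intro tendsto_diff tendsto_const cinner.tendsto y' bounded_linear.tendsto[OF cbop_bl[OF
          wd_cbop[OF v]]] y)
    moreover have "(\<lambda>n. err (fst (f n)) (snd (f n)) v) \<longlonglongrightarrow> 0"
    proof (rule Lim_null_comparison)
      have "cmod (err (fst (f n)) (snd (f n)) v) \<le> (1/4) ^ n" for n
      proof -
        have "L2_set (\<lambda>v. cmod (err (fst (f n)) (snd (f n)) v)) {v} \<le> (1/4) ^ n"
          using f(1)[of n] v unfolding P_def approx_dual_def by blast
        then show ?thesis by simp
      qed
      then show "\<forall>\<^sub>F n in sequentially. norm (err (fst (f n)) (snd (f n)) v) \<le> (1/4) ^ n" by simp
      show "(\<lambda>n. (1/4 :: real) ^ n) \<longlonglongrightarrow> 0" by (intro LIMSEQ_power_zero) simp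
    qed
    ultimately show ?thesis by (rule LIMSEQ_unique)
  qed
  have "orb0 I S y \<subseteq> {h. \<forall>k\<in>{y'}. cinner h k = 0}"
    unfolding orb0_def
  proof (intro hull_minimal csub_orth subsetI)
    fix h assume "h \<in> {foldr S v y |v. v \<in> lists I \<and> v \<noteq> []}"
    then obtain v where "v \<in> lists I" "v \<noteq> []" "h = foldr S v y" by blast
    then show "h \<in> {h. \<forall>k\<in>{y'}. cinner h k = 0}" using err0[of v] by (simp add: err_def)
  qed
  then have "cinner y y' = 0" using no[of y] by blast
  moreover have "cinner y y' = 1" using err0[of "[]"] by (simp add: err_def)
  ultimately show False by simp
qed

end

lemma exists_wandering_if_two_letters:
  fixes z :: "('i, 'a) l2"
  assumes pq: "p \<in> I" "q \<in> I" "p \<noteq> q" and z: "wandering I (\<lambda>i. l2_map (S i)) z" "z \<noteq> 0"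
  shows "\<exists>w. wandering I S w \<and> w \<noteq> 0"
proof (rule ccontr)
  assume none: "\<not> ?thesis"
  note no = no_wandering[OF none]
  obtain z' :: "('i, 'a) l2" where z': "wandering I (\<lambda>i. l2_map (S i)) z'" "norm z' = 1"
    using wandering_normalize[OF iso_tuple_l2 z] by metis
  have "ac (l2_nth z' j)" for j
    unfolding ac_def
    using bessel_l2_nth(1)[OF iso_tuple_axioms iso_tuple.bessel_wandering[OF iso_tuple_l2 z']]
        by blast
  then have "l2_nth z' j = 0" for j by (rule ac_imp_zero[OF pq no])
  then have "z' = 0" by (intro l2_eqI) simp
  then show False using z'(2) by simp
qed

end

subsection \<open>Operators commuting with the bilateral shift\<close>

lemma l2_basis_agree:
  fixes A B :: "('i, complex) l2 \<Rightarrow> 'b::complex_hilbert_space"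
  assumes A: "cbop A" and B: "cbop B" and eq: "\<And>i. A (l2_single i 1) = B (l2_single i 1)"
  shows "A f = B f"
proof -
  have "csub {f. A f - B f \<in> {0}}"
    by (rule cbop_preimage_csub[OF cbop_minus[OF A B]]) (simp add: csub_def)
  then have "f \<in> {f. A f - B f \<in> {0}}"
  proof (rule csub_bicomplement)
    fix h assume h: "\<And>z. z \<in> {f. A f - B f \<in> {0}} \<Longrightarrow> cinner h z = 0"
    have "l2_nth h i = 0" for i
      using h[of "l2_single i 1"] eq[of i] by (simp add: cinner_l2_single_right cinner_complex_def)
    then have "h = 0" by (intro l2_eqI) simp
    then show "cinner f h = 0" by simp
  qed
  then show ?thesis by simp
qed

lemma bessel_single: "bessel (\<lambda>i. l2_single (\<sigma> i) (1::complex)) 1" if "inj \<sigma>"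
  by (rule bessel_orthonormal)
    (use that in \<open>auto simp: cinner_l2_single l2_nth_single norm_l2_single cinner_complex_def
        dest: injD\<close>)

definition bishift :: "(int, complex) l2 \<Rightarrow> (int, complex) l2" where
  "bishift = synth (\<lambda>j. l2_single (j + 1) 1)"

lemma bessel_bishift: "bessel (\<lambda>j::int. l2_single (j + 1) (1::complex)) 1"
  by (rule bessel_single) (simp add: inj_on_def)

lemma cbop_bishift: "cbop bishift"
  unfolding bishift_def by (rule cbop_synth[OF bessel_bishift])

lemma bishift_single: "bishift (l2_single j 1) = l2_single (j + 1) 1"
  unfolding bishift_def by (rule synth_single[OF bessel_bishift])

lemma adj_bishift_nth: "l2_nth (adj bishift f) j = l2_nth f (j + 1)"
proof -
  have "adj bishift = analysis (\<lambda>j. l2_single (j + 1) 1)"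
    unfolding bishift_def synth_def by (rule adj_adj[OF cbop_analysis[OF bessel_bishift]])
  then show ?thesis
    by (simp add: l2_nth_analysis[OF bessel_bishift] cinner_l2_single_right cinner_complex_def)
qed

lemma adj_bishift_single: "adj bishift (l2_single j 1) = l2_single (j - 1) 1"
  by (rule l2_eqI) (auto simp: adj_bishift_nth l2_nth_single)

lemma bishift_adj: "bishift (adj bishift f) = f"
  by (rule l2_basis_agree[OF cbop_compose[OF cbop_bishift cbop_adj[OF cbop_bishift]] cbop_id(1)])
    (simp add: adj_bishift_single bishift_single)

lemma bishift_nth: "l2_nth (bishift f) j = l2_nth f (j - 1)"
  using adj_bishift_nth[of "bishift f" "j - 1"] adj_bishift_nth[of f "j - 1"]
proof -
  have "adj bishift (bishift f) = f"
    by (rule l2_basis_agree[OF cbop_compose[OF cbop_adj[OF cbop_bishift] cbop_bishift] cbop_id(1)])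
      (simp add: adj_bishift_single bishift_single)
  then show ?thesis using adj_bishift_nth[of "bishift f" "j - 1"] by simp
qed

text \<open>Commuting with the shift makes each column of the matrix a translate of the next, so the
  matrix is constant along diagonals and determined by the column at 0.\<close>

lemma laurent_nth:
  assumes "\<And>f. C (bishift f) = bishift (C f)"
  shows "l2_nth (C (l2_single j 1)) k = l2_nth (C (l2_single 0 1)) (k - j)"
proof (induction j arbitrary: k rule: int_induct[of _ 0])
  case (step1 i)
  have "C (l2_single (i + 1) 1) = bishift (C (l2_single i 1))"
    using assms[of "l2_single i 1"] by (simp add: bishift_single)
  then show ?case using step1 by (simp add: bishift_nth algebra_simps)
next
  case (step2 i)
  have "C (l2_single i 1) = bishift (C (l2_single (i - 1) 1))"
    using assms[of "l2_single (i - 1) 1"] by (simp add: bishift_single)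
  then have "l2_nth (C (l2_single (i - 1) 1)) k = l2_nth (C (l2_single i 1)) (k + 1)"
      by (simp add: bishift_nth)
  then show ?case using step2 by (simp add: algebra_simps)
qed simp

lemma laurent_convolution:
  assumes C: "cbop C" "\<And>f. C (bishift f) = bishift (C f)"
  shows "l2_nth (C f) k = (\<Sum>\<^sub>\<infinity>j. l2_nth f j * l2_nth (C (l2_single 0 1)) (k - j))"
proof -
  have "l2_nth (C f) k = cinner (C f) (l2_single k 1)"
    by (simp add: cinner_l2_single_right cinner_complex_def)
  also have "\<dots> = cinner f (adj C (l2_single k 1))" by (rule cinner_adj[OF C(1)])
  also have "\<dots> = (\<Sum>\<^sub>\<infinity>j. l2_nth f j * cnj (l2_nth (adj C (l2_single k 1)) j))"
    by (simp add: cinner_l2_def cinner_complex_def)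
  also have "\<dots> = (\<Sum>\<^sub>\<infinity>j. l2_nth f j * l2_nth (C (l2_single 0 1)) (k - j))"
  proof (rule infsum_cong)
    fix j
    have "l2_nth (adj C (l2_single k 1)) j = cinner (adj C (l2_single k 1)) (l2_single j 1)"
      by (simp add: cinner_l2_single_right cinner_complex_def)
    also have "\<dots> = cinner (l2_single k 1) (C (l2_single j 1))" by (rule cinner_adj'[OF C(1)])
    also have "\<dots> = cnj (l2_nth (C (l2_single 0 1)) (k - j))"
      by (simp add: cinner_l2_single cinner_complex_def laurent_nth[where C = C, OF C(2), of j k])
    finally show "l2_nth f j * cnj (l2_nth (adj C (l2_single k 1)) j)
        = l2_nth f j * l2_nth (C (l2_single 0 1)) (k - j)"
      by simp
  qed
  finally show ?thesis .
qed

text \<open>The image of the basis vector at 0 under either product is the convolution of the two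
  columns at 0, and convolution is commutative by the substitution of k - j for j.\<close>

lemma laurent_commute:
  assumes C: "cbop C" "\<And>f. C (bishift f) = bishift (C f)" and D: "cbop D" "\<And>f. D (bishift f)
      = bishift (D f)"
  shows "C (D f) = D (C f)"
proof (rule l2_basis_agree[OF cbop_compose[OF C(1) D(1)] cbop_compose[OF D(1) C(1)]])
  fix j :: int
  let ?e = "l2_single (0::int) (1::complex)"
  have 0: "l2_nth (C (D ?e)) k = l2_nth (D (C ?e)) k" for k
  proof -
    have "l2_nth (C (D ?e)) k = (\<Sum>\<^sub>\<infinity>j. l2_nth (D ?e) j * l2_nth (C ?e) (k - j))"
      by (rule laurent_convolution[OF C])
    also have "\<dots> = (\<Sum>\<^sub>\<infinity>j. l2_nth (D ?e) (k - j) * l2_nth (C ?e) (k - (k - j)))"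
    proof -
      have "bij_betw (\<lambda>j. k - j) UNIV UNIV" by (rule bij_betw_byWitness[of _ "\<lambda>j. k - j"]) auto
      from infsum_reindex_bij_betw[OF this, of "\<lambda>j. l2_nth (D ?e) j * l2_nth (C ?e) (k - j)"]
      show ?thesis by simp
    qed
    also have "\<dots> = (\<Sum>\<^sub>\<infinity>j. l2_nth (C ?e) j * l2_nth (D ?e) (k - j))" by (simp add: mult.commute)
    also have "\<dots> = l2_nth (D (C ?e)) k" by (rule laurent_convolution[OF D, symmetric])
    finally show ?thesis .
  qed
  have CD: "C (D (bishift f)) = bishift (C (D f))" and DC: "D (C (bishift f)) = bishift (D (C f))"
      for f
    using C D by simp_all
  show "C (D (l2_single j 1)) = D (C (l2_single j 1))"
  proof (rule l2_eqI)
    fix k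
    show "l2_nth (C (D (l2_single j 1))) k = l2_nth (D (C (l2_single j 1))) k"
      using laurent_nth[of "\<lambda>f. C (D f)", OF CD, of j k] laurent_nth[of "\<lambda>f. D (C f)", OF DC,
          of j k] 0 by simp
  qed
qed

subsection \<open>Intertwiners of the bilateral shift and a unitary\<close>

locale unitary =
  fixes U :: "'a::complex_hilbert_space \<Rightarrow> 'a"
  assumes U: "cbop U" and adj_U: "adj U (U x) = x" and U_adj: "U (adj U x) = x"
begin

definition intertwiner :: "((int, complex) l2 \<Rightarrow> 'a) \<Rightarrow> bool" where
  "intertwiner Y \<longleftrightarrow> cbop Y \<and> (\<forall>f. Y (bishift f) = U (Y f))"

lemma intertwiner_adj:
  assumes "intertwiner Y" shows "adj Y (U x) = bishift (adj Y x)"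
proof -
  have Y: "cbop Y" "\<And>f. Y (bishift f) = U (Y f)" using assms by (auto simp: intertwiner_def)
  have *: "adj U (Y f) = Y (adj bishift f)" for f
    using Y(2)[of "adj bishift f"] by (simp add: bishift_adj adj_U)
  have "cinner (adj Y (U x)) f = cinner (bishift (adj Y x)) f" for f
    by (simp add: cinner_adj'[OF Y(1)] cinner_adj[OF U] cinner_adj[OF cbop_bishift] *)
  then show ?thesis by (rule cinner_ext)
qed

lemma intertwiner_product:
  assumes "intertwiner Y" "intertwiner Z"
  shows "cbop (\<lambda>f. adj Y (Z f))" "adj Y (Z (bishift f)) = bishift (adj Y (Z f))"
  using assms intertwiner_adj[OF assms(1)] cbop_compose[OF cbop_adj]
  by (auto simp: intertwiner_def)

text \<open>On the spectral subspace where \<open>Y\<^sup>* Y \<ge> Z\<^sup>* Z\<close> use \<open>Y\<close>, on its complement use \<open>Z\<close>. The two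
    parts have
  orthogonal ranges since operators commuting with the bilateral shift commute with each other.\<close>

lemma intertwiner_merge:
  assumes Y: "intertwiner Y" and Z: "intertwiner Z"
  shows "\<exists>X. intertwiner X \<and> (\<forall>f. (norm (Y f))\<^sup>2 + (norm (Z f))\<^sup>2 \<le> 2 * (norm (X f))\<^sup>2)"
proof -
  have Yc: "cbop Y" and Zc: "cbop Z" using Y Z by (auto simp: intertwiner_def)
  \<comment> \<open>The sign of this operator decides where \<open>Y\<close> dominates
    \<open>Z\<close>; \<open>A\<close> is its multiple of norm at most 1, as
    \<open>spectral_splitting\<close> requires.\<close>
  define A0 where "A0 f = adj Y (Y f) - adj Z (Z f)" for f
  have A0c: "cbop A0" unfolding A0_def
    by (rule cbop_minus[OF intertwiner_product(1)[OF Y Y] intertwiner_product(1)[OF Z Z]])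
  obtain c where c: "c > 0" "\<And>f. norm (A0 f) \<le> c * norm f" using cbop_bound[OF A0c] by metis
  define A where "A f = complex_of_real (1 / c) *\<^sub>C A0 f" for f
  have Ac: "cbop A" unfolding A_def by (rule cbop_scaleC[OF A0c])
  have Ain: "cinner (A f) g = complex_of_real (1 / c) * (cinner (Y f) (Y g) - cinner (Z f) (Z g))"
      for f g
    by (simp add: A_def A0_def cinner_scaleC_left cinner.diff_left cinner_adj'[OF Yc]
        cinner_adj'[OF Zc])
  have "selfadj A"
    unfolding selfadj_def
  proof (intro conjI allI Ac)
    fix f g
    have "cinner f (A g) = cnj (cinner (A g) f)" by (rule cinner_commute)
    then show "cinner (A f) g = cinner f (A g)"
      using cinner_commute[of "Y f" "Y g"] cinner_commute[of "Z f" "Z g"] by (simp add: Ain)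
  qed
  moreover have "norm (A f) \<le> norm f" for f
    using c by (simp add: A_def norm_scaleC norm_divide divide_simps mult.commute)
  ultimately obtain E where E: "csub E"
    and Ecom: "\<forall>C. cbop C \<longrightarrow> (\<forall>x. C (A x) = A (C x)) \<longrightarrow> (\<forall>x. C (cproj E x) = cproj E (C x))"
    and pos: "\<And>x. x \<in> E \<Longrightarrow> (norm (A x))\<^sup>2 \<le> Re (cinner (A x) x)"
    and neg: "\<And>x. cproj E x = 0 \<Longrightarrow> (norm (A x))\<^sup>2 \<le> - Re (cinner (A x) x)"
    by (rule spectral_splitting) (rule that)
  let ?P = "cproj E"
  note Pc = cbop_cproj[OF E]
  have AB: "bishift (A f) = A (bishift f)" for f
    by (simp add: A_def A0_def cbop_scale[OF cbop_bishift] cbop_diff[OF cbop_bishift]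
        intertwiner_product(2)[OF Y Y] intertwiner_product(2)[OF Z Z])
  have PB: "?P (bishift f) = bishift (?P f)" for f using Ecom cbop_bishift AB by metis
  have orth: "cinner (Y1 (?P f)) (Y2 (f - ?P f)) = 0" if "intertwiner Y1" "intertwiner Y2"
      for Y1 Y2 f
  proof -
    have Y12: "cbop Y2" using that by (auto simp: intertwiner_def)
    have "adj Y2 (Y1 (?P f)) = ?P (adj Y2 (Y1 f))"
      by (rule laurent_commute[OF intertwiner_product[OF that(2,1)] Pc PB])
    moreover have "?P (f - ?P f) = 0"
      by (simp add: cbop_diff[OF Pc] cproj_id[OF E cproj_in[OF E]])
    ultimately show ?thesis
      using cinner_adj'[OF Y12, of "Y1 (?P f)" "f - ?P f"] cproj_selfadj[OF E, of "adj Y2 (Y1 f)"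
          "f - ?P f"] by simp
  qed
  define X where "X f = Y (?P f) + Z (f - ?P f)" for f
  have "cbop X" unfolding X_def
    by (rule cbop_plus[OF cbop_compose[OF Yc Pc] cbop_compose[OF Zc cbop_minus[OF cbop_id(1) Pc]]])
  moreover have "X (bishift f) = U (X f)" for f
  proof -
    have "bishift f - ?P (bishift f) = bishift (f - ?P f)" by (simp add: PB cbop_diff[OF
        cbop_bishift])
    then show ?thesis using Y Z by (simp add: X_def PB intertwiner_def cbop_add[OF U])
  qed
  ultimately have "intertwiner X" by (simp add: intertwiner_def)
  moreover have "(norm (Y f))\<^sup>2 + (norm (Z f))\<^sup>2 \<le> 2 * (norm (X f))\<^sup>2" for f
  proof -
    \<comment> \<open>\<open>Y\<close> dominates on \<open>g\<close> and \<open>Z\<close> on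
      \<open>h\<close>, so each of the two norms squared is at most that of \<open>X f\<close>; this
      is the factor 2.\<close>
    define g h where "g = ?P f" and "h = f - ?P f"
    have f: "f = g + h" by (simp add: g_def h_def)
    have Aff: "Re (cinner (A u) u) = ((norm (Y u))\<^sup>2 - (norm (Z u))\<^sup>2) / c" for u
      by (simp add: Ain cinner_self flip: of_real_power of_real_diff of_real_divide)
    have "0 \<le> Re (cinner (A g) g)" using pos[of g] cproj_in[OF E] order_trans[OF zero_le_power2]
        by (simp add: g_def)
    then have "(norm (Z g))\<^sup>2 \<le> (norm (Y g))\<^sup>2" using c(1) by (simp add: Aff zero_le_divide_iff)
    moreover have "?P h = 0" by (simp add: h_def cbop_diff[OF Pc] cproj_id[OF E cproj_in[OF E]])
    then have "Re (cinner (A h) h) \<le> 0" using neg[of h] zero_le_power2[of "norm (A h)"] by linarith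
    then have "(norm (Y h))\<^sup>2 \<le> (norm (Z h))\<^sup>2" using c(1) by (simp add: Aff divide_le_0_iff)
    moreover have "(norm (X f))\<^sup>2 = (norm (Y g))\<^sup>2 + (norm (Z h))\<^sup>2"
      unfolding X_def g_def h_def by (rule pythagoras[OF orth[OF Y Z]])
    moreover have "(norm (Y f))\<^sup>2 = (norm (Y g))\<^sup>2 + (norm (Y h))\<^sup>2"
      unfolding f cbop_add[OF Yc] unfolding g_def h_def by (rule pythagoras[OF orth[OF Y Y]])
    moreover have "(norm (Z f))\<^sup>2 = (norm (Z g))\<^sup>2 + (norm (Z h))\<^sup>2"
      unfolding f cbop_add[OF Zc] unfolding g_def h_def by (rule pythagoras[OF orth[OF Z Z]])
    ultimately show ?thesis by linarith
  qed
  ultimately show ?thesis by blast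
qed

lemma intertwiner_merge_finite:
  assumes "finite F" "\<And>i. i \<in> F \<Longrightarrow> intertwiner (X i)"
  shows "\<exists>Y c. intertwiner Y \<and> 0 < c \<and> (\<forall>f. (\<Sum>i\<in>F. (norm (X i f))\<^sup>2) \<le> c * (norm (Y f))\<^sup>2)"
  using assms
proof (induction F)
  case empty
  have "intertwiner (\<lambda>f. 0)" by (simp add: intertwiner_def cbop_0[OF U])
  then show ?case by (intro exI[of _ "\<lambda>f. 0"] exI[of _ 1]) simp
next
  case (insert i F)
  then obtain Y c where Y: "intertwiner Y" "0 < c" "\<And>f. (\<Sum>i\<in>F. (norm (X i f))\<^sup>2)
      \<le> c * (norm (Y f))\<^sup>2" by auto
  obtain Z where Z: "intertwiner Z" "\<And>f. (norm (X i f))\<^sup>2 + (norm (Y f))\<^sup>2 \<le> 2 * (norm (Z f))\<^sup>2"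
    using intertwiner_merge[of "X i" Y] insert.prems Y(1) by auto
  have "(\<Sum>j\<in>insert i F. (norm (X j f))\<^sup>2) \<le> (1 + c) * 2 * (norm (Z f))\<^sup>2" for f
  proof -
    have "(\<Sum>j\<in>insert i F. (norm (X j f))\<^sup>2) \<le> (norm (X i f))\<^sup>2 + c * (norm (Y f))\<^sup>2"
      using insert.hyps Y(3)[of f] by simp
    also have "\<dots> \<le> (1 + c) * ((norm (X i f))\<^sup>2 + (norm (Y f))\<^sup>2)"
      using Y(2) by (simp add: algebra_simps)
    also have "\<dots> \<le> (1 + c) * (2 * (norm (Z f))\<^sup>2)" using Y(2) Z(2)[of f] by (intro mult_left_mono)
        auto
    finally show ?thesis by (simp only: mult.assoc)
  qed
  then show ?case using Z(1) Y(2) by (intro exI[of _ Z] exI[of _ "(1 + c) * 2"]) auto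
qed

definition upow :: "int \<Rightarrow> 'a \<Rightarrow> 'a" where
  "upow j x = (if 0 \<le> j then (U ^^ nat j) x else (adj U ^^ nat (- j)) x)"

lemma upow_succ: "upow (j + 1) x = U (upow j x)"
proof -
  consider "0 \<le> j" | "j = -1" | "j < -1" by linarith
  then show ?thesis
  proof cases
    case 1
    then show ?thesis by (simp add: upow_def nat_add_distrib)
  next
    case 2
    then show ?thesis by (simp add: upow_def U_adj)
  next
    case 3
    then have "nat (- j) = Suc (nat (- (j + 1)))" by simp
    then show ?thesis using 3 by (simp add: upow_def U_adj)
  qed
qed

lemma upow_in:
  assumes "x \<in> K" "\<And>y. y \<in> K \<Longrightarrow> U y \<in> K" "\<And>y. y \<in> K \<Longrightarrow> adj U y \<in> K" shows "upow j x \<in> K"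
proof -
  have "(U ^^ n) x \<in> K" "(adj U ^^ n) x \<in> K" for n by (induction n) (auto simp: assms)
  then show ?thesis by (simp add: upow_def)
qed

lemma cinner_upow: "cinner (upow j x) (upow k y) = cinner (upow (j - k) x) y"
proof -
  have shift: "cinner (upow (j + 1) x) (upow (k + 1) y) = cinner (upow j x) (upow k y)" for j k
    by (simp add: upow_succ cinner_adj[OF U] adj_U)
  show ?thesis
  proof (induction k arbitrary: j rule: int_induct[of _ 0])
    case base then show ?case by (simp add: upow_def)
  next
    case (step1 k)
    then show ?case using shift[of "j - 1" k] by (simp add: algebra_simps)
  next
    case (step2 k)
    then show ?case using shift[of j "k - 1"] by (simp add: algebra_simps)
  qed
qed

lemma upow_orthogonal:
  assumes z: "\<And>n. 0 < n \<Longrightarrow> cinner ((U ^^ n) z) z = 0" and "j \<noteq> k"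
  shows "cinner (upow j z) (upow k z) = 0"
proof -
  have *: "cinner (upow j z) (upow k z) = 0" if "k < j" for j k
    using that z[of "nat (j - k)"] by (simp add: cinner_upow) (simp add: upow_def)
  show ?thesis using assms(2) *[of k j] *[of j k] cinner_eq_0_sym by (metis linorder_neqE)
qed

lemma norm_upow: "norm (upow j x) = norm x"
  using cinner_upow[of j x j x] by (simp add: upow_def norm_eq_sqrt_cinner)

end

lemma synth_isometric:
  fixes g :: "'i \<Rightarrow> 'a::complex_hilbert_space"
  assumes orth: "\<And>i j. i \<noteq> j \<Longrightarrow> cinner (g i) (g j) = 0" and unit: "\<And>i. norm (g i) = 1"
  shows "norm (synth g f) = norm f"
proof -
  have b: "bessel g 1" using assms by (intro bessel_orthonormal) auto
  have "analysis g (synth g f) = f"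
  proof (rule l2_basis_agree[OF cbop_compose[OF cbop_analysis[OF b] cbop_synth[OF b]] cbop_id(1)])
    fix i
    show "analysis g (synth g (l2_single i 1)) = l2_single i 1"
      by (rule l2_eqI) (simp add: synth_single[OF b] l2_nth_analysis[OF b] l2_nth_single orth
          cinner_self unit)
  qed
  then have "cinner (synth g f) (synth g f) = cinner f f" by (simp add: cinner_synth[OF b])
  then show ?thesis by (simp add: norm_eq_sqrt_cinner)
qed

lemma norm_l2_finite_support:
  fixes f :: "('i, 'a::complex_hilbert_space) l2"
  assumes "finite F" "\<And>i. i \<notin> F \<Longrightarrow> l2_nth f i = 0"
  shows "(norm f)\<^sup>2 = (\<Sum>i\<in>F. (norm (l2_nth f i))\<^sup>2)"
proof -
  have "(\<Sum>\<^sub>\<infinity>i. (norm (l2_nth f i))\<^sup>2) = (\<Sum>\<^sub>\<infinity>i\<in>F. (norm (l2_nth f i))\<^sup>2)"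
    using assms by (intro infsum_cong_neutral) auto
  then show ?thesis using assms(1) by (simp add: norm_l2_def sum_nonneg)
qed

context iso_tuple begin

lemma exists_wandering_if_one_letter:
  fixes z :: "('i, 'a) l2"
  assumes I: "I = {a}" and z: "wandering I (\<lambda>i. l2_map (S i)) z" "z \<noteq> 0"
    and F: "finite F" "\<And>i. i \<notin> F \<Longrightarrow> l2_nth z i = 0"
  shows "\<exists>w. wandering I S w \<and> w \<noteq> 0"
proof (rule ccontr)
  assume none: "\<not> ?thesis"
  note no = no_wandering[OF none]
  have a: "a \<in> I" by (simp add: I)
  let ?U = "S a" and ?W = "l2_map (S a) :: ('i, 'a) l2 \<Rightarrow> _"
  note U = S_cbop[OF a]
  \<comment> \<open>Without wandering vectors the isometry has total range, so it is
    unitary.\<close>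
  have U_adj: "?U (adj ?U x) = x" for x
  proof -
    define D where "D = {x. ?U (adj ?U x) - x \<in> {0}}"
    have "csub D" unfolding D_def
      by (rule cbop_preimage_csub[OF cbop_minus[OF cbop_compose[OF U cbop_adj[OF U]] cbop_id(1)]])
          (simp add: csub_def)
    moreover have "{foldr S b h | b h. b \<in> {b \<in> lists I. length b = 1}} \<subseteq> D"
    proof
      fix y assume "y \<in> {foldr S b h | b h. b \<in> {b \<in> lists I. length b = 1}}"
      then obtain b h where b: "y = foldr S b h" "b \<in> lists I" "length b = 1" by blast
      then have "b = [a]" using I by (cases b) auto
      then show "y \<in> D" using b(1) by (simp add: D_def adj_S_same[OF a])
    qed
    ultimately have "csub hull {foldr S b h | b h. b \<in> {b \<in> lists I. length b = 1}} \<subseteq> D"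
        by (intro hull_minimal)
    then show ?thesis using total_ranges[OF no, of x 1] by (auto simp: D_def)
  qed
  interpret U: unitary ?U
    by unfold_locales (simp_all add: U adj_S_same[OF a] U_adj)
  interpret W: unitary ?W
    by unfold_locales
      (auto intro!: l2_eqI simp: cbop_l2_map U adj_l2_map l2_nth_map cbop_adj adj_S_same[OF a]
          U_adj)
  obtain z' :: "('i, 'a) l2" where z': "wandering I (\<lambda>i. l2_map (S i)) z'" "norm z' = 1"
      "z' = complex_of_real (inverse (norm z)) *\<^sub>C z"
    using wandering_normalize[OF iso_tuple_l2 z] by metis
  have z'F: "l2_nth z' i = 0" if "i \<notin> F" for i using F(2)[OF that] by (simp add: z'(3))
  have orth: "cinner ((?W ^^ n) z') z' = 0" if "0 < n" for n
  proof -
    have "replicate n a \<in> lists I" "replicate n a \<noteq> []" using a that by auto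
    then have "cinner (foldr (\<lambda>i. l2_map (S i)) (replicate n a) z') z' = 0"
      using z'(1) unfolding wandering_def by blast
    then show ?thesis by simp
  qed
  define g where "g j = W.upow j z'" for j
  have g: "\<And>i j. i \<noteq> j \<Longrightarrow> cinner (g i) (g j) = 0" "\<And>i. norm (g i) = 1"
    unfolding g_def using W.upow_orthogonal[OF orth] W.norm_upow z'(2) by auto
  have b: "bessel g 1" using g by (intro bessel_orthonormal) auto
  let ?D = "{f :: ('i, 'a) l2. \<forall>i. i \<notin> F \<longrightarrow> l2_nth f i = 0}"
  have "synth g f \<in> ?D" for f
  proof (rule synth_in[OF b csub_support])
    show "g i \<in> ?D" for i unfolding g_def
      by (rule W.upow_in) (auto simp: z'F l2_nth_map U adj_l2_map cbop_adj cbop_0)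
  qed
  \<comment> \<open>The coordinates are intertwiners that need not be bounded below individually,
    but their squares add up to that of an isometry. Merging them transfers a lower bound to a
    single intertwiner.\<close>
  then have norm_sum: "(norm f)\<^sup>2 = (\<Sum>i\<in>F. (norm (l2_nth (synth g f) i))\<^sup>2)" for f
    using norm_l2_finite_support[OF F(1), of "synth g f"] synth_isometric[of g f] g by simp
  have int: "U.intertwiner (\<lambda>f. l2_nth (synth g f) i)" for i
    unfolding U.intertwiner_def
  proof (intro conjI allI)
    show "cbop (\<lambda>f. l2_nth (synth g f) i)" by (rule cbop_compose[OF cbop_l2_nth cbop_synth[OF b]])
    have "synth g (bishift f) = ?W (synth g f)" for f
      by (rule l2_basis_agree[OF cbop_compose[OF cbop_synth[OF b] cbop_bishift] cbop_compose[OF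
          cbop_l2_map[OF U] cbop_synth[OF b]]])
        (simp add: bishift_single synth_single[OF b] g_def W.upow_succ)
    then show "l2_nth (synth g (bishift f)) i = ?U (l2_nth (synth g f) i)" for f
      by (simp add: l2_nth_map[OF U])
  qed
  obtain Y c where Y: "U.intertwiner Y" "0 < c" "\<And>f. (norm f)\<^sup>2 \<le> c * (norm (Y f))\<^sup>2"
    using U.intertwiner_merge_finite[OF F(1), of "\<lambda>i f. l2_nth (synth g f) i"] int
        unfolding norm_sum by blast
  have Yc: "cbop Y" and YB: "\<And>f. Y (bishift f) = ?U (Y f)" using Y(1)
      by (auto simp: U.intertwiner_def)
  have lower: "1 / sqrt c * norm f \<le> norm (Y f)" for f
  proof -
    have "norm f \<le> sqrt (c * (norm (Y f))\<^sup>2)" using Y(3) by (rule real_le_rsqrt)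
    then show ?thesis using Y(2) by (simp add: real_sqrt_mult field_simps)
  qed
  define y where "y = Y (l2_single 0 1)"
  \<comment> \<open>Being bounded below, \<open>Y\<close> maps \<open>M\<close> onto a closed
    subspace. It contains all images of \<open>y\<close> under nonempty words, but not
    \<open>y\<close> itself, the image of the basis vector at 0; so \<open>y\<close> is not in
    \<open>orb0 I S y\<close>.\<close>
  define M where "M = {f :: (int, complex) l2. l2_nth f 0 \<in> {0}}"
  have M: "csub M" unfolding M_def by (rule cbop_preimage_csub[OF cbop_l2_nth]) (simp add: csub_def)
  have "csub (Y ` M)" using Y(2) lower by (intro csub_image[OF Yc M, of "1 / sqrt c"]) auto
  moreover have "{foldr S v y | v. v \<in> lists I \<and> v \<noteq> []} \<subseteq> Y ` M"
  proof
    have wd: "foldr S v y = Y (l2_single (int (length v)) 1)" if "v \<in> lists I" for v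
      using that
    proof (induction v)
      case (Cons i v)
      then have "foldr S (i # v) y = ?U (Y (l2_single (int (length v)) 1))" using I by auto
      then show ?case by (simp add: bishift_single add.commute flip: YB)
    qed (simp add: y_def)
    fix h assume "h \<in> {foldr S v y | v. v \<in> lists I \<and> v \<noteq> []}"
    then obtain v where v: "v \<in> lists I" "v \<noteq> []" "h = foldr S v y" by blast
    have "l2_single (int (length v)) 1 \<in> M" using v(2) by (simp add: M_def l2_nth_single)
    then show "h \<in> Y ` M" using wd[OF v(1)] v(3) by blast
  qed
  ultimately have "orb0 I S y \<subseteq> Y ` M" unfolding orb0_def by (intro hull_minimal)
  then obtain f where f: "f \<in> M" "y = Y f" using no[of y] by blast
  have "norm (l2_single 0 1 - f) \<le> 0"
    using lower[of "l2_single 0 1 - f"] Y(2) f(2)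
    by (simp add: cbop_diff[OF Yc] y_def divide_le_0_iff)
  then have "f = l2_single 0 1" by simp
  then show False using f(1) by (simp add: M_def l2_nth_single)
qed

end

subsection \<open>The weak operator topology\<close>

lemma continuous_map_wot:
  "continuous_map weak_operator_topology euclidean (\<lambda>A :: 'a::complex_hilbert_space \<Rightarrow> 'a. cinner
      (A x) y)"
proof -
  have "continuous_map euclidean euclidean (\<lambda>\<phi> :: 'a \<times> 'a \<Rightarrow> complex. \<phi> (x, y))"
    by (simp add: continuous_on_product_coordinates)
  then have "continuous_map (weak_operator_topology :: ('a \<Rightarrow> 'a) topology) euclidean
      ((\<lambda>\<phi>. \<phi> (x, y)) \<circ> (\<lambda>A (x, y). cinner (A x) y))"
    unfolding weak_operator_topology_def by (rule continuous_map_pullback)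
  then show ?thesis by (simp add: comp_def)
qed

lemma topspace_wot: "topspace weak_operator_topology = bounded_operators"
  by (simp add: weak_operator_topology_def topspace_pullback_topology)

lemma closedin_wot_cinner: "closedin weak_operator_topology {A \<in> bounded_operators. cinner (A x) y
    = 0}"
  using closedin_continuous_map_preimage[OF continuous_map_wot, of "{0}" x y]
      by (simp add: topspace_wot)

lemma operator_algebra_bounded_operators: "operator_algebra bounded_operators"
  unfolding operator_algebra_def operator_subspace_def bounded_operators_cbop
  by (auto simp: bounded_operators_cbop cbop_plus cbop_scaleC comp_def cbop_compose)

text \<open>The open set missing \<open>\<A>\<close> is pulled back from a product, where a basic
  box restricts only finitely many coordinates, here pairs of vectors.\<close>

lemma wot_neighbourhood:
  assumes closed: "closedin weak_operator_topology \<A>" and T: "T \<in> bounded_operators" "T \<notin> \<A>"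
  obtains J W where "finite J" "\<And>x y. (x, y) \<in> J \<Longrightarrow> open (W x y)" "\<And>x y. (x, y) \<in> J \<Longrightarrow> cinner (T x)
      y \<in> W x y"
    "\<And>A. A \<in> \<A> \<Longrightarrow> \<exists>x y. (x, y) \<in> J \<and> cinner (A x) y \<notin> W x y"
proof -
  have "openin weak_operator_topology (bounded_operators - \<A>)"
    using closed by (simp add: closedin_def topspace_wot)
  then obtain V where V: "open V" "bounded_operators - \<A> = (\<lambda>A (x, y). cinner (A x) y)
      -` V \<inter> bounded_operators"
    unfolding weak_operator_topology_def openin_pullback_topology by auto
  have sub: "\<A> \<subseteq> bounded_operators" using closedin_subset[OF closed] by (simp add: topspace_wot)
  let ?t = "\<lambda>(x, y). cinner (T x) y"
  have tV: "?t \<in> V" using T V(2) by blast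
  have "openin (product_topology (\<lambda>_. euclidean) UNIV) V" using V(1) by (simp only: open_fun_def)
  from product_topology_open_contains_basis[OF this tV]
  have "\<exists>X. ?t \<in> (\<Pi>\<^sub>E i\<in>UNIV. X i) \<and> (\<forall>i. open (X i)) \<and> finite {i. X i \<noteq> UNIV} \<and> (\<Pi>\<^sub>E i\<in>UNIV. X i)
      \<subseteq> V"
    by simp
  then obtain X where "?t \<in> (\<Pi>\<^sub>E i\<in>UNIV. X i) \<and> (\<forall>i. open (X i)) \<and> finite {i. X i \<noteq> UNIV}
      \<and> (\<Pi>\<^sub>E i\<in>UNIV. X i) \<subseteq> V"
    by (rule exE)
  then have X: "?t \<in> (\<Pi>\<^sub>E i\<in>UNIV. X i)" "open (X i)" "finite {i. X i \<noteq> UNIV}" "(\<Pi>\<^sub>E i\<in>UNIV. X i) \<subseteq>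
      V" for i
    by blast+
  show thesis
  proof (rule that[of "{i. X i \<noteq> UNIV}" "\<lambda>x y. X (x, y)"])
    show "finite {i. X i \<noteq> UNIV}" by (rule X)
    show "open (X (x, y))" for x y by (rule X)
    show "cinner (T x) y \<in> X (x, y)" for x y using X(1) by (auto simp: PiE_iff)
    show "\<exists>x y. (x, y) \<in> {i. X i \<noteq> UNIV} \<and> cinner (A x) y \<notin> X (x, y)" if A: "A \<in> \<A>" for A
    proof (rule ccontr)
      assume *: "\<not> ?thesis"
      have "(\<lambda>(x, y). cinner (A x) y) \<in> (\<Pi>\<^sub>E i\<in>UNIV. X i)"
      proof (rule PiE_I)
        fix i :: "'a \<times> 'a"
        show "(case i of (x, y) \<Rightarrow> cinner (A x) y) \<in> X i" using * by (cases i; cases "X i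
            = UNIV") auto
      qed simp
      then have "A \<in> bounded_operators - \<A>" unfolding V(2) using X(4) A sub by blast
      then show False using A by simp
    qed
  qed
qed

text \<open>The defining conditions pass to intersections; the family is nonempty since it contains
  \<open>bounded_operators\<close>, which closedness of the intersection requires.\<close>

lemma free_semigroup_algebra_closed:
  fixes S :: "nat \<Rightarrow> 'a::complex_hilbert_space \<Rightarrow> 'a"
  assumes S: "\<And>i. enat i < n \<Longrightarrow> cbop (S i)"
  defines "\<A> \<equiv> free_semigroup_algebra n S"
  shows "operator_algebra \<A>" "closedin weak_operator_topology \<A>" "id \<in> \<A>" "\<And>i. enat i < n \<Longrightarrow> S i \<in> \<A>"
proof -
  define F where "F = {\<B>. (operator_algebra \<B> \<and> closedin weak_operator_topology \<B>)
      \<and> insert id {S i |i. enat i < n} \<subseteq> \<B>}"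
  have A: "\<A> = \<Inter>F" by (simp add: \<A>_def free_semigroup_algebra_def hull_def F_def)
  have "closedin weak_operator_topology bounded_operators"
    using closedin_topspace[of weak_operator_topology] by (simp only: topspace_wot)
  then have B: "bounded_operators \<in> F"
    using S by (auto simp: F_def operator_algebra_bounded_operators bounded_operators_cbop)
  have F: "\<B> \<subseteq> bounded_operators" "(\<lambda>x. 0) \<in> \<B>"
    "\<And>X Y. X \<in> \<B> \<Longrightarrow> Y \<in> \<B> \<Longrightarrow> (\<lambda>x. X x + Y x) \<in> \<B>"
    "\<And>c X. X \<in> \<B> \<Longrightarrow> (\<lambda>x. c *\<^sub>C X x) \<in> \<B>"
    "\<And>X Y. X \<in> \<B> \<Longrightarrow> Y \<in> \<B> \<Longrightarrow> X \<circ> Y \<in> \<B>" "closedin weak_operator_topology \<B>" if "\<B> \<in> F" for \<B>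
    using that by (auto simp: F_def operator_algebra_def operator_subspace_def)
  show "operator_algebra \<A>"
    unfolding operator_algebra_def operator_subspace_def A
  proof (intro conjI ballI allI InterI)
    show "\<Inter>F \<subseteq> bounded_operators" using B by (rule Inter_lower)
    show "(\<lambda>x. 0) \<in> \<B>" if "\<B> \<in> F" for \<B> by (rule F(2)[OF that])
    show "(\<lambda>x. X x + Y x) \<in> \<B>" if "X \<in> \<Inter>F" "Y \<in> \<Inter>F" "\<B> \<in> F" for X Y \<B>
      by (rule F(3)[OF that(3) InterD[OF that(1,3)] InterD[OF that(2,3)]])
    show "(\<lambda>x. c *\<^sub>C X x) \<in> \<B>" if "X \<in> \<Inter>F" "\<B> \<in> F" for c X \<B>
      by (rule F(4)[OF that(2) InterD[OF that]])
    show "X \<circ> Y \<in> \<B>" if "X \<in> \<Inter>F" "Y \<in> \<Inter>F" "\<B> \<in> F" for X Y \<B>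
      by (rule F(5)[OF that(3) InterD[OF that(1,3)] InterD[OF that(2,3)]])
  qed
  show "closedin weak_operator_topology \<A>" unfolding A using F B by (intro closedin_Inter) auto
  show "id \<in> \<A>" "\<And>i. enat i < n \<Longrightarrow> S i \<in> \<A>" unfolding A F_def by auto
qed

text \<open>The bounded operators that map every x into its \<open>orb\<close> form an algebra
  containing the generators. It is weakly closed because membership in a closed subspace is tested
  by matrix coefficients against the orthogonal complement.\<close>

lemma free_semigroup_algebra_in_orb:
  fixes S :: "nat \<Rightarrow> 'a::complex_hilbert_space \<Rightarrow> 'a"
  assumes S: "iso_tuple {i. enat i < n} S" and A: "A \<in> free_semigroup_algebra n S"
  shows "A x \<in> orb {i. enat i < n} S x"
proof -
  let ?I = "{i. enat i < n}"
  interpret iso_tuple ?I S by (rule S)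
  define \<B> where "\<B> = {A. cbop A \<and> (\<forall>x. A x \<in> orb ?I S x)}"
  have "operator_subspace \<B>"
    unfolding operator_subspace_def \<B>_def
    by (auto simp: bounded_operators_cbop cbop_plus cbop_scaleC csub_0[OF csub_orb] csub_add[OF
        csub_orb] csub_scale[OF csub_orb])
  moreover have "X \<circ> Y \<in> \<B>" if "X \<in> \<B>" "Y \<in> \<B>" for X Y
  proof -
    have "X (Y x) \<in> orb ?I S x" for x
      using that orb_mono[of "Y x" x] by (auto simp: \<B>_def)
    then show ?thesis using that by (auto simp: \<B>_def comp_def intro: cbop_compose)
  qed
  ultimately have "operator_algebra \<B>" by (simp add: operator_algebra_def)
  moreover have "closedin weak_operator_topology \<B>"
  proof -
    define C where "C = insert bounded_operators
      {{A \<in> bounded_operators. cinner (A x) y = 0} | x y. \<forall>z\<in>orb ?I S x. cinner y z = 0}"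
    have "\<B> = \<Inter>C"
    proof (intro equalityI subsetI)
      fix X assume "X \<in> \<B>"
      then show "X \<in> \<Inter>C"
        using cinner_eq_0_sym by (fastforce simp: \<B>_def C_def bounded_operators_cbop)
    next
      fix X assume X: "X \<in> \<Inter>C"
      have "X x \<in> orb ?I S x" for x
      proof (rule csub_bicomplement[OF csub_orb])
        fix y assume "\<And>z. z \<in> orb ?I S x \<Longrightarrow> cinner y z = 0"
        then have "{A \<in> bounded_operators. cinner (A x) y = 0} \<in> C" unfolding C_def by blast
        then show "cinner (X x) y = 0" using X by blast
      qed
      then show "X \<in> \<B>" using X by (auto simp: \<B>_def C_def bounded_operators_cbop)
    qed
    moreover have "closedin weak_operator_topology bounded_operators"
      using closedin_topspace[of weak_operator_topology] by (simp only: topspace_wot)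
    then have "closedin weak_operator_topology K" if "K \<in> C" for K
      using that closedin_wot_cinner by (auto simp: C_def)
    then have "closedin weak_operator_topology (\<Inter>C)" by (intro closedin_Inter) (auto simp: C_def)
    ultimately show ?thesis by simp
  qed
  moreover have "insert id {S i |i. enat i < n} \<subseteq> \<B>"
    using S_cbop S_in_orb'[OF _ orb_self] by (auto simp: \<B>_def orb_self)
  ultimately have "free_semigroup_algebra n S \<subseteq> \<B>"
    unfolding free_semigroup_algebra_def by (intro hull_minimal) auto
  then show ?thesis using A by (auto simp: \<B>_def)
qed

theorem corollary4p14:
  fixes n :: enat
    and S :: "nat \<Rightarrow> 'a::complex_hilbert_space \<Rightarrow> 'a"
  assumes "1 \<le> n"
    and "isometric_tuple n S"
  shows "reflexive_subspace (free_semigroup_algebra n S)"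
proof -
  let ?I = "{i. enat i < n}" and ?A = "free_semigroup_algebra n S"
  have Sc: "cbop (S i)" if "i \<in> ?I" for i
    using assms(2) that by (auto simp: isometric_tuple_def bounded_operators_cbop)
  have S: "iso_tuple ?I S"
  proof
    fix i j x y assume i: "i \<in> ?I"
    show "cbop (S i)" by (rule Sc[OF i])
    note adj = cadjoint_eq_adj[OF Sc[OF i]]
    have "cadjoint (S i) \<circ> S i = id" using assms(2) i by (simp add: isometric_tuple_def)
    then have "adj (S i) (S i y) = y" unfolding adj by (metis comp_apply id_apply)
    then show "cinner (S i x) (S i y) = cinner x y" by (simp add: cinner_adj[OF Sc[OF i]])
    assume j: "j \<in> ?I" and ij: "i \<noteq> j"
    have "cadjoint (S i) \<circ> S j = (\<lambda>x. 0)" using assms(2) i j ij by (simp add: isometric_tuple_def)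
    then have "adj (S i) (S j y) = 0" unfolding adj by (metis comp_apply)
    then show "cinner (S i x) (S j y) = 0" by (simp add: cinner_adj[OF Sc[OF i]])
  qed
  interpret iso_tuple ?I S by (rule S)
  note alg = free_semigroup_algebra_closed[of n S, OF Sc, simplified]
  have sub: "operator_subspace ?A" using alg(1) by (simp add: operator_algebra_def)
  have A: "cbop X" if "X \<in> ?A" for X
    using sub that by (auto simp: operator_subspace_def bounded_operators_cbop)
  \<comment> \<open>\<open>1 \<le> n\<close> provides the letter whose powers serve as
    S_a^k.\<close>
  have 0: "0 \<in> ?I" using assms(1) by (cases n) (auto simp: one_enat_def)
  have wdA: "foldr S v \<in> ?A" if "v \<in> lists ?I" for v
    using that
  proof (induction v)
    case Nil then show ?case using alg(3) by (simp add: id_def)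
  next
    case (Cons i v)
    then have "S i \<circ> foldr S v \<in> ?A" using alg(1,4) unfolding operator_algebra_def by blast
    then show ?case by (simp add: comp_def)
  qed
  have "T \<in> ?A" if T: "T \<in> bounded_operators" and Tx: "\<forall>x. T x \<in> closure {X x |X. X \<in> ?A}" for T
  proof (rule ccontr)
    assume nT: "T \<notin> ?A"
    have Tc: "cbop T" using T by (simp add: bounded_operators_cbop)
    have Torb: "T x \<in> orb ?I S x" for x
    proof -
      have "closure {X x |X. X \<in> ?A} \<subseteq> orb ?I S x"
        using free_semigroup_algebra_in_orb[OF S] by (intro closure_minimal csub_closed csub_orb)
            auto
      then show ?thesis using Tx by blast
    qed
    obtain J W where J: "finite J" "\<And>x y. (x, y) \<in> J \<Longrightarrow> open (W x y)" "\<And>x y. (x, y) \<in> J \<Longrightarrow> cinner (T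
        x) y \<in> W x y"
      "\<And>A. A \<in> ?A \<Longrightarrow> \<exists>x y. (x, y) \<in> J \<and> cinner (A x) y \<notin> W x y"
      using wot_neighbourhood[OF alg(2) T nT] by metis
    \<comment> \<open>The ampliation is indexed by the test pairs themselves, and the coordinate at
      \<open>(x, y)\<close> is x.\<close>
    define \<xi> where "\<xi> = (\<Sum>j\<in>J. l2_single j (fst j))"
    have \<xi>: "l2_nth \<xi> j = (if j \<in> J then fst j else 0)" for j
    proof -
      have "l2_nth \<xi> j = (\<Sum>i\<in>J. l2_nth (l2_single i (fst i)) j)"
        unfolding \<xi>_def by (rule cbop_sum[OF cbop_l2_nth])
      then show ?thesis using J(1) by (simp add: l2_nth_single)
    qed
    have in_orb: "l2_map T \<xi> \<in> orb ?I (\<lambda>i. l2_map (S i)) \<xi>"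
    proof (rule preserves_orb_l2[OF Tc Torb 0 _ J(1)])
      fix z :: "('a \<times> 'a, 'a) l2"
      assume z: "wandering ?I (\<lambda>i. l2_map (S i)) z" "z \<noteq> 0" "\<And>i. i \<notin> J \<Longrightarrow> l2_nth z i = 0"
      show "\<exists>w. wandering ?I S w \<and> w \<noteq> 0"
      proof (cases "?I = {0}")
        case True
        then show ?thesis using exists_wandering_if_one_letter[OF True z(1,2) J(1) z(3)] by blast
      next
        case False
        then obtain q where "q \<in> ?I" "0 \<noteq> q" using 0 by blast
        then show ?thesis using exists_wandering_if_two_letters[OF 0 _ _ z(1,2)] by blast
      qed
    qed (simp add: \<xi>)
    \<comment> \<open>The closure of \<open>D\<close> contains all words applied to
      \<open>\<xi>\<close>, hence the ampliation of \<open>T\<close> at \<open>\<xi>\<close>. A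
      sequence in \<open>D\<close> converging to it gives operators of the algebra that converge to
      \<open>T\<close> at all first components of \<open>J\<close>.\<close>
    define D where "D = {l2_map X \<xi> | X. X \<in> ?A}"
    have "csub (closure D)"
    proof (rule csub_closure)
      have "0 = l2_map (\<lambda>x. 0) \<xi>" by (rule l2_eqI) (simp add: l2_nth_map)
      moreover have "(\<lambda>x. 0) \<in> ?A" using sub by (simp add: operator_subspace_def)
      ultimately show "0 \<in> D" unfolding D_def by blast
      show "f + g \<in> D" if fg: "f \<in> D" "g \<in> D" for f g
      proof -
        obtain X Y where X: "f = l2_map X \<xi>" "X \<in> ?A" and Y: "g = l2_map Y \<xi>" "Y \<in> ?A"
          using fg unfolding D_def by blast
        have "(\<lambda>x. X x + Y x) \<in> ?A" using sub X Y by (simp add: operator_subspace_def)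
        moreover have "f + g = l2_map (\<lambda>x. X x + Y x) \<xi>"
          by (rule l2_eqI) (simp add: X Y l2_nth_map A cbop_plus)
        ultimately show ?thesis unfolding D_def by blast
      qed
      show "c *\<^sub>C f \<in> D" if f: "f \<in> D" for c f
      proof -
        obtain X where X: "f = l2_map X \<xi>" "X \<in> ?A" using f unfolding D_def by blast
        have "(\<lambda>x. c *\<^sub>C X x) \<in> ?A" using sub X by (simp add: operator_subspace_def)
        moreover have "c *\<^sub>C f = l2_map (\<lambda>x. c *\<^sub>C X x) \<xi>"
          by (rule l2_eqI) (simp add: X l2_nth_map A cbop_scaleC)
        ultimately show ?thesis unfolding D_def by blast
      qed
    qed
    moreover have "{foldr (\<lambda>i. l2_map (S i)) v \<xi> | v. v \<in> lists ?I} \<subseteq> closure D"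
    proof
      fix f assume "f \<in> {foldr (\<lambda>i. l2_map (S i)) v \<xi> | v. v \<in> lists ?I}"
      then obtain v where v: "v \<in> lists ?I" "f = foldr (\<lambda>i. l2_map (S i)) v \<xi>" by blast
      have "l2_nth f j = l2_nth (l2_map (foldr S v) \<xi>) j" for j
        unfolding v(2) l2_nth_map[OF wd_cbop[OF v(1)]] by (rule foldr_l2_map[OF S_cbop v(1)])
      then have "f = l2_map (foldr S v) \<xi>" by (rule l2_eqI)
      then have "f \<in> D" unfolding D_def using wdA[OF v(1)] by (intro CollectI exI conjI)
      then show "f \<in> closure D" by (rule subsetD[OF closure_subset])
    qed
    ultimately have "orb ?I (\<lambda>i. l2_map (S i)) \<xi> \<subseteq> closure D" unfolding orb_def
        by (intro hull_minimal)
    then have "l2_map T \<xi> \<in> closure D" using in_orb by blast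
    then obtain h where h: "\<And>k. h k \<in> D" "h \<longlonglongrightarrow> l2_map T \<xi>" unfolding closure_sequential by blast
    then obtain X where X: "\<And>k. X k \<in> ?A" "\<And>k. h k = l2_map (X k) \<xi>" unfolding D_def
        by (auto, metis)
    have "\<forall>\<^sub>F k in sequentially. cinner (X k x) y \<in> W x y" if xy: "(x, y) \<in> J" for x y
    proof -
      have "(\<lambda>k. l2_nth (h k) (x, y)) \<longlonglongrightarrow> l2_nth (l2_map T \<xi>) (x, y)"
        by (rule bounded_linear.tendsto[OF cbop_bl[OF cbop_l2_nth] h(2)])
      then have "(\<lambda>k. X k x) \<longlonglongrightarrow> T x" using xy by (simp add: X(2) l2_nth_map A[OF X(1)] Tc \<xi>)
      then have "(\<lambda>k. cinner (X k x) y) \<longlonglongrightarrow> cinner (T x) y" by (intro cinner.tendsto tendsto_const)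
      then show ?thesis using topological_tendstoD J(2,3)[OF xy] by blast
    qed
    then have "\<forall>j\<in>J. \<forall>\<^sub>F k in sequentially. cinner (X k (fst j)) (snd j) \<in> W (fst j) (snd j)"
        by auto
    then have "\<forall>\<^sub>F k in sequentially. \<forall>j\<in>J. cinner (X k (fst j)) (snd j) \<in> W (fst j) (snd j)"
      by (rule eventually_ball_finite[OF J(1)])
    then obtain k where "\<forall>j\<in>J. cinner (X k (fst j)) (snd j) \<in> W (fst j) (snd j)"
      using eventually_happens'[OF sequentially_bot] by blast
    then show False using J(4)[OF X(1)[of k]] by fastforce
  qed
  then show ?thesis unfolding reflexive_subspace_def using sub by blast
qed

end
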